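(* Let $0<p<\infty$ and $\omega\in\widehat{\mathcal{D}}$, and let $(\mu_n)$ be a sequence of $p$-Carleson measures for $A^p_\omega$ such that $\sup_n\|M_\omega(\mu_n)\|_{L^\infty}<\infty$. Then $(\mu_n)$ has a weakly convergent subsequence. Further, if $\mu_n\rightharpoonup\mu$, then $$\lim_{n\to\infty}\int_{\mathbb{D}}|f(z)|^p\,d\mu_n(z)=\int_{\mathbb{D}}|f(z)|^p\,d\mu(z),\quad f\in A^p_\omega,$$ and $\mu$ is a $p$-Carleson measure for $A^p_\omega$ with $\|Id\|_{A^p_\omega\to L^p_\mu}\le\liminf_{n\to\infty}\|Id\|_{A^p_\omega\to L^p_{\mu_n}}$. Furthermore, if the $\mu_n$ are sampling measures for $A^p_\omega$ with sampling constants at most $\Lambda>0$, then $\mu$ is also a sampling measure for $A^p_\omega$ with a sampling constant at most $\Lambda$.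
   Context: $\mathbb{D}=\{z\in\mathbb{C}:|z|<1\}$, $\mathcal{H}(\mathbb{D})$ is the space of analytic functions in $\mathbb{D}$, and $dA(z)=\frac{dx\,dy}{\pi}$. A weight is a function $\omega:\mathbb{D}\to[0,\infty)$ integrable over $\mathbb{D}$ (with respect to $dA$); it is radial if $\omega(z)=\omega(|z|)$; $\omega(E)=\int_E\omega\,dA$. $A^p_\omega$ consists of $f\in\mathcal{H}(\mathbb{D})$ with $\|f\|_{A^p_\omega}^p=\int_{\mathbb{D}}|f|^p\omega\,dA<\infty$. For a radial weight $\omega$ put $\widehat\omega(z)=\int_{|z|}^1\omega(s)\,ds$; it is assumed that $\widehat\omega(z)>0$ for all $z\in\mathbb{D}$. A radial weight $\omega$ belongs to $\widehat{\mathcal{D}}$ if there exists $C\ge1$ such that $\widehat\omega(r)\le C\widehat\omega(\frac{1+r}{2})$ for all $0\le r<1$. Carleson squares are the sets $S(a)=\{re^{i\theta}\in\mathbb{D}:|a|<r<1,\ |\arg(ae^{-i\theta})|<\frac{1-|a|}{2}\}$, $a\in\mathbb{D}\setminus\{0\}$. For a positive Borel measure $\mu$ on $\mathbb{D}$, $M_\omega(\mu)(z)=\sup_{S\ni z}\frac{\mu(S)}{\omega(S)}$, the supremum being over Carleson squares $S$ containing $z$. A positive Borel measure $\mu$ on $\mathbb{D}$ is a $p$-Carleson measure for $A^p_\omega$ if $A^p_\omega$ is continuously embedded into $L^p_\mu$; $\|Id\|_{A^p_\omega\to L^p_\mu}$ is the norm of the embedding, i.e. the smallest $C$ with $\|f\|_{L^p_\mu}\le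 C\|f\|_{A^p_\omega}$ for all $f\in A^p_\omega$. $\mu$ is a sampling measure for $A^p_\omega$ if $\int_{\mathbb{D}}|f|^p\,d\mu\asymp\|f\|_{A^p_\omega}^p$, $f\in A^p_\omega$; having sampling constant at most $\Lambda$ means $\Lambda^{-1}\|f\|_{A^p_\omega}^p\le\int_{\mathbb{D}}|f|^p\,d\mu\le\Lambda\|f\|_{A^p_\omega}^p$ for all $f\in A^p_\omega$. A sequence $(\mu_n)$ of measures on $\mathbb{D}$ converges weakly to a measure $\mu$, denoted $\mu_n\rightharpoonup\mu$, if $\int_{\mathbb{D}}h\,d\mu_n\to\int_{\mathbb{D}}h\,d\mu$ for all nonnegative continuous compactly supported functions $h$ in $\mathbb{D}$.
   Formalization: The Carleson squares also include S(0)=D in the definition of M_ω; with only a≠0 the first claim fails (μ_n=nδ_0 has M_ω(μ_n)=0 but no weakly convergent subsequence), so this in effect adds sup_n μ_n({0})<∞. *)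

theory Defs
  imports "HOL-Probability.Essential_Supremum" "HOL-Complex_Analysis.Complex_Analysis"
begin

abbreviation unit_disc :: "complex set" where
  "unit_disc \<equiv> ball 0 1"

text \<open>Normalised area measure $dA = dx\,dy/\pi$ on the disc, on the Lebesgue measurable subsets.\<close>

definition disc_area :: "complex measure" where
  "disc_area = scale_measure (ennreal (1 / pi)) (lebesgue_on unit_disc)"

definition weight :: "(complex \<Rightarrow> real) \<Rightarrow> bool" where
  "weight \<omega> \<longleftrightarrow> (\<forall>z\<in>unit_disc. 0 \<le> \<omega> z) \<and> integrable disc_area \<omega>"

definition radial_weight :: "(complex \<Rightarrow> real) \<Rightarrow> bool" where
  "radial_weight \<omega> \<longleftrightarrow> weight \<omega> \<and> (\<forall>z\<in>unit_disc. \<omega> z = \<omega> (of_real (cmod z)))"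

text \<open>The measure $E \mapsto \omega(E) = \int_E \omega\,dA$.\<close>

definition weight_measure :: "(complex \<Rightarrow> real) \<Rightarrow> complex measure" where
  "weight_measure \<omega> = density disc_area (\<lambda>z. ennreal (\<omega> z))"

text \<open>The tail integral $\widehat\omega$. It is extended-valued because an integrable radial weight
  may have $\widehat\omega(0) = \infty$, e.g. $\omega(z) = 1/|z|$; the doubling condition
  below rules this out.\<close>

definition weight_tail :: "(complex \<Rightarrow> real) \<Rightarrow> complex \<Rightarrow> ennreal" where
  "weight_tail \<omega> z = (\<integral>\<^sup>+ s \<in> {cmod z..<1}. ennreal (\<omega> (of_real s)) \<partial>lebesgue)"

definition D_hat :: "(complex \<Rightarrow> real) set" where
  "D_hat = {\<omega>. radial_weight \<omega> \<and>
     (\<exists>C::real. C \<ge> 1 \<and> (\<forall>r::real. 0 \<le> r \<and> r < 1 \<longrightarrow>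
        weight_tail \<omega> (of_real r) \<le> ennreal C * weight_tail \<omega> (of_real ((1 + r) / 2))))}"

text \<open>For \<open>a = 0\<close> the convention $S(0) = \mathbb{D}$ is used: no square $S(a)$ with
  $a \neq 0$ contains the origin, so without it the maximal function below would not see
  the mass of a measure at the origin.\<close>

definition carleson_square :: "complex \<Rightarrow> complex set" where
  "carleson_square a = (if a = 0 then unit_disc else
     {of_real r * cis \<theta> | r \<theta>. cmod a < r \<and> r < 1 \<and> \<bar>Arg (a * cis (- \<theta>))\<bar> < (1 - cmod a) / 2})"

definition disc_borel_measure :: "complex measure \<Rightarrow> bool" where
  "disc_borel_measure \<mu> \<longleftrightarrow> sets \<mu> = sets (restrict_space borel unit_disc)"

definition maximal_function ::
    "(complex \<Rightarrow> real) \<Rightarrow> complex measure \<Rightarrow> complex \<Rightarrow> ennreal" where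
  "maximal_function \<omega> \<mu> z =
     (SUP S \<in> {S \<in> carleson_square ` unit_disc. z \<in> S}. emeasure \<mu> S / emeasure (weight_measure \<omega>) S)"

definition integral_pow :: "real \<Rightarrow> complex measure \<Rightarrow> (complex \<Rightarrow> complex) \<Rightarrow> ennreal" where
  "integral_pow p \<mu> f = (\<integral>\<^sup>+ z. ennreal (cmod (f z) powr p) \<partial>\<mu>)"

definition Lp_norm :: "real \<Rightarrow> complex measure \<Rightarrow> (complex \<Rightarrow> complex) \<Rightarrow> ennreal" where
  "Lp_norm p \<mu> f = (if integral_pow p \<mu> f = \<infinity> then \<infinity>
     else ennreal (enn2real (integral_pow p \<mu> f) powr (1 / p)))"

definition bergman_space :: "real \<Rightarrow> (complex \<Rightarrow> real) \<Rightarrow> (complex \<Rightarrow> complex) set" where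
  "bergman_space p \<omega> =
     {f. f holomorphic_on unit_disc \<and> integral_pow p (weight_measure \<omega>) f < \<infinity>}"

abbreviation bergman_norm :: "real \<Rightarrow> (complex \<Rightarrow> real) \<Rightarrow> (complex \<Rightarrow> complex) \<Rightarrow> ennreal" where
  "bergman_norm p \<omega> \<equiv> Lp_norm p (weight_measure \<omega>)"

definition carleson_measure :: "real \<Rightarrow> (complex \<Rightarrow> real) \<Rightarrow> complex measure \<Rightarrow> bool" where
  "carleson_measure p \<omega> \<mu> \<longleftrightarrow> disc_borel_measure \<mu> \<and>
     (\<exists>C::real. \<forall>f \<in> bergman_space p \<omega>. Lp_norm p \<mu> f \<le> ennreal C * bergman_norm p \<omega> f)"

definition embedding_norm :: "real \<Rightarrow> (complex \<Rightarrow> real) \<Rightarrow> complex measure \<Rightarrow> ennreal" where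
  "embedding_norm p \<omega> \<mu> =
     Inf {C. \<forall>f \<in> bergman_space p \<omega>. Lp_norm p \<mu> f \<le> C * bergman_norm p \<omega> f}"

definition sampling_constant_le ::
    "real \<Rightarrow> (complex \<Rightarrow> real) \<Rightarrow> complex measure \<Rightarrow> real \<Rightarrow> bool" where
  "sampling_constant_le p \<omega> \<mu> \<Lambda> \<longleftrightarrow> (\<forall>f \<in> bergman_space p \<omega>.
     ennreal (1 / \<Lambda>) * integral_pow p (weight_measure \<omega>) f \<le> integral_pow p \<mu> f \<and>
     integral_pow p \<mu> f \<le> ennreal \<Lambda> * integral_pow p (weight_measure \<omega>) f)"

definition sampling_measure :: "real \<Rightarrow> (complex \<Rightarrow> real) \<Rightarrow> complex measure \<Rightarrow> bool" where
  "sampling_measure p \<omega> \<mu> \<longleftrightarrow>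
     disc_borel_measure \<mu> \<and> (\<exists>\<Lambda>>0. sampling_constant_le p \<omega> \<mu> \<Lambda>)"

definition disc_test_function :: "(complex \<Rightarrow> real) \<Rightarrow> bool" where
  "disc_test_function h \<longleftrightarrow> continuous_on unit_disc h \<and> (\<forall>z\<in>unit_disc. 0 \<le> h z) \<and>
     (\<exists>K. compact K \<and> K \<subseteq> unit_disc \<and> (\<forall>z \<in> unit_disc - K. h z = 0))"

definition converges_weakly :: "(nat \<Rightarrow> complex measure) \<Rightarrow> complex measure \<Rightarrow> bool" where
  "converges_weakly \<mu>s \<mu> \<longleftrightarrow> (\<forall>h. disc_test_function h \<longrightarrow>
     (\<lambda>n. \<integral>\<^sup>+ z. ennreal (h z) \<partial>\<mu>s n) \<longlonglongrightarrow> (\<integral>\<^sup>+ z. ennreal (h z) \<partial>\<mu>))"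

end

theory Submission
  imports Defs "HOL-Probability.Helly_Selection"
begin

text \<open>The core is a uniform Carleson embedding: if \<open>\<mu>(S) \<le> B \<omega>(S)\<close> for all Carleson squares, then
  \<open>\<integral>|f|\<^sup>p d\<mu> \<le> C B \<integral>|f|\<^sup>p \<omega> dA\<close> with \<open>C\<close> depending only on \<open>\<omega>\<close>. With \<open>u = |f|\<^bsup>p/2\<^esup>\<close>, Cauchy's formula
  for \<open>f\<close> times a high power of \<open>(1 - |z|\<^sup>2) / (1 - \<close>conj\<open>(z) w)\<close> bounds \<open>u(z)\<close> by a geometrically damped sum of
  \<open>\<omega>\<close>-averages of \<open>u\<close> over dilated Carleson regions at \<open>z\<close>, a high enough power beating the doubling constant of
  \<open>\<omega>\<close>; a Vitali covering argument turns this into the weak-type bound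
  \<open>\<mu>{u > s} \<le> (C B / s) \<integral>\<^bsub>{C u > s}\<^esub> u \<omega> dA\<close>, which is integrated in \<open>s\<close>.
  Applying the embedding to \<open>f(z) z\<^sup>k\<close> and letting \<open>k\<close> grow gives tightness of \<open>|f|\<^sup>p \<mu>\<^sub>n\<close> at the boundary
  uniformly in \<open>n\<close>, so weak convergence passes to the integrals of \<open>|f|\<^sup>p\<close>. A space-filling curve with a Borel right inverse
  transports weak compactness from the line (Helly) to the disc.\<close>

section \<open>Polar coordinates\<close>

text \<open>A weight in \<open>D_hat\<close> may vanish on whole annuli, and doubling controls only
  its tails, so |f(z)|^q cannot be compared with its \<open>\<omega>\<close>-average over a disc
  around z. The averaging has to reach the boundary: with \<open>\<delta>\<close> = 1 - |z|,
  Cauchy's formula is used on almost every circle of radius between 1 - \<open>\<delta>\<close>/2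
  and 1 and integrated against the radial density, which produces exactly a tail of the weight. A
  whole circle also sees points far from z; damping them is the task of the kernel. Its exponent is
  fixed by the doubling constant \<open>K\<close> of tents, because a tent enlarged 2^i times can
  weigh K^i times as much. Taking u = |f|^(p/2) moves every p to the exponent 2, strictly above the
  exponent 1 of the weak-type bound. Cutting the right side of that bound down to the set where u is
  large is essential: after multiplication by s the factor 1/s disappears, and only the cut makes
  the integral over s finite. The maximal function is bounded only almost everywhere. This still
  controls every square that is needed, since each of them contains a tent of positive weight and so
  a good point.\<close>

lemma measurable_Complex [measurable]:
  assumes [measurable]: "a \<in> borel_measurable M" "b \<in> borel_measurable M"
  shows "(\<lambda>x. Complex (a x) (b x)) \<in> borel_measurable M"
  unfolding Complex_eq by measurable

lemma measurable_rcis [measurable]: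
  assumes [measurable]: "a \<in> borel_measurable M" "b \<in> borel_measurable M"
  shows "(\<lambda>x. rcis (a x) (b x)) \<in> borel_measurable M"
  unfolding rcis_def cis_conv_exp by measurable

lemma measurable_tan [measurable]: "tan \<in> borel_measurable (borel :: real measure)"
  unfolding tan_def[abs_def] by measurable

lemma lborel_complex_eq_distr:
  "(lborel :: complex measure) = distr (lborel \<Otimes>\<^sub>M lborel) borel (\<lambda>(x, y). Complex x y)"
proof (rule lborel_eqI)
  have meas: "(\<lambda>(x, y). Complex x y) \<in> lborel \<Otimes>\<^sub>M lborel \<rightarrow>\<^sub>M borel"
    unfolding case_prod_beta by measurable
  fix l u :: complex
  assume le: "\<And>b. b \<in> Basis \<Longrightarrow> l \<bullet> b \<le> u \<bullet> b"
  then have "Re l \<le> Re u" "Im l \<le> Im u"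
    by (force simp: Basis_complex_def)+
  have "(\<lambda>(x, y). Complex x y) -` box l u \<inter> space (lborel \<Otimes>\<^sub>M lborel)
      = {Re l<..<Re u} \<times> {Im l<..<Im u}"
    by (auto simp: box_def Basis_complex_def space_pair_measure)
  then have "emeasure (distr (lborel \<Otimes>\<^sub>M lborel) borel (\<lambda>(x, y). Complex x y)) (box l u)
      = emeasure (lborel \<Otimes>\<^sub>M lborel) ({Re l<..<Re u} \<times> {Im l<..<Im u})"
    using meas by (subst emeasure_distr) auto
  also have "\<dots> = ennreal (Re u - Re l) * ennreal (Im u - Im l)"
    using \<open>Re l \<le> Re u\<close> \<open>Im l \<le> Im u\<close>
    by (subst lborel.emeasure_pair_measure_Times) auto
  also have "\<dots> = ennreal (\<Prod>b\<in>Basis. (u - l) \<bullet> b)"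
    using \<open>Re l \<le> Re u\<close> \<open>Im l \<le> Im u\<close>
    by (simp add: Basis_complex_def ennreal_mult complex_i_not_one[symmetric])
  finally show "emeasure (distr (lborel \<Otimes>\<^sub>M lborel) borel (\<lambda>(x, y). Complex x y)) (box l u)
      = ennreal (\<Prod>b\<in>Basis. (u - l) \<bullet> b)" .
qed simp

lemma nn_integral_lborel_complex:
  fixes g :: "complex \<Rightarrow> ennreal"
  assumes [measurable]: "g \<in> borel_measurable borel"
  shows "(\<integral>\<^sup>+z. g z \<partial>lborel) = (\<integral>\<^sup>+y. \<integral>\<^sup>+x. g (Complex x y) \<partial>lborel \<partial>lborel)"
proof -
  have meas [measurable]: "(\<lambda>(x, y). Complex x y) \<in> lborel \<Otimes>\<^sub>M lborel \<rightarrow>\<^sub>M borel"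
    unfolding case_prod_beta by measurable
  have "(\<integral>\<^sup>+z. g z \<partial>lborel) = (\<integral>\<^sup>+xy. g (case xy of (x, y) \<Rightarrow> Complex x y) \<partial>(lborel \<Otimes>\<^sub>M lborel))"
    by (subst lborel_complex_eq_distr, subst nn_integral_distr) auto
  also have "\<dots> = (\<integral>\<^sup>+y. \<integral>\<^sup>+x. g (Complex x y) \<partial>lborel \<partial>lborel)"
    by (subst lborel_pair.nn_integral_snd[symmetric]) auto
  finally show ?thesis .
qed

text \<open>The substitution is made on [-n, n], where \<open>tan\<close> is a smooth bijection from
  a compact interval, and monotone convergence in n does the rest.\<close>

lemma nn_integral_tan_substitution:
  fixes F :: "real \<Rightarrow> ennreal"
  assumes [measurable]: "F \<in> borel_measurable borel"
  shows "(\<integral>\<^sup>+s. F s \<partial>lborel)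
    = (\<integral>\<^sup>+\<theta>. F (tan \<theta>) * ennreal (1 / (cos \<theta>)\<^sup>2) * indicator {-(pi/2)<..<pi/2} \<theta> \<partial>lborel)"
proof -
  let ?G = "\<lambda>\<theta>. F (tan \<theta>) * ennreal (1 / (cos \<theta>)\<^sup>2)"
  let ?I = "\<lambda>n::nat. {- arctan (real n) .. arctan (real n)}"
  have step: "(\<integral>\<^sup>+s. F s * indicator {- real n..real n} s \<partial>lborel) = (\<integral>\<^sup>+\<theta>. ?G \<theta> * indicator (?I n) \<theta> \<partial>lborel)"
    for n :: nat
  \<comment> \<open>For n = 0 the interval is a single point, which the substitution rule excludes;
    both integrals are then zero.\<close>
  proof (cases "n = 0")
    case True
    have "AE s in lborel. s \<noteq> (0::real)" by (rule AE_lborel_singleton)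
    then show ?thesis using True
      by (auto intro!: nn_integral_cong_AE elim!: eventually_mono simp: indicator_def)
  next
    case False
    have c: "cos x > 0" if "x \<in> ?I n" for x
      using that arctan_lbound[of "real n"] arctan_ubound[of "real n"] by (intro cos_gt_zero_pi) auto
    have "(\<integral>\<^sup>+s. F s * indicator {tan (- arctan (real n))..tan (arctan (real n))} s \<partial>lborel)
      = (\<integral>\<^sup>+\<theta>. ?G \<theta> * indicator (?I n) \<theta> \<partial>lborel)"
    proof (rule nn_integral_substitution_aux)
      show "(tan has_real_derivative 1 / (cos x)\<^sup>2) (at x)" if "x \<in> ?I n" for x
        using c[OF that] by (auto intro!: derivative_eq_intros simp: divide_inverse)
      show "continuous_on (?I n) (\<lambda>x. 1 / (cos x)\<^sup>2)"
        using c by (intro continuous_intros) force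
      show "- arctan (real n) < arctan (real n)" using False by simp
    qed auto
    then show ?thesis by (simp add: tan_arctan)
  qed
  have "(\<integral>\<^sup>+s. F s \<partial>lborel) = (\<integral>\<^sup>+s. (SUP n. F s * indicator {- real n..real n} s) \<partial>lborel)"
  proof (rule nn_integral_cong)
    fix s :: real
    obtain n where n: "\<bar>s\<bar> \<le> real n" using real_arch_simple by blast
    show "F s = (SUP n. F s * indicator {- real n..real n} s)"
      using n by (intro antisym SUP_least) (auto simp: indicator_def intro!: SUP_upper2[of n])
  qed
  also have "\<dots> = (SUP n. \<integral>\<^sup>+s. F s * indicator {- real n..real n} s \<partial>lborel)"
    by (intro nn_integral_monotone_convergence_SUP)
       (auto simp: incseq_def le_fun_def indicator_def)
  also have "\<dots> = (SUP n. \<integral>\<^sup>+\<theta>. ?G \<theta> * indicator (?I n) \<theta> \<partial>lborel)"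
    by (simp add: step)
  also have "\<dots> = (\<integral>\<^sup>+\<theta>. (SUP n. ?G \<theta> * indicator (?I n) \<theta>) \<partial>lborel)"
  proof (intro nn_integral_monotone_convergence_SUP[symmetric])
    show "incseq (\<lambda>n \<theta>. ?G \<theta> * indicator (?I n) \<theta>)"
      by (auto simp: incseq_def le_fun_def indicator_def)
         (meson arctan_monotone' of_nat_mono order_trans neg_le_iff_le)+
  qed auto
  also have "\<dots> = (\<integral>\<^sup>+\<theta>. ?G \<theta> * indicator {-(pi/2)<..<pi/2} \<theta> \<partial>lborel)"
  proof (rule nn_integral_cong)
    fix \<theta> :: real
    show "(SUP n. ?G \<theta> * indicator (?I n) \<theta>) = ?G \<theta> * indicator {-(pi/2)<..<pi/2} \<theta>"
    proof (cases "\<theta> \<in> {-(pi/2)<..<pi/2}")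
      case True
      then have at: "arctan (tan \<theta>) = \<theta>" by (auto intro: arctan_tan)
      obtain n where n: "\<bar>tan \<theta>\<bar> \<le> real n" using real_arch_simple by blast
      then have "arctan (- real n) \<le> arctan (tan \<theta>)" "arctan (tan \<theta>) \<le> arctan (real n)"
        by (auto simp del: arctan_minus intro!: arctan_monotone')
      then have "\<theta> \<in> ?I n" using at by (simp add: arctan_minus)
      then show ?thesis using True
        by (intro antisym SUP_least) (auto simp: indicator_def intro!: SUP_upper2[of n])
    next
      case False
      then have "\<theta> \<notin> ?I n" for n
        using arctan_lbound[of "real n"] arctan_ubound[of "real n"] by auto
      then show ?thesis using False by simp
    qed
  qed
  finally show ?thesis by (simp add: mult.assoc)
qed

abbreviation circle_integral :: "(complex \<Rightarrow> ennreal) \<Rightarrow> real \<Rightarrow> ennreal" where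
  "circle_integral G \<rho> \<equiv> \<integral>\<^sup>+t\<in>{0<..<2*pi}. G (rcis \<rho> t) \<partial>lborel"

text \<open>The substitutions \<open>x = y s\<close>, \<open>s = tan \<theta>\<close>, \<open>y = \<rho> cos \<theta>\<close> are one-dimensional, which
  avoids the multivariate change of variables.\<close>

lemma nn_integral_polar:
  fixes g :: "complex \<Rightarrow> ennreal"
  assumes g [measurable]: "g \<in> borel_measurable borel"
  shows "(\<integral>\<^sup>+z. g z \<partial>lborel)
    = (\<integral>\<^sup>+\<rho>. ennreal \<rho> * circle_integral g \<rho> * indicator {0<..} \<rho> \<partial>lborel)"
proof -
  define H where "H \<phi> = (\<integral>\<^sup>+\<rho>. ennreal \<rho> * g (rcis \<rho> \<phi>) * indicator {0<..} \<rho> \<partial>lborel)" for \<phi>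
  have H_meas [measurable]: "H \<in> borel_measurable borel" unfolding H_def by measurable
  let ?T = "\<lambda>\<theta>. \<integral>\<^sup>+y. ennreal \<bar>y\<bar> * g (Complex (y * tan \<theta>) y) \<partial>lborel"
  let ?S = "\<lambda>\<theta>. \<integral>\<^sup>+\<rho>. ennreal \<bar>\<rho>\<bar> * g (Complex (\<rho> * sin \<theta>) (\<rho> * cos \<theta>)) \<partial>lborel"
  let ?R = "\<lambda>\<phi>. \<integral>\<^sup>+\<rho>. ennreal \<bar>\<rho>\<bar> * g (rcis \<rho> \<phi>) \<partial>lborel"
  let ?H = "\<lambda>\<phi>. H (pi + 1 * \<phi>) * indicator {pi<..<2*pi} (pi + 1 * \<phi>)"
  let ?Q = "\<lambda>\<rho> \<phi>. ennreal \<rho> * g (rcis \<rho> \<phi>) * indicator {0<..} \<rho> * indicator {0<..<2*pi} \<phi>"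
  have "(\<integral>\<^sup>+z. g z \<partial>lborel) = (\<integral>\<^sup>+y. \<integral>\<^sup>+x. g (Complex x y) \<partial>lborel \<partial>lborel)"
    by (rule nn_integral_lborel_complex) fact
  also have "\<dots> = (\<integral>\<^sup>+y. \<integral>\<^sup>+s. ennreal \<bar>y\<bar> * g (Complex (y * s) y) \<partial>lborel \<partial>lborel)"
  proof (rule nn_integral_cong_AE)
    have "AE y in lborel. y \<noteq> (0::real)" by (rule AE_lborel_singleton)
    then show "AE y in lborel. (\<integral>\<^sup>+x. g (Complex x y) \<partial>lborel)
        = (\<integral>\<^sup>+s. ennreal \<bar>y\<bar> * g (Complex (y * s) y) \<partial>lborel)"
    proof eventually_elim
      case (elim y)
      then show ?case
        by (subst nn_integral_real_affine[of _ y 0]) (auto simp: nn_integral_cmult)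
    qed
  qed
  also have "\<dots> = (\<integral>\<^sup>+s. \<integral>\<^sup>+y. ennreal \<bar>y\<bar> * g (Complex (y * s) y) \<partial>lborel \<partial>lborel)"
    by (rule lborel_pair.Fubini') measurable
  also have "\<dots> = (\<integral>\<^sup>+\<theta>. ?T \<theta>
      * ennreal (1 / (cos \<theta>)\<^sup>2) * indicator {-(pi/2)<..<pi/2} \<theta> \<partial>lborel)"
    by (rule nn_integral_tan_substitution) measurable
  also have "\<dots> = (\<integral>\<^sup>+\<theta>. ?S \<theta>
      * indicator {-(pi/2)<..<pi/2} \<theta> \<partial>lborel)"
  proof (rule nn_integral_cong)
    fix \<theta> :: real
    show "?T \<theta>
      * ennreal (1 / (cos \<theta>)\<^sup>2) * indicator {-(pi/2)<..<pi/2} \<theta>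
      = ?S \<theta>
      * indicator {-(pi/2)<..<pi/2} \<theta>"
    proof (cases "\<theta> \<in> {-(pi/2)<..<pi/2}")
      case True
      then have c: "cos \<theta> > 0" by (intro cos_gt_zero_pi) auto
      have "?T \<theta>
        = ennreal (cos \<theta>) * (\<integral>\<^sup>+\<rho>. ennreal \<bar>cos \<theta> * \<rho>\<bar> * g (Complex (cos \<theta> * \<rho> * tan \<theta>) (cos \<theta> * \<rho>)) \<partial>lborel)"
        using c by (subst nn_integral_real_affine[of _ "cos \<theta>" 0]) auto
      also have "(\<lambda>\<rho>. ennreal \<bar>cos \<theta> * \<rho>\<bar> * g (Complex (cos \<theta> * \<rho> * tan \<theta>) (cos \<theta> * \<rho>)))
        = (\<lambda>\<rho>. ennreal (cos \<theta>) * (ennreal \<bar>\<rho>\<bar> * g (Complex (\<rho> * sin \<theta>) (\<rho> * cos \<theta>))))"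
        using c by (auto simp: fun_eq_iff abs_mult ennreal_mult tan_def mult_ac)
      also have "(\<integral>\<^sup>+\<rho>. ennreal (cos \<theta>) * (ennreal \<bar>\<rho>\<bar> * g (Complex (\<rho> * sin \<theta>) (\<rho> * cos \<theta>))) \<partial>lborel)
        = ennreal (cos \<theta>) * ?S \<theta>"
        by (rule nn_integral_cmult) measurable
      finally have e: "?T \<theta> = ennreal (cos \<theta>) * \<dots>" .
      have "ennreal (cos \<theta>) * (ennreal (cos \<theta>) * X) * ennreal (1 / (cos \<theta>)\<^sup>2) = X" for X
      proof -
        have "ennreal (cos \<theta>) * (ennreal (cos \<theta>) * X) * ennreal (1 / (cos \<theta>)\<^sup>2)
          = (ennreal (cos \<theta>) * ennreal (cos \<theta>) * ennreal (1 / (cos \<theta>)\<^sup>2)) * X" by (simp add: mult_ac)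
        also have "ennreal (cos \<theta>) * ennreal (cos \<theta>) * ennreal (1 / (cos \<theta>)\<^sup>2) = 1"
          using c by (simp add: ennreal_mult[symmetric] power2_eq_square)
        finally show ?thesis by simp
      qed
      then show ?thesis using e by simp
    qed simp
  qed
  \<comment> \<open>The angle \<open>\<theta>\<close> is measured from the imaginary axis; \<phi> =
    \<pi>/2 - \<theta> turns it into the usual argument, now in (0, \<pi>).\<close>
  also have "\<dots> = (\<integral>\<^sup>+\<phi>. ?R \<phi> * indicator {0<..<pi} \<phi> \<partial>lborel)"
  proof (subst nn_integral_real_affine[of _ "-1" "pi/2"], goal_cases)
    case 3
    have "\<And>\<rho> x. Complex (\<rho> * sin (pi / 2 + - 1 * x)) (\<rho> * cos (pi / 2 + - 1 * x)) = rcis \<rho> x"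
      by (auto simp: complex_eq_iff sin_diff cos_diff)
    then show ?case
      by (auto intro!: nn_integral_cong simp: indicator_def)
  qed measurable
  \<comment> \<open>So far \<open>\<rho>\<close> runs over a full line through 0. Its negative half
    is the ray at angle \<phi> + \<pi>, which supplies the lower half plane.\<close>
  also have "\<dots> = (\<integral>\<^sup>+\<phi>. H \<phi> * indicator {0<..<pi} \<phi> + ?H \<phi> \<partial>lborel)"
  proof (rule nn_integral_cong)
    fix \<phi> :: real
    have "?R \<phi>
      = (\<integral>\<^sup>+\<rho>. ennreal \<rho> * g (rcis \<rho> \<phi>) * indicator {0<..} \<rho>
            + ennreal (-\<rho>) * g (rcis \<rho> \<phi>) * indicator {..<0} \<rho> \<partial>lborel)"
      by (intro nn_integral_cong) (auto simp: indicator_def abs_if not_less)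
    also have "\<dots> = H \<phi> + (\<integral>\<^sup>+\<rho>. ennreal (-\<rho>) * g (rcis \<rho> \<phi>) * indicator {..<0} \<rho> \<partial>lborel)"
      unfolding H_def by (intro nn_integral_add) auto
    also have "(\<integral>\<^sup>+\<rho>. ennreal (-\<rho>) * g (rcis \<rho> \<phi>) * indicator {..<0} \<rho> \<partial>lborel) = H (pi + 1 * \<phi>)"
    proof (subst nn_integral_real_affine[of _ "-1" "0"], goal_cases)
      case 3
      have "\<And>\<rho>. rcis (0 + - 1 * \<rho>) \<phi> = rcis \<rho> (pi + 1 * \<phi>)"
        by (auto simp: complex_eq_iff)
      then show ?case unfolding H_def
        by (auto intro!: nn_integral_cong simp: indicator_def)
    qed auto
    finally show "?R \<phi> * indicator {0<..<pi} \<phi>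
      = H \<phi> * indicator {0<..<pi} \<phi> + ?H \<phi>"
      by (auto simp: indicator_def)
  qed
  also have "\<dots> = (\<integral>\<^sup>+\<phi>. H \<phi> * indicator {0<..<pi} \<phi> \<partial>lborel)
      + (\<integral>\<^sup>+\<phi>. ?H \<phi> \<partial>lborel)"
    by (rule nn_integral_add) measurable
  also have "(\<integral>\<^sup>+\<phi>. ?H \<phi> \<partial>lborel)
      = (\<integral>\<^sup>+\<phi>. H \<phi> * indicator {pi<..<2*pi} \<phi> \<partial>lborel)"
    by (subst nn_integral_real_affine[of "\<lambda>\<phi>. H \<phi> * indicator {pi<..<2*pi} \<phi>" 1 pi]) auto
  also have "(\<integral>\<^sup>+\<phi>. H \<phi> * indicator {0<..<pi} \<phi> \<partial>lborel) + \<dots>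
      = (\<integral>\<^sup>+\<phi>. H \<phi> * indicator {0<..<pi} \<phi> + H \<phi> * indicator {pi<..<2*pi} \<phi> \<partial>lborel)"
    by (rule nn_integral_add[symmetric]) measurable
  \<comment> \<open>The two open half circles miss only the angle \<pi>, a null set.\<close>
  also have "\<dots> = (\<integral>\<^sup>+\<phi>. H \<phi> * indicator {0<..<2*pi} \<phi> \<partial>lborel)"
  proof (rule nn_integral_cong_AE)
    have "AE x in lborel. x \<noteq> pi" by (rule AE_lborel_singleton)
    then show "AE \<phi> in lborel. H \<phi> * indicator {0<..<pi} \<phi> + H \<phi> * indicator {pi<..<2*pi} \<phi>
        = H \<phi> * indicator {0<..<2*pi} \<phi>"
      by eventually_elim (use pi_gt_zero in \<open>auto simp: indicator_def\<close>)
  qed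
  also have "\<dots> = (\<integral>\<^sup>+\<phi>. \<integral>\<^sup>+\<rho>. ?Q \<rho> \<phi> \<partial>lborel \<partial>lborel)"
    unfolding H_def by (intro nn_integral_cong nn_integral_multc[symmetric]) measurable
  also have "\<dots> = (\<integral>\<^sup>+\<rho>. \<integral>\<^sup>+\<phi>. ?Q \<rho> \<phi> \<partial>lborel \<partial>lborel)"
    by (rule lborel_pair.Fubini') measurable
  also have "\<dots> = (\<integral>\<^sup>+\<rho>. ennreal \<rho> * circle_integral g \<rho> * indicator {0<..} \<rho> \<partial>lborel)"
  proof (rule nn_integral_cong)
    fix \<rho> :: real
    have "(\<integral>\<^sup>+\<phi>. ?Q \<rho> \<phi> \<partial>lborel)
      = (\<integral>\<^sup>+\<phi>. (ennreal \<rho> * indicator {0<..} \<rho>) * (g (rcis \<rho> \<phi>) * indicator {0<..<2*pi} \<phi>) \<partial>lborel)"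
      by (simp add: mult_ac)
    also have "\<dots> = (ennreal \<rho> * indicator {0<..} \<rho>) * (\<integral>\<^sup>+\<phi>. g (rcis \<rho> \<phi>) * indicator {0<..<2*pi} \<phi> \<partial>lborel)"
      by (rule nn_integral_cmult) measurable
    finally show "(\<integral>\<^sup>+\<phi>. ?Q \<rho> \<phi> \<partial>lborel)
      = ennreal \<rho> * circle_integral g \<rho> * indicator {0<..} \<rho>"
      by (simp add: mult_ac)
  qed
  finally show ?thesis .
qed

section \<open>Radial doubling weights\<close>

text \<open>The polar formula is applied to the indicator of a Borel null set \<open>N\<close>
  covering the exceptions. Exchanging the two quantifiers is Fubini, so the measurable
  \<open>N\<close> and not \<open>P\<close> itself must carry the argument.\<close>

lemma AE_lborel_polar:
  assumes "AE z in lborel. P (z :: complex)"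
  shows "AE \<rho> in lborel. AE t in lborel. 0 < \<rho> \<and> 0 < t \<and> t < 2 * pi \<longrightarrow> P (rcis \<rho> t)"
    and "AE t in lborel. AE \<rho> in lborel. 0 < \<rho> \<and> 0 < t \<and> t < 2 * pi \<longrightarrow> P (rcis \<rho> t)"
proof -
  from assms obtain N where N: "{z. \<not> P z} \<subseteq> N" "N \<in> null_sets lborel"
    by (auto elim!: AE_E simp: null_sets_def)
  then have [measurable]: "N \<in> sets borel" by auto
  have "(\<integral>\<^sup>+z. indicator N z \<partial>lborel) = (0 :: ennreal)"
    using N by auto
  then have "(\<integral>\<^sup>+\<rho>. ennreal \<rho> * circle_integral (indicator N) \<rho> * indicator {0<..} \<rho> \<partial>lborel) = 0"
    by (subst (asm) nn_integral_polar) auto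
  then have "AE \<rho> in lborel. ennreal \<rho> * circle_integral (indicator N) \<rho> * indicator {0<..} \<rho> = 0"
    by (subst (asm) nn_integral_0_iff_AE) auto
  then have *: "AE \<rho> in lborel. AE t in lborel. 0 < \<rho> \<and> 0 < t \<and> t < 2 * pi \<longrightarrow> rcis \<rho> t \<notin> N"
  proof eventually_elim
    case (elim \<rho>)
    show ?case
    proof (cases "0 < \<rho>")
      case True
      with elim have "(\<integral>\<^sup>+t. indicator N (rcis \<rho> t) * indicator {0<..<2*pi} t \<partial>lborel) = (0 :: ennreal)"
        by (auto simp: ennreal_eq_0_iff)
      then have "AE t in lborel. indicator N (rcis \<rho> t) * indicator {0<..<2*pi} t = (0 :: ennreal)"
        by (subst (asm) nn_integral_0_iff_AE) auto
      then show ?thesis by eventually_elim (auto simp: indicator_def split: if_splits)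
    qed simp
  qed
  from * show "AE \<rho> in lborel. AE t in lborel. 0 < \<rho> \<and> 0 < t \<and> t < 2 * pi \<longrightarrow> P (rcis \<rho> t)"
  proof eventually_elim
    case (elim x)
    then show ?case by eventually_elim (use N(1) in auto)
  qed
  have "{x \<in> space (lborel \<Otimes>\<^sub>M lborel). 0 < fst x \<and> 0 < snd x \<and> snd x < 2 * pi \<longrightarrow> rcis (fst x) (snd x) \<notin> N}
      \<in> sets (lborel \<Otimes>\<^sub>M lborel)"
    by measurable
  from iffD1[OF lborel_pair.AE_commute[OF this] *]
  show "AE t in lborel. AE \<rho> in lborel. 0 < \<rho> \<and> 0 < t \<and> t < 2 * pi \<longrightarrow> P (rcis \<rho> t)"
  proof eventually_elim
    case (elim x)
    then show ?case by eventually_elim (use N(1) in auto)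
  qed
qed

lemma AE_lborel_cmod:
  assumes "AE \<rho> in lborel. P (\<rho> :: real)"
  shows "AE z in lborel. z \<noteq> 0 \<longrightarrow> P (cmod z)"
proof -
  from assms obtain N where N: "{\<rho>. \<not> P \<rho>} \<subseteq> N" "N \<in> null_sets lborel"
    by (auto elim!: AE_E simp: null_sets_def)
  then have [measurable]: "N \<in> sets borel" by auto
  have "AE \<rho> in lborel. \<rho> \<notin> N" using N(2) by (rule AE_not_in)
  then have "(\<integral>\<^sup>+\<rho>. ennreal \<rho> * (\<integral>\<^sup>+t\<in>{0<..<2*pi}. indicator N (cmod (rcis \<rho> t)) \<partial>lborel) * indicator {0<..} \<rho> \<partial>lborel)
      = (\<integral>\<^sup>+\<rho>. 0 \<partial>(lborel :: real measure))"
    by (intro nn_integral_cong_AE) (auto elim!: eventually_mono simp: indicator_def)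
  then have "(\<integral>\<^sup>+z. indicator N (cmod z) \<partial>lborel) = (0 :: ennreal)"
    by (subst nn_integral_polar) auto
  then have "AE z in lborel. indicator N (cmod z) = (0 :: ennreal)"
    by (subst (asm) nn_integral_0_iff_AE) auto
  then show ?thesis
    by eventually_elim (use N(1) in \<open>auto simp: indicator_def subset_iff split: if_splits\<close>)
qed

lemma sets_disc_area: "sets disc_area = sets (lebesgue_on unit_disc)"
  and space_disc_area: "space disc_area = unit_disc"
  unfolding disc_area_def by (simp_all only: sets_scale_measure space_scale_measure) simp

lemma sets_weight_measure: "sets (weight_measure \<omega>) = sets (lebesgue_on unit_disc)"
  and space_weight_measure: "space (weight_measure \<omega>) = unit_disc"
  unfolding weight_measure_def by (simp_all only: sets_density space_density sets_disc_area space_disc_area)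

text \<open>The restriction of a Lebesgue measurable function to a fixed ray need not be measurable,
  but by Fubini almost every ray is good, and a radial function is the same on all of them.\<close>

lemma radial_profile:
  assumes "radial_weight \<omega>"
  obtains h :: "real \<Rightarrow> ennreal" where "h \<in> borel_measurable borel"
    and "AE s in lborel. 0 < s \<and> s < 1 \<longrightarrow> ennreal (\<omega> (of_real s)) = h s"
    and "AE z in lborel. z \<in> unit_disc \<longrightarrow> ennreal (\<omega> z) = h (cmod z)"
proof -
  have rad: "\<omega> z = \<omega> (of_real (cmod z))" if "z \<in> unit_disc" for z
    using assms that unfolding radial_weight_def by blast
  have "\<omega> \<in> borel_measurable disc_area"
    using assms by (auto simp: radial_weight_def weight_def)
  then have "(\<lambda>z. ennreal (\<omega> z)) \<in> borel_measurable (lebesgue_on unit_disc)"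
    using measurable_cong_sets[OF sets_disc_area refl, of "borel :: real measure"] by (auto intro: measurable_compose)
  then have "(\<lambda>z. ennreal (\<omega> z) * indicator unit_disc z) \<in> borel_measurable lebesgue"
    by (subst (asm) borel_measurable_restrict_space_iff_ennreal) auto
  \<comment> \<open>\<open>\<omega>\<close> is only Lebesgue measurable, whereas the polar formula
    concerns Borel functions; \<open>w\<close> is a Borel version of it.\<close>
  from completion_ex_borel_measurable[OF this] obtain w where [measurable]: "w \<in> borel_measurable borel"
    and w: "AE z in lborel. ennreal (\<omega> z) * indicator unit_disc z = w z" by auto
  have "\<exists>t. 0 < t \<and> t < 2*pi \<and> (AE \<rho> in lborel. 0 < \<rho> \<longrightarrow> ennreal (\<omega> (rcis \<rho> t)) * indicator unit_disc (rcis \<rho> t) = w (rcis \<rho> t))"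
  proof (rule ccontr)
    assume neg: "\<nexists>t. 0 < t \<and> t < 2*pi \<and> (AE \<rho> in lborel. 0 < \<rho> \<longrightarrow> ennreal (\<omega> (rcis \<rho> t)) * indicator unit_disc (rcis \<rho> t) = w (rcis \<rho> t))"
    from AE_lborel_polar(2)[OF w] have "AE t in lborel. t \<notin> {0<..<2*pi}"
      by eventually_elim (use neg in auto)
    then have "emeasure lborel {0<..<2*pi} = 0"
      by (subst (asm) AE_iff_measurable[of "{0<..<2*pi}"]) auto
    then show False by simp
  qed
  then obtain t where t: "AE \<rho> in lborel. 0 < \<rho> \<longrightarrow> ennreal (\<omega> (rcis \<rho> t)) * indicator unit_disc (rcis \<rho> t) = w (rcis \<rho> t)"
    by blast
  define h where "h \<rho> = w (rcis \<rho> t)" for \<rho>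
  have h_AE: "AE s in lborel. 0 < s \<and> s < 1 \<longrightarrow> ennreal (\<omega> (of_real s)) = h s"
    using t
  proof eventually_elim
    case (elim s)
    then show ?case using rad[of "rcis s t"] by (auto simp: h_def)
  qed
  show ?thesis
  proof
    show "h \<in> borel_measurable borel" unfolding h_def by measurable
    show "AE s in lborel. 0 < s \<and> s < 1 \<longrightarrow> ennreal (\<omega> (of_real s)) = h s" by (rule h_AE)
    have "AE z in lborel. z \<noteq> (0::complex)" by (rule AE_lborel_singleton)
    with AE_lborel_cmod[OF h_AE] show "AE z in lborel. z \<in> unit_disc \<longrightarrow> ennreal (\<omega> z) = h (cmod z)"
    proof eventually_elim
      case (elim z)
      then show ?case using rad[of z] by auto
    qed
  qed
qed

text \<open>Abstracts a weight in \<open>D_hat\<close>: \<open>W\<close> is the measure \<open>\<omega> dA\<close> and \<open>\<kappa>(\<rho>) = \<omega>(\<rho>) \<rho> / \<pi>\<close>, so that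
  \<open>dW = \<kappa>(\<rho>) d\<rho> dt\<close> in polar coordinates.\<close>

locale doubling_radial =
  fixes W :: "complex measure" and \<kappa> :: "real \<Rightarrow> ennreal" and D :: real
  assumes space_W: "space W = unit_disc"
    and sets_W: "sets (restrict_space borel unit_disc) \<subseteq> sets W"
    and kappa_measurable [measurable]: "\<kappa> \<in> borel_measurable borel"
    and kappa_zero: "\<And>\<rho>. \<rho> \<le> 0 \<or> 1 \<le> \<rho> \<Longrightarrow> \<kappa> \<rho> = 0"
    and polar: "\<And>G. G \<in> borel_measurable borel \<Longrightarrow>
      (\<integral>\<^sup>+z. G z \<partial>W) = (\<integral>\<^sup>+\<rho>. \<kappa> \<rho> * circle_integral G \<rho> \<partial>lborel)"
    and finite_W: "emeasure W unit_disc < \<infinity>"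
    and tail_pos: "\<And>r. r < 1 \<Longrightarrow> 0 < (\<integral>\<^sup>+\<rho>\<in>{r<..}. \<kappa> \<rho> \<partial>lborel)"
    and D_ge_1: "1 \<le> D"
    and tail_doubling: "\<And>\<delta>. 0 < \<delta> \<Longrightarrow>
      (\<integral>\<^sup>+\<rho>\<in>{1 - 2 * \<delta><..}. \<kappa> \<rho> \<partial>lborel) \<le> ennreal D * (\<integral>\<^sup>+\<rho>\<in>{1 - \<delta><..}. \<kappa> \<rho> \<partial>lborel)"

section \<open>The weight and its tail in polar form\<close>

lemma weight_measure_polar:
  fixes h :: "real \<Rightarrow> ennreal"
  assumes "radial_weight \<omega>"
    and h [measurable]: "h \<in> borel_measurable borel"
    and hz: "AE z in lborel. z \<in> unit_disc \<longrightarrow> ennreal (\<omega> z) = h (cmod z)"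
    and G [measurable]: "G \<in> borel_measurable borel"
  shows "(\<integral>\<^sup>+z. G z \<partial>weight_measure \<omega>)
     = (\<integral>\<^sup>+\<rho>. ennreal (\<rho> / pi) * h \<rho> * indicator {0<..<1} \<rho> * circle_integral G \<rho> \<partial>lborel)"
proof -
  have [measurable]: "unit_disc \<in> sets borel" by simp
  have wt: "weight \<omega>" using assms(1) by (simp only: radial_weight_def)
  let ?I = "\<lambda>\<rho>. \<integral>\<^sup>+t\<in>{0<..<2*pi}. h (cmod (rcis \<rho> t)) * G (rcis \<rho> t) * indicator unit_disc (rcis \<rho> t) \<partial>lborel"
  have m: "(\<lambda>z. ennreal (\<omega> z)) \<in> borel_measurable disc_area"
    using wt by (auto simp: weight_def)
  have G': "G \<in> borel_measurable disc_area"
    unfolding measurable_cong_sets[OF sets_disc_area refl]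
    by (intro measurable_restrict_space1 measurable_completion) simp
  have "(\<integral>\<^sup>+z. G z \<partial>weight_measure \<omega>) = (\<integral>\<^sup>+z. ennreal (\<omega> z) * G z \<partial>disc_area)"
    unfolding weight_measure_def by (rule nn_integral_density[OF m G'])
  also have "\<dots> = ennreal (1/pi) * (\<integral>\<^sup>+z. ennreal (\<omega> z) * G z \<partial>lebesgue_on unit_disc)"
    unfolding disc_area_def
    by (rule nn_integral_scale_measure)
      (use borel_measurable_times_ennreal[OF m G'] measurable_cong_sets[OF sets_disc_area refl] in blast)
  also have "(\<integral>\<^sup>+z. ennreal (\<omega> z) * G z \<partial>lebesgue_on unit_disc)
      = (\<integral>\<^sup>+z. ennreal (\<omega> z) * G z * indicator unit_disc z \<partial>lebesgue)"
    by (rule nn_integral_restrict_space) simp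
  also have "\<dots> = (\<integral>\<^sup>+z. h (cmod z) * G z * indicator unit_disc z \<partial>lebesgue)"
  proof (intro nn_integral_cong_AE AE_completion)
    show "AE z in lborel. ennreal (\<omega> z) * G z * indicator unit_disc z = h (cmod z) * G z * indicator unit_disc z"
      using hz by eventually_elim (auto simp: indicator_def)
  qed
  also have "\<dots> = (\<integral>\<^sup>+z. h (cmod z) * G z * indicator unit_disc z \<partial>lborel)"
    by (simp add: nn_integral_completion)
  also have "\<dots> = (\<integral>\<^sup>+\<rho>. ennreal \<rho> * ?I \<rho> * indicator {0<..} \<rho> \<partial>lborel)"
    by (rule nn_integral_polar) measurable
  also have "\<dots> = (\<integral>\<^sup>+\<rho>. ennreal \<rho> * h \<rho> * indicator {0<..<1} \<rho> * circle_integral G \<rho> \<partial>lborel)"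
  proof (rule nn_integral_cong)
    fix \<rho> :: real
    have "?I \<rho>
      = (\<integral>\<^sup>+t. (h \<rho> * indicator {..<1} \<rho>) * (G (rcis \<rho> t) * indicator {0<..<2*pi} t) \<partial>lborel)" if "0 < \<rho>"
      using that by (intro nn_integral_cong) (auto simp: indicator_def)
    also have "\<dots> = (h \<rho> * indicator {..<1} \<rho>) * circle_integral G \<rho>"
      by (rule nn_integral_cmult) measurable
    finally show "ennreal \<rho> * ?I \<rho> * indicator {0<..} \<rho>
      = ennreal \<rho> * h \<rho> * indicator {0<..<1} \<rho> * circle_integral G \<rho>"
      by (auto simp: indicator_def mult_ac)
  qed
  also have "ennreal (1/pi) * \<dots> = (\<integral>\<^sup>+\<rho>. ennreal (1/pi) * (ennreal \<rho> * h \<rho> * indicator {0<..<1} \<rho> * circle_integral G \<rho>) \<partial>lborel)"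
    by (rule nn_integral_cmult[symmetric]) measurable
  also have "\<dots> = (\<integral>\<^sup>+\<rho>. ennreal (\<rho> / pi) * h \<rho> * indicator {0<..<1} \<rho> * circle_integral G \<rho> \<partial>lborel)"
  proof (rule nn_integral_cong)
    fix \<rho> :: real
    have "ennreal (\<rho> / pi) = ennreal (1/pi) * ennreal \<rho>" if "0 < \<rho>"
      using that by (simp add: ennreal_mult[symmetric])
    then show "ennreal (1/pi) * (ennreal \<rho> * h \<rho> * indicator {0<..<1} \<rho> * circle_integral G \<rho>)
      = ennreal (\<rho> / pi) * h \<rho> * indicator {0<..<1} \<rho> * circle_integral G \<rho>"
      by (auto simp: indicator_def mult_ac)
  qed
  finally show ?thesis .
qed

lemma weight_tail_profile:
  fixes h :: "real \<Rightarrow> ennreal"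
  assumes [measurable]: "h \<in> borel_measurable borel"
    and hs: "AE s in lborel. 0 < s \<and> s < 1 \<longrightarrow> ennreal (\<omega> (of_real s)) = h s"
    and "0 \<le> r"
  shows "weight_tail \<omega> (of_real r) = (\<integral>\<^sup>+s\<in>{r<..<1}. h s \<partial>lborel)"
proof -
  have r: "AE s in lborel. s \<noteq> r" by (rule AE_lborel_singleton)
  have "weight_tail \<omega> (of_real r) = (\<integral>\<^sup>+ s\<in>{r..<1}. ennreal (\<omega> (of_real s)) \<partial>lebesgue)"
    using \<open>0 \<le> r\<close> by (simp add: weight_tail_def)
  also have "\<dots> = (\<integral>\<^sup>+ s\<in>{r<..<1}. h s \<partial>lebesgue)"
  proof (intro nn_integral_cong_AE AE_completion)
    show "AE s in lborel. ennreal (\<omega> (of_real s)) * indicator {r..<1} s = h s * indicator {r<..<1} s"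
      using hs r by eventually_elim (use \<open>0 \<le> r\<close> in \<open>auto simp: indicator_def\<close>)
  qed
  finally show ?thesis by (simp add: nn_integral_completion)
qed

lemma finite_weight_measure:
  assumes "weight \<omega>"
  shows "emeasure (weight_measure \<omega>) unit_disc < \<infinity>"
proof -
  have m: "\<omega> \<in> borel_measurable disc_area" using assms by (auto simp: weight_def)
  have "emeasure (weight_measure \<omega>) (space disc_area) = (\<integral>\<^sup>+z. ennreal (\<omega> z) * indicator (space disc_area) z \<partial>disc_area)"
    unfolding weight_measure_def by (rule emeasure_density) (use m in auto)
  also have "\<dots> = (\<integral>\<^sup>+z. ennreal (norm (\<omega> z)) \<partial>disc_area)"
    using assms by (intro nn_integral_cong) (auto simp: weight_def space_disc_area)
  also have "\<dots> < \<infinity>"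
    using assms by (auto simp: weight_def integrable_iff_bounded)
  finally show ?thesis by (simp add: space_disc_area)
qed

text \<open>The tail of the weight integrates the profile \<open>h\<close>, the tail in the locale
  integrates \<open>h\<close> times \<rho>/\<pi>. This factor is at most 1 everywhere and at least
  1/(2\<pi>) beyond 1/2, and radii beyond 1/2 are the only ones where the lower bound is
  used.\<close>

theorem D_hat_doubling_radial:
  assumes "\<omega> \<in> D_hat" and pos: "\<forall>z\<in>unit_disc. 0 < weight_tail \<omega> z"
  obtains \<kappa> D where "doubling_radial (weight_measure \<omega>) \<kappa> D"
proof -
  have rad: "radial_weight \<omega>" using assms by (auto simp: D_hat_def)
  obtain C :: real where C: "C \<ge> 1"
    and dbl: "\<And>r::real. 0 \<le> r \<Longrightarrow> r < 1 \<Longrightarrow> weight_tail \<omega> (of_real r) \<le> ennreal C * weight_tail \<omega> (of_real ((1 + r) / 2))"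
    using assms(1) unfolding D_hat_def by blast
  obtain h :: "real \<Rightarrow> ennreal" where h [measurable]: "h \<in> borel_measurable borel"
    and hs: "AE s in lborel. 0 < s \<and> s < 1 \<longrightarrow> ennreal (\<omega> (of_real s)) = h s"
    and hz: "AE z in lborel. z \<in> unit_disc \<longrightarrow> ennreal (\<omega> z) = h (cmod z)"
    using radial_profile[OF rad] by blast
  note tail = weight_tail_profile[OF h hs]
  define \<kappa> where "\<kappa> \<rho> = ennreal (\<rho> / pi) * h \<rho> * indicator {0<..<1} \<rho>" for \<rho>
  have \<kappa>_meas [measurable]: "\<kappa> \<in> borel_measurable borel" unfolding \<kappa>_def by measurable
  define V where "V r = (\<integral>\<^sup>+\<rho>\<in>{r<..}. \<kappa> \<rho> \<partial>lborel)" for r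
  define T where "T r = (\<integral>\<^sup>+s\<in>{r<..<1}. h s \<partial>lborel)" for r
  have V_anti: "V s \<le> V r" if "r \<le> s" for r s
    unfolding V_def using that by (intro nn_integral_mono) (auto simp: indicator_def)
  have T_anti: "T s \<le> T r" if "r \<le> s" for r s
    unfolding T_def using that by (intro nn_integral_mono) (auto simp: indicator_def)
  have V_le_T: "V r \<le> T r" if "0 \<le> r" for r
    unfolding V_def T_def
  proof (rule nn_integral_mono)
    fix \<rho> :: real
    have "ennreal (\<rho> / pi) * h \<rho> \<le> 1 * h \<rho>" if "\<rho> < 1"
      using that pi_ge_two by (intro mult_right_mono) (auto simp: divide_simps)
    then show "\<kappa> \<rho> * indicator {r<..} \<rho> \<le> h \<rho> * indicator {r<..<1} \<rho>"
      by (auto simp: \<kappa>_def indicator_def)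
  qed
  have T_le_V: "T r \<le> ennreal (2 * pi) * V r" if "1/2 \<le> r" for r
  proof -
    have "T r \<le> (\<integral>\<^sup>+\<rho>. ennreal (2 * pi) * (\<kappa> \<rho> * indicator {r<..} \<rho>) \<partial>lborel)"
      unfolding T_def
    proof (rule nn_integral_mono)
      fix \<rho> :: real
      have "h \<rho> \<le> ennreal (2*pi) * (ennreal (\<rho> / pi) * h \<rho>)" if "1/2 < \<rho>"
      proof -
        have "1 \<le> ennreal (2*pi * (\<rho>/pi))" using that by simp
        then have "1 * h \<rho> \<le> ennreal (2*pi * (\<rho>/pi)) * h \<rho>" by (rule mult_right_mono) simp
        also have "ennreal (2*pi * (\<rho>/pi)) = ennreal (2*pi) * ennreal (\<rho>/pi)"
          using that by (intro ennreal_mult) auto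
        finally show ?thesis by (simp only: mult.assoc mult_1)
      qed
      then show "h \<rho> * indicator {r<..<1} \<rho> \<le> ennreal (2 * pi) * (\<kappa> \<rho> * indicator {r<..} \<rho>)"
        using that by (auto simp: \<kappa>_def indicator_def)
    qed
    also have "\<dots> = ennreal (2 * pi) * V r"
      unfolding V_def by (rule nn_integral_cmult) measurable
    finally show ?thesis .
  qed
  have T_dbl: "T r \<le> ennreal C * T ((1 + r) / 2)" if "0 \<le> r" "r < 1" for r
    using dbl[OF that] that by (simp add: tail T_def del: of_real_divide of_real_add)
  \<comment> \<open>\<open>C\<close> is the given doubling constant; 2\<pi> pays for the return from
    \<open>T\<close> to \<open>V\<close>.\<close>
  define D where "D = C * (2 * pi)"
  have "1 * 1 \<le> C * (2 * pi)" using C pi_ge_two by (intro mult_mono) auto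
  then have D: "1 \<le> D" by (simp add: D_def)
  have polar: "(\<integral>\<^sup>+z. G z \<partial>weight_measure \<omega>) = (\<integral>\<^sup>+\<rho>. \<kappa> \<rho> * circle_integral G \<rho> \<partial>lborel)"
    if "G \<in> borel_measurable borel" for G
    unfolding \<kappa>_def by (rule weight_measure_polar[OF rad h hz that])
  have "doubling_radial (weight_measure \<omega>) \<kappa> D"
  proof
    show "space (weight_measure \<omega>) = unit_disc" by (rule space_weight_measure)
    show "sets (restrict_space borel unit_disc) \<subseteq> sets (weight_measure \<omega>)"
      unfolding sets_weight_measure sets_restrict_space by (intro image_mono subsetI sets_completionI_sets) simp
    show "\<kappa> \<in> borel_measurable borel" by fact
    show "\<And>\<rho>. \<rho> \<le> 0 \<or> 1 \<le> \<rho> \<Longrightarrow> \<kappa> \<rho> = 0" by (auto simp: \<kappa>_def)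
    show "\<And>G. G \<in> borel_measurable borel \<Longrightarrow>
      (\<integral>\<^sup>+z. G z \<partial>weight_measure \<omega>) = (\<integral>\<^sup>+\<rho>. \<kappa> \<rho> * circle_integral G \<rho> \<partial>lborel)"
      by (rule polar)
    have "weight \<omega>" using rad by (simp only: radial_weight_def)
    then show "emeasure (weight_measure \<omega>) unit_disc < \<infinity>" by (rule finite_weight_measure)
    fix r :: real assume r: "r < 1"
    have "0 < weight_tail \<omega> (of_real (max r (1/2)))"
      using r by (intro bspec[OF pos]) auto
    then have "0 < T (max r (1/2))" by (subst (asm) tail) (auto simp: T_def)
    also have "\<dots> \<le> ennreal (2*pi) * V (max r (1/2))" by (rule T_le_V) simp
    finally have "0 < V (max r (1/2))" by (auto simp: zero_less_iff_neq_zero)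
    also have "\<dots> \<le> V r" by (rule V_anti) simp
    finally show "0 < (\<integral>\<^sup>+\<rho>\<in>{r<..}. \<kappa> \<rho> \<partial>lborel)" by (simp add: V_def)
  next
    show "1 \<le> D" by (rule D)
    fix \<delta> :: real assume \<delta>: "0 < \<delta>"
    have half: "(1 + (1 - 2 * \<delta>)) / 2 = 1 - \<delta>" for \<delta> :: real by simp
    have *: "V (1 - 2 * \<delta>) \<le> ennreal D * V (1 - \<delta>)" if "0 < \<delta>" "\<delta> \<le> 1/2" for \<delta>
    proof -
      have "V (1 - 2 * \<delta>) \<le> T (1 - 2 * \<delta>)" using that by (intro V_le_T) auto
      also have "\<dots> \<le> ennreal C * T (1 - \<delta>)" using T_dbl[of "1 - 2 * \<delta>", unfolded half] that by simp
      also have "\<dots> \<le> ennreal C * (ennreal (2 * pi) * V (1 - \<delta>))"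
        using that by (intro mult_left_mono T_le_V) auto
      also have "\<dots> = ennreal D * V (1 - \<delta>)"
        using C by (simp add: D_def ennreal_mult mult.assoc)
      finally show ?thesis .
    qed
    \<comment> \<open>For \<delta> > 1/2 the left side is already the full integral, so \<delta> =
      1/2 and monotonicity of \<open>V\<close> settle it.\<close>
    have "V (1 - 2 * \<delta>) \<le> ennreal D * V (1 - \<delta>)"
    proof (cases "\<delta> \<le> 1/2")
      case False
      have "V (1 - 2 * \<delta>) = V 0"
        unfolding V_def using False by (intro nn_integral_cong) (auto simp: \<kappa>_def indicator_def)
      also have "\<dots> \<le> ennreal D * V (1/2)" using *[of "1/2"] by simp
      also have "\<dots> \<le> ennreal D * V (1 - \<delta>)" using False by (intro mult_left_mono V_anti) auto
      finally show ?thesis .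
    qed (use * \<delta> in auto)
    then show "(\<integral>\<^sup>+\<rho>\<in>{1 - 2 * \<delta><..}. \<kappa> \<rho> \<partial>lborel) \<le> ennreal D * (\<integral>\<^sup>+\<rho>\<in>{1 - \<delta><..}. \<kappa> \<rho> \<partial>lborel)"
      by (simp add: V_def)
  qed
  then show ?thesis by (rule that)
qed

section \<open>Subharmonicity of powers of holomorphic functions\<close>

text \<open>The algebra of the Blaschke factor \<rho> (w - a) / (\<rho>^2 - conj(a) w) of the disc
  of radius \<rho>: for |a| < \<rho> the right side is positive when |w| < \<rho> and zero when |w|
  = \<rho>.\<close>

lemma cmod_blaschke_diff:
  fixes a w :: complex and \<rho> :: real
  shows "(cmod (of_real (\<rho>\<^sup>2) - cnj a * w))\<^sup>2 - \<rho>\<^sup>2 * (cmod (w - a))\<^sup>2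
    = (\<rho>\<^sup>2 - (cmod a)\<^sup>2) * (\<rho>\<^sup>2 - (cmod w)\<^sup>2)"
  unfolding cmod_power2 by (simp add: power2_eq_square algebra_simps)

lemma cmod_blaschke_le:
  fixes a w :: complex and \<rho> :: real
  assumes "cmod a < \<rho>" "cmod w \<le> \<rho>"
  shows "cmod (w - a) \<le> cmod ((of_real (\<rho>\<^sup>2) - cnj a * w) / of_real \<rho>)"
    and "cmod w = \<rho> \<Longrightarrow> cmod (w - a) = cmod ((of_real (\<rho>\<^sup>2) - cnj a * w) / of_real \<rho>)"
    and "(of_real (\<rho>\<^sup>2) - cnj a * w) / of_real \<rho> \<noteq> 0"
proof -
  let ?b = "(of_real (\<rho>\<^sup>2) - cnj a * w) / of_real \<rho>"
  have \<rho>: "0 < \<rho>" using assms(1) norm_ge_zero[of a] by linarith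
  have sq: "(cmod a)\<^sup>2 < \<rho>\<^sup>2" "(cmod w)\<^sup>2 \<le> \<rho>\<^sup>2"
    using assms by (auto intro!: power_strict_mono power_mono)
  then have "0 \<le> (\<rho>\<^sup>2 - (cmod a)\<^sup>2) * (\<rho>\<^sup>2 - (cmod w)\<^sup>2)" by simp
  then have "(\<rho> * cmod (w - a))\<^sup>2 \<le> (cmod (of_real (\<rho>\<^sup>2) - cnj a * w))\<^sup>2"
    using cmod_blaschke_diff[of \<rho> a w] by (simp add: power_mult_distrib)
  then have "\<rho> * cmod (w - a) \<le> cmod (of_real (\<rho>\<^sup>2) - cnj a * w)"
    by (rule power2_le_imp_le) simp
  then show "cmod (w - a) \<le> cmod ?b"
    using \<rho> by (simp add: norm_divide field_simps)
  show "cmod (w - a) = cmod ?b" if "cmod w = \<rho>"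
  proof -
    have "(\<rho> * cmod (w - a))\<^sup>2 = (cmod (of_real (\<rho>\<^sup>2) - cnj a * w))\<^sup>2"
      using cmod_blaschke_diff[of \<rho> a w] that by (simp add: power_mult_distrib)
    then have "\<rho> * cmod (w - a) = cmod (of_real (\<rho>\<^sup>2) - cnj a * w)"
      using \<rho> by (subst (asm) power2_eq_iff_nonneg) auto
    then show ?thesis using \<rho> by (simp add: norm_divide field_simps)
  qed
  have "cmod (cnj a * w) \<le> cmod a * \<rho>"
    using assms by (simp add: norm_mult mult_left_mono)
  also have "\<dots> < \<rho> * \<rho>" using assms \<rho> by (intro mult_strict_right_mono) auto
  finally have "cmod (cnj a * w) < cmod (of_real (\<rho>\<^sup>2))" by (simp add: power2_eq_square norm_mult)
  then have "of_real (\<rho>\<^sup>2) \<noteq> cnj a * w" by force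
  then show "?b \<noteq> 0" using \<rho> by auto
qed

text \<open>Dividing by Blaschke factors of the disc of radius \<open>\<rho>\<close>; the quotient has a holomorphic
  \<open>q\<close>-th power, to which Cauchy's formula applies.\<close>

lemma holomorphic_remove_zeros:
  fixes f :: "complex \<Rightarrow> complex"
  assumes "f holomorphic_on ball 0 1" "0 < \<rho>" "\<rho> < 1" "\<And>w. cmod w = \<rho> \<Longrightarrow> f w \<noteq> 0"
  obtains g where "g holomorphic_on ball 0 1" "\<And>w. cmod w \<le> \<rho> \<Longrightarrow> g w \<noteq> 0"
    "\<And>w. cmod w = \<rho> \<Longrightarrow> cmod (g w) = cmod (f w)"
    "\<And>w. cmod w \<le> \<rho> \<Longrightarrow> cmod (f w) \<le> cmod (g w)"
proof -
  \<comment> \<open>Nonvanishing on the circle excludes f = 0, so the zeros in the closed disc can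
    be counted for the induction below.\<close>
  have fin: "finite {w \<in> cball 0 \<rho>. f w = 0}"
    if f: "f holomorphic_on ball 0 1" and nz: "\<And>w. cmod w = \<rho> \<Longrightarrow> f w \<noteq> 0" for f
  proof (cases "f constant_on ball 0 1")
    case True
    then obtain c where c: "\<And>w. w \<in> ball 0 1 \<Longrightarrow> f w = c" by (auto simp: constant_on_def)
    have "f (of_real \<rho>) \<noteq> 0" using assms by (intro nz) auto
    then have "{w \<in> cball 0 \<rho>. f w = 0} = {}" using c[of "of_real \<rho>"] c assms by auto
    then show ?thesis by (metis finite.emptyI)
  next
    case False
    then show ?thesis
      using assms f by (intro holomorphic_compact_finite_zeros[of f "ball 0 1"]) auto
  qed
  have "\<exists>g. g holomorphic_on ball 0 1 \<and> (\<forall>w. cmod w \<le> \<rho> \<longrightarrow> g w \<noteq> 0) \<and>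
    (\<forall>w. cmod w = \<rho> \<longrightarrow> cmod (g w) = cmod (f w)) \<and> (\<forall>w. cmod w \<le> \<rho> \<longrightarrow> cmod (f w) \<le> cmod (g w))"
    using assms(1,4)
  \<comment> \<open>Every round removes one zero with its full multiplicity \<open>m\<close>, so the
    number of distinct zeros drops.\<close>
  proof (induction "card {w \<in> cball 0 \<rho>. f w = 0}" arbitrary: f rule: less_induct)
    case less
    note f = less.prems(1) and nz = less.prems(2)
    show ?case
    proof (cases "{w \<in> cball 0 \<rho>. f w = 0} = {}")
      case True
      then show ?thesis using f by (intro exI[of _ f]) auto
    next
      case False
      then obtain a where a: "cmod a \<le> \<rho>" "f a = 0" by auto
      with nz have a': "cmod a < \<rho>" by force
      have "\<exists>w\<in>ball 0 1. f w \<noteq> 0"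
        using assms(2,3) nz[of "of_real \<rho>"] by (intro bexI[of _ "of_real \<rho>"]) auto
      then obtain r where r: "r > 0" "cball a r \<subseteq> ball 0 1"
        and hol: "zor_poly f a holomorphic_on cball a r"
        and fac: "\<And>w. w \<in> cball a r \<Longrightarrow> f w = zor_poly f a w * (w - a) ^ nat (zorder f a) \<and> zor_poly f a w \<noteq> 0"
        using zorder_exist_zero[OF f, of a] a assms(3) by auto
      define m where "m = nat (zorder f a)"
      \<comment> \<open>The quotient has a removable singularity at \<open>a\<close>; the local
        cofactor \<open>zor_poly\<close> fills it in, and the two formulas agree on the punctured
        disc.\<close>
      define h where "h w = (if w \<in> ball a r then zor_poly f a w else f w / (w - a) ^ m)" for w
      have h_eq: "h w = f w / (w - a) ^ m" if "w \<noteq> a" for w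
        using fac[of w] that by (auto simp: h_def m_def)
      have f_eq: "f w = h w * (w - a) ^ m" for w
        using fac[of w] a(2) by (cases "w \<in> ball a r") (auto simp: h_def m_def r(1))
      have "h holomorphic_on ball a r"
        by (rule holomorphic_transform[OF holomorphic_on_subset[OF hol ball_subset_cball]]) (simp add: h_def)
      moreover have "h holomorphic_on ball 0 1 - {a}"
      proof (rule holomorphic_transform)
        show "(\<lambda>w. f w / (w - a) ^ m) holomorphic_on ball 0 1 - {a}"
          by (intro holomorphic_intros holomorphic_on_subset[OF f]) auto
      qed (simp add: h_eq)
      ultimately have "h holomorphic_on ball a r \<union> (ball 0 1 - {a})"
        by (intro holomorphic_on_Un) auto
      moreover have "a \<in> ball a r" "ball a r \<subseteq> ball 0 1" using r ball_subset_cball[of a r] by auto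
      then have "ball a r \<union> (ball 0 1 - {a}) = ball 0 1" by blast
      ultimately have h: "h holomorphic_on ball 0 1" by simp
      have ha: "h a \<noteq> 0" using fac[of a] r by (simp add: h_def)
      define b where "b w = (of_real (\<rho>\<^sup>2) - cnj a * w) / of_real \<rho>" for w
      \<comment> \<open>The factor (w - a)^m is exchanged for \<open>b w ^ m\<close>, which has no
        zero, the same modulus on the circle, and at least that modulus inside.\<close>
      define g where "g w = h w * b w ^ m" for w
      note b = cmod_blaschke_le[OF a', folded b_def]
      have g: "g holomorphic_on ball 0 1" unfolding g_def b_def
        using assms(2) by (intro holomorphic_intros h) auto
      have "h w \<noteq> 0" if "cmod w = \<rho>" for w using nz[OF that] f_eq[of w] by auto
      then have gnz: "g w \<noteq> 0" if "cmod w = \<rho>" for w using that b(3)[of w] by (simp add: g_def)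
      have "{w \<in> cball 0 \<rho>. g w = 0} \<subset> {w \<in> cball 0 \<rho>. f w = 0}"
      proof
        show "{w \<in> cball 0 \<rho>. g w = 0} \<subseteq> {w \<in> cball 0 \<rho>. f w = 0}"
          using b(3) f_eq by (auto simp: g_def)
        have "a \<in> {w \<in> cball 0 \<rho>. f w = 0}" "a \<notin> {w \<in> cball 0 \<rho>. g w = 0}"
          using a ha b(3)[of a] by (auto simp: g_def)
        then show "{w \<in> cball 0 \<rho>. g w = 0} \<noteq> {w \<in> cball 0 \<rho>. f w = 0}" by blast
      qed
      then have "card {w \<in> cball 0 \<rho>. g w = 0} < card {w \<in> cball 0 \<rho>. f w = 0}"
        by (intro psubset_card_mono fin f nz)
      from less.hyps[OF this g gnz] obtain G where G: "G holomorphic_on ball 0 1"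
        "\<And>w. cmod w \<le> \<rho> \<Longrightarrow> G w \<noteq> 0" "\<And>w. cmod w = \<rho> \<Longrightarrow> cmod (G w) = cmod (g w)"
        "\<And>w. cmod w \<le> \<rho> \<Longrightarrow> cmod (g w) \<le> cmod (G w)" by blast
      have "cmod (g w) = cmod (f w)" if "cmod w = \<rho>" for w
        using b(2)[of w] that by (simp add: g_def f_eq[of w] norm_mult norm_power)
      moreover have "cmod (f w) \<le> cmod (g w)" if "cmod w \<le> \<rho>" for w
        using b(1)[OF that] by (auto simp: g_def f_eq[of w] norm_mult norm_power intro!: mult_left_mono power_mono)
      ultimately show ?thesis using G by (intro exI[of _ G]) (metis order_trans)
    qed
  qed
  then show ?thesis using that by blast
qed

text \<open>The zero-free majorant \<open>g\<close> has a logarithm \<open>L\<close>, so exp(q L) k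
  is holomorphic for every real q; Cauchy's formula at z, with |w - z| >= \<rho> - |z| on the
  circle, gives the constant. Apart from \<open>k z = 1\<close> the factor \<open>k\<close> is free:
  making it small far from z later localises the estimate.\<close>

lemma holomorphic_power_submean:
  fixes f k :: "complex \<Rightarrow> complex" and q :: real
  assumes f: "f holomorphic_on ball 0 1" and k: "k holomorphic_on ball 0 1" and "k z = 1"
    and z: "cmod z < \<rho>" and "\<rho> < 1" and nz: "\<And>w. cmod w = \<rho> \<Longrightarrow> f w \<noteq> 0" and "0 < q"
  shows "ennreal (cmod (f z) powr q) \<le> ennreal (\<rho> / (2 * pi * (\<rho> - cmod z))) *
    (\<integral>\<^sup>+t\<in>{0<..<2*pi}. ennreal (cmod (f (rcis \<rho> t)) powr q * cmod (k (rcis \<rho> t))) \<partial>lborel)"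
proof -
  have \<rho>: "0 < \<rho>" using z norm_ge_zero[of z] by linarith
  obtain g where g: "g holomorphic_on ball 0 1" "\<And>w. cmod w \<le> \<rho> \<Longrightarrow> g w \<noteq> 0"
    "\<And>w. cmod w = \<rho> \<Longrightarrow> cmod (g w) = cmod (f w)"
    "\<And>w. cmod w \<le> \<rho> \<Longrightarrow> cmod (f w) \<le> cmod (g w)"
    using holomorphic_remove_zeros[OF f \<rho> \<open>\<rho> < 1\<close> nz] by blast
  have "open (ball 0 1 \<inter> g -` (- {0}))"
    by (intro continuous_open_preimage holomorphic_on_imp_continuous_on g) auto
  moreover have "ball 0 1 \<inter> g -` (- {0}) = {w \<in> ball 0 1. g w \<noteq> 0}" by auto
  ultimately have "open {w \<in> ball 0 1. g w \<noteq> 0}" by metis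
  moreover have "cball 0 \<rho> \<subseteq> {w \<in> ball 0 1. g w \<noteq> 0}" using g(2) \<open>\<rho> < 1\<close> by auto
  \<comment> \<open>Cauchy's formula is applied up to the circle, so the logarithm must live on a
    slightly larger open disc.\<close>
  ultimately obtain e where e: "e > 0" "(\<Union>x\<in>cball 0 \<rho>. ball x e) \<subseteq> {w \<in> ball 0 1. g w \<noteq> 0}"
    using compact_subset_open_imp_ball_epsilon_subset[of "cball (0::complex) \<rho>"] by auto
  have sub: "ball 0 (\<rho> + e) \<subseteq> {w \<in> ball 0 1. g w \<noteq> 0}"
  proof
    fix w :: complex assume w: "w \<in> ball 0 (\<rho> + e)"
    have "w \<in> (\<Union>x\<in>cball 0 \<rho>. ball x e)"
    proof (cases "cmod w \<le> \<rho>")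
      case True
      then show ?thesis using e(1) by (intro UN_I[of w]) auto
    next
      case False
      \<comment> \<open>The radial projection of \<open>w\<close> to the circle lies at distance |w|
        - \<rho> < \<open>e\<close> from it.\<close>
      define x where "x = of_real (\<rho> / cmod w) * w"
      have wnz: "cmod w > 0" using False \<rho> by linarith
      have "dist x w = cmod (of_real (\<rho> / cmod w - 1) * w)" by (simp add: x_def dist_norm algebra_simps)
      also have "\<dots> = \<bar>\<rho> / cmod w - 1\<bar> * cmod w" by (simp only: norm_mult norm_of_real)
      also have "\<dots> = cmod w - \<rho>" using False wnz \<rho> by (simp add: abs_if field_simps)
      finally have "dist x w < e" using w by simp
      moreover have "cmod x = \<rho>" using wnz \<rho> by (simp add: x_def norm_mult norm_divide)
      ultimately show ?thesis by auto
    qed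
    then show "w \<in> {w \<in> ball 0 1. g w \<noteq> 0}" using e by blast
  qed
  have "contractible (ball (0::complex) (\<rho> + e))" by (simp add: convex_imp_contractible)
  then obtain L where L: "L holomorphic_on ball 0 (\<rho> + e)" "\<And>w. w \<in> ball 0 (\<rho> + e) \<Longrightarrow> g w = exp (L w)"
    using contractible_imp_holomorphic_log[OF holomorphic_on_subset[OF g(1)], of "ball 0 (\<rho> + e)"] sub by blast
  have sub': "cball 0 \<rho> \<subseteq> ball (0::complex) (\<rho> + e)" using e by auto
  define G where "G w = exp (of_real q * L w) * k w" for w
  have Gk: "cmod (G w) = cmod (g w) powr q * cmod (k w)" if "cmod w \<le> \<rho>" for w
    using L(2)[of w] that e by (simp add: G_def norm_mult powr_def)
  have G_hol: "G holomorphic_on ball 0 (\<rho> + e)"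
  proof -
    have "ball 0 (\<rho> + e) \<subseteq> ball (0::complex) 1" using sub by blast
    then show ?thesis
      unfolding G_def by (intro holomorphic_intros L holomorphic_on_subset[OF k])
  qed
  have "((\<lambda>u. G u / (u - z)) has_contour_integral 2 * complex_of_real pi * \<i> * G z) (circlepath 0 \<rho>)"
    using z sub' ball_subset_cball[of 0 \<rho>]
    by (intro Cauchy_integral_circlepath holomorphic_on_imp_continuous_on holomorphic_on_subset[OF G_hol]) auto
  then have I: "((\<lambda>t. G (of_real \<rho> * cis t) / (of_real \<rho> * cis t - z) * of_real \<rho> * \<i> * cis t)
      has_integral (2 * complex_of_real pi * \<i> * G z)) {0..2*pi}"
    unfolding circlepath_def by (subst (asm) has_contour_integral_part_circlepath_iff) auto
  define B where "B t = cmod (f (rcis \<rho> t)) powr q * cmod (k (rcis \<rho> t)) * (\<rho> / (\<rho> - cmod z))" for t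
  have cont_rcis: "continuous_on UNIV (rcis \<rho>)"
    unfolding rcis_def by (intro continuous_intros)
  have "continuous_on UNIV (\<lambda>t. f (rcis \<rho> t))" "continuous_on UNIV (\<lambda>t. k (rcis \<rho> t))"
    using \<rho> \<open>\<rho> < 1\<close>
    by (auto intro!: continuous_on_compose2[OF holomorphic_on_imp_continuous_on[OF f] cont_rcis]
        continuous_on_compose2[OF holomorphic_on_imp_continuous_on[OF k] cont_rcis])
  then have B_cont: "continuous_on UNIV B"
    unfolding B_def using nz \<rho> by (intro continuous_intros continuous_on_powr) auto
  then have "B integrable_on {0..2*pi}"
    by (intro integrable_continuous_real continuous_on_subset[OF B_cont]) auto
  then have BI: "(B has_integral integral {0..2*pi} B) {0..2*pi}" by (rule integrable_integral)
  have B_nonneg: "0 \<le> B t" for t using \<rho> z by (simp add: B_def)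
  have "cmod (integral {0..2*pi} (\<lambda>t. G (of_real \<rho> * cis t) / (of_real \<rho> * cis t - z) * of_real \<rho> * \<i> * cis t))
      \<le> integral {0..2*pi} B"
  proof (rule integral_norm_bound_integral[OF has_integral_integrable[OF I] has_integral_integrable[OF BI]])
    fix t :: real
    have r: "cmod (rcis \<rho> t) = \<rho>" using \<rho> by simp
    have "\<rho> - cmod z \<le> cmod (rcis \<rho> t - z)" using norm_triangle_ineq2[of "rcis \<rho> t" z] r by simp
    then have "cmod (G (rcis \<rho> t)) * \<rho> / cmod (rcis \<rho> t - z) \<le> cmod (G (rcis \<rho> t)) * \<rho> / (\<rho> - cmod z)"
      using z \<rho> by (intro divide_left_mono mult_pos_pos mult_nonneg_nonneg) auto
    then show "cmod (G (of_real \<rho> * cis t) / (of_real \<rho> * cis t - z) * of_real \<rho> * \<i> * cis t) \<le> B t"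
      using Gk[of "rcis \<rho> t"] r g(3)[of "rcis \<rho> t"] \<rho>
      by (simp add: norm_mult norm_divide B_def rcis_def mult_ac)
  qed
  then have "cmod (G z) \<le> integral {0..2*pi} B / (2 * pi)"
    unfolding integral_unique[OF I] by (simp add: norm_mult field_simps)
  moreover have "cmod (f z) powr q \<le> cmod (G z)"
    using g(4)[of z] z \<open>0 < q\<close> \<open>k z = 1\<close> Gk[of z] by (auto intro!: powr_mono2)
  ultimately have "cmod (f z) powr q \<le> integral {0..2*pi} B / (2 * pi)" by linarith
  then have "ennreal (cmod (f z) powr q) \<le> ennreal (1 / (2*pi)) * ennreal (integral {0..2*pi} B)"
    using B_nonneg by (subst ennreal_mult[symmetric]) (auto intro!: ennreal_leI integral_nonneg has_integral_integrable[OF BI])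
  also have "ennreal (integral {0..2*pi} B) = (\<integral>\<^sup>+t. ennreal (B t) * indicator {0..2*pi} t \<partial>lborel)"
    using BI B_nonneg by (intro nn_integral_has_integral_lebesgue'[symmetric])
  also have "\<dots> = (\<integral>\<^sup>+t. ennreal (\<rho> / (\<rho> - cmod z)) * (ennreal (cmod (f (rcis \<rho> t)) powr q * cmod (k (rcis \<rho> t))) * indicator {0<..<2*pi} t) \<partial>lborel)"
  proof (rule nn_integral_cong_AE)
    have "AE t in lborel. t \<noteq> (0::real)" "AE t in lborel. t \<noteq> 2 * pi" by (rule AE_lborel_singleton)+
    then show "AE t in lborel. ennreal (B t) * indicator {0..2*pi} t
       = ennreal (\<rho> / (\<rho> - cmod z)) * (ennreal (cmod (f (rcis \<rho> t)) powr q * cmod (k (rcis \<rho> t))) * indicator {0<..<2*pi} t)"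
      by eventually_elim (use \<rho> z in \<open>auto simp: indicator_def B_def ennreal_mult[symmetric] mult_ac\<close>)
  qed
  also have "\<dots> = ennreal (\<rho> / (\<rho> - cmod z)) * (\<integral>\<^sup>+t\<in>{0<..<2*pi}. ennreal (cmod (f (rcis \<rho> t)) powr q * cmod (k (rcis \<rho> t))) \<partial>lborel)"
  proof (rule nn_integral_cmult)
    have "(\<lambda>t. cmod (f (rcis \<rho> t)) powr q * cmod (k (rcis \<rho> t))) = (\<lambda>t. B t * ((\<rho> - cmod z) / \<rho>))"
      using \<rho> z by (auto simp: B_def fun_eq_iff)
    then have [measurable]: "(\<lambda>t. cmod (f (rcis \<rho> t)) powr q * cmod (k (rcis \<rho> t))) \<in> borel_measurable borel"
      using borel_measurable_continuous_onI[OF B_cont] by simp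
    show "(\<lambda>t. ennreal (cmod (f (rcis \<rho> t)) powr q * cmod (k (rcis \<rho> t))) * indicator {0<..<2*pi} t) \<in> borel_measurable lborel"
      by measurable
  qed
  finally show ?thesis
    using \<rho> z by (simp add: mult.assoc[symmetric] ennreal_mult[symmetric])
qed

section \<open>Tents\<close>

text \<open>Carleson squares with the angular distance replaced by the chordal one: disjoint discs
  \<open>cball \<zeta> \<delta>\<close> in the plane give disjoint tents, so the Vitali lemma of the library applies.\<close>

definition tent :: "complex \<Rightarrow> real \<Rightarrow> complex set" where
  "tent \<zeta> \<delta> = {w \<in> unit_disc. 1 - \<delta> < cmod w \<and> cmod (sgn w - \<zeta>) < \<delta>}"

text \<open>Up to \<pi>/3 the derivative cos x - 1/3 of the difference is positive, as cos x >= 1/2;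
  beyond, sin x >= sqrt 3 / 2 >= 2/3 >= x/3. This is the source of the factor 3 by which arcs may
  exceed chords below.\<close>

lemma sin_ge_third:
  assumes "0 \<le> x" "x \<le> pi / 2"
  shows "x / 3 \<le> sin x"
proof (cases "x \<le> pi / 3")
  case True
  have "(\<lambda>x. sin x - x / 3) 0 \<le> (\<lambda>x. sin x - x / 3) x"
  proof (rule DERIV_nonneg_imp_nondecreasing[of 0 x "\<lambda>x. sin x - x / 3"])
    fix y assume y: "0 \<le> y" "y \<le> x"
    then have "cos (pi / 3) \<le> cos y" using True by (intro cos_monotone_0_pi_le) auto
    then have "0 \<le> cos y - 1 / 3" by (simp add: cos_60)
    then show "\<exists>d. ((\<lambda>x. sin x - x / 3) has_real_derivative d) (at y) \<and> 0 \<le> d"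
      by (intro exI[of _ "cos y - 1 / 3"]) (auto intro!: derivative_eq_intros)
  qed fact
  then show ?thesis by simp
next
  case False
  then have "sin (pi / 3) \<le> sin x" using assms by (intro sin_monotone_2pi_le) auto
  moreover have "(4/3)\<^sup>2 \<le> (3::real)" by (simp add: power2_eq_square)
  then have "4/3 \<le> sqrt 3" by (rule real_le_rsqrt)
  ultimately show ?thesis using assms pi_less_4 by (simp add: sin_60)
qed

lemma cmod_cis_diff: "cmod (cis s - cis t) = 2 * \<bar>sin ((s - t) / 2)\<bar>"
proof -
  have "(cmod (cis s - cis t))\<^sup>2 = 2 - 2 * cos (s - t)"
    by (simp add: cmod_power2 cos_diff power2_diff algebra_simps)
  also have "\<dots> = (2 * \<bar>sin ((s - t) / 2)\<bar>)\<^sup>2"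
  proof -
    define x where "x = (s - t) / 2"
    have "s - t = 2 * x" by (simp add: x_def)
    then show ?thesis using cos_double_sin[of x] by (simp add: power_mult_distrib)
  qed
  finally show ?thesis by (subst (asm) power2_eq_iff_nonneg) auto
qed

lemma cmod_cis_diff_le: "cmod (cis s - cis t) \<le> \<bar>s - t\<bar>"
  using abs_sin_x_le_abs_x[of "(s - t) / 2"] by (simp add: cmod_cis_diff)

lemma abs_le_cmod_cis_diff:
  assumes "\<bar>s - t\<bar> \<le> pi"
  shows "\<bar>s - t\<bar> \<le> 3 * cmod (cis s - cis t)"
proof -
  have "\<bar>s - t\<bar> / 2 / 3 \<le> sin (\<bar>s - t\<bar> / 2)" using assms by (intro sin_ge_third) auto
  also have "\<dots> \<le> \<bar>sin ((s - t) / 2)\<bar>"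
    using sin_minus[of "(s - t) / 2"] by (auto simp: abs_if minus_divide_left)
  finally show ?thesis by (simp add: cmod_cis_diff)
qed

lemma tent_subset_disc: "tent \<zeta> \<delta> \<subseteq> unit_disc"
  by (auto simp: tent_def)

text \<open>Two unit vectors differ by at most 2, and \<open>sgn 0 = 0\<close> is at distance 1 from
  \<zeta>. Tents of scale above 2 are therefore all equal, which is why scales up to 4 suffice
  later.\<close>

lemma tent_eq_disc:
  assumes "cmod \<zeta> = 1" "2 < \<delta>" shows "tent \<zeta> \<delta> = unit_disc"
proof -
  have "cmod (sgn w - \<zeta>) < \<delta>" for w
    using norm_triangle_ineq4[of "sgn w" \<zeta>] assms by (simp add: norm_sgn split: if_splits)
  moreover have "1 - \<delta> < cmod w" for w using assms(2) norm_ge_zero[of w] by linarith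
  ultimately show ?thesis by (auto simp: tent_def)
qed

lemma tent_borel [measurable]: "tent \<zeta> \<delta> \<in> sets borel"
proof -
  have [measurable]: "unit_disc \<in> sets borel" by simp
  have "tent \<zeta> \<delta> = {w \<in> space borel. w \<in> unit_disc \<and> 1 - \<delta> < cmod w \<and> cmod (sgn w - \<zeta>) < \<delta>}"
    by (auto simp: tent_def)
  also have "\<dots> \<in> sets borel" unfolding sgn_div_norm by measurable
  finally show ?thesis .
qed

lemma tent_in_sets:
  assumes "sets M = sets (restrict_space borel unit_disc)"
  shows "tent \<zeta> \<delta> \<in> sets M"
  unfolding assms using tent_subset_disc by (subst sets_restrict_space_iff) auto

text \<open>The angular part of a tent: in polar coordinates a tent is this set times a radial
  interval, so its weight factorises.\<close>

definition arc :: "complex \<Rightarrow> real \<Rightarrow> real set" where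
  "arc \<zeta> \<delta> = {t. 0 < t \<and> t < 2 * pi \<and> cmod (cis t - \<zeta>) < \<delta>}"

lemma arc_borel [measurable]: "arc \<zeta> \<delta> \<in> sets borel"
proof -
  have "arc \<zeta> \<delta> = {t \<in> space borel. 0 < t \<and> t < 2 * pi \<and> cmod (cis t - \<zeta>) < \<delta>}"
    by (auto simp: arc_def)
  also have "\<dots> \<in> sets borel" unfolding cis_conv_exp by measurable
  finally show ?thesis .
qed

lemma emeasure_arc_ge:
  assumes "cmod \<zeta> = 1" "0 < \<delta>"
  shows "ennreal (min \<delta> 1) \<le> emeasure lborel (arc \<zeta> \<delta>)"
proof -
  define \<alpha> where "\<alpha> = Arg2pi \<zeta>"
  have \<alpha>: "0 \<le> \<alpha>" "\<alpha> < 2 * pi" by (auto simp: \<alpha>_def Arg2pi_ge_0 Arg2pi_lt_2pi)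
  have \<zeta>: "\<zeta> = cis \<alpha>"
    using Arg2pi_eq[of \<zeta>] assms(1) by (simp add: \<alpha>_def cis_conv_exp)
  define \<epsilon> where "\<epsilon> = min \<delta> 1"
  have \<epsilon>: "0 < \<epsilon>" "\<epsilon> \<le> \<delta>" "\<epsilon> \<le> 1" using assms by (auto simp: \<epsilon>_def)
  \<comment> \<open>An interval on one side of \<alpha> is enough; the side is chosen so that, with
    length at most 1, it stays inside (0, 2\<pi>).\<close>
  define I where "I = (if \<alpha> \<le> pi then {\<alpha><..<\<alpha> + \<epsilon>} else {\<alpha> - \<epsilon><..<\<alpha>})"
  have "I \<subseteq> arc \<zeta> \<delta>"
  proof
    fix t assume t: "t \<in> I"
    have "cmod (cis t - \<zeta>) \<le> \<bar>t - \<alpha>\<bar>" unfolding \<zeta> by (rule cmod_cis_diff_le)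
    also have "\<dots> < \<delta>" using t \<epsilon> by (auto simp: I_def split: if_splits)
    finally show "t \<in> arc \<zeta> \<delta>"
      using t \<epsilon> \<alpha> pi_gt3 by (auto simp: arc_def I_def split: if_splits)
  qed
  then have "emeasure lborel I \<le> emeasure lborel (arc \<zeta> \<delta>)" by (intro emeasure_mono) auto
  moreover have "emeasure lborel I = ennreal \<epsilon>" using \<epsilon> by (simp add: I_def)
  ultimately show ?thesis by (simp add: \<epsilon>_def)
qed

lemma emeasure_arc_le:
  assumes "cmod \<zeta> = 1" "0 < \<delta>"
  shows "emeasure lborel (arc \<zeta> \<delta>) \<le> ennreal (18 * \<delta>)"
proof -
  define \<alpha> where "\<alpha> = Arg2pi \<zeta>"
  have \<alpha>: "0 \<le> \<alpha>" "\<alpha> < 2 * pi" by (auto simp: \<alpha>_def Arg2pi_ge_0 Arg2pi_lt_2pi)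
  have \<zeta>: "\<zeta> = cis \<alpha>"
    using Arg2pi_eq[of \<zeta>] assms(1) by (simp add: \<alpha>_def cis_conv_exp)
  define J where "J s = {s - 3 * \<delta>..s + 3 * \<delta>}" for s
  \<comment> \<open>The arc may wrap around the angle 0, so three lifts of \<zeta> are covered. Each
    interval has length 6\<delta>, which gives the 18.\<close>
  have "arc \<zeta> \<delta> \<subseteq> J \<alpha> \<union> J (\<alpha> + 2 * pi) \<union> J (\<alpha> - 2 * pi)"
  proof
    fix t assume t: "t \<in> arc \<zeta> \<delta>"
    have *: "\<bar>t - s\<bar> \<le> 3 * \<delta>" if "cis s = \<zeta>" "\<bar>t - s\<bar> \<le> pi" for s
      using abs_le_cmod_cis_diff[OF that(2)] that(1) t by (auto simp: arc_def)
    have c: "cis (\<alpha> + 2 * pi) = \<zeta>" "cis (\<alpha> - 2 * pi) = \<zeta>"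
      by (simp_all add: \<zeta> complex_eq_iff cos_diff sin_diff)
    have "\<bar>t - \<alpha>\<bar> \<le> pi \<or> \<bar>t - (\<alpha> + 2 * pi)\<bar> \<le> pi \<or> \<bar>t - (\<alpha> - 2 * pi)\<bar> \<le> pi"
      using t \<alpha> unfolding arc_def by auto
    then show "t \<in> J \<alpha> \<union> J (\<alpha> + 2 * pi) \<union> J (\<alpha> - 2 * pi)"
      using *[OF \<zeta>[symmetric]] *[OF c(1)] *[OF c(2)] unfolding J_def by auto
  qed
  then have "emeasure lborel (arc \<zeta> \<delta>) \<le> emeasure lborel (J \<alpha> \<union> J (\<alpha> + 2 * pi) \<union> J (\<alpha> - 2 * pi))"
    by (intro emeasure_mono) (auto simp: J_def)
  also have "\<dots> \<le> emeasure lborel (J \<alpha> \<union> J (\<alpha> + 2 * pi)) + emeasure lborel (J (\<alpha> - 2 * pi))"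
    by (intro emeasure_subadditive) (auto simp: J_def)
  also have "\<dots> \<le> (emeasure lborel (J \<alpha>) + emeasure lborel (J (\<alpha> + 2 * pi))) + emeasure lborel (J (\<alpha> - 2 * pi))"
    by (intro add_right_mono emeasure_subadditive) (auto simp: J_def)
  also have "\<dots> = ennreal (18 * \<delta>)"
  proof -
    have "emeasure lborel (J s) = ennreal (6 * \<delta>)" for s using assms by (simp add: J_def)
    then show ?thesis using assms by (simp add: ennreal_plus[symmetric] del: ennreal_plus)
  qed
  finally show ?thesis .
qed

lemma arc_doubling:
  assumes "cmod \<zeta> = 1" "0 < \<delta>"
  shows "emeasure lborel (arc \<zeta> (2 * \<delta>)) \<le> ennreal 36 * emeasure lborel (arc \<zeta> \<delta>)"
proof -
  \<comment> \<open>The constant 36 is 18 times the doubled radius; for \<delta> > 1 it exceeds the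
    full length 2\<pi> anyway.\<close>
  have "emeasure lborel (arc \<zeta> (2 * \<delta>)) \<le> ennreal (36 * min \<delta> 1)"
  proof (cases "\<delta> \<le> 1")
    case True
    then show ?thesis using emeasure_arc_le[of \<zeta> "2 * \<delta>"] assms by simp
  next
    case False
    have "emeasure lborel (arc \<zeta> (2 * \<delta>)) \<le> emeasure lborel {0..2 * pi}"
      by (intro emeasure_mono) (auto simp: arc_def)
    also have "\<dots> = ennreal (2 * pi)" by simp
    also have "\<dots> \<le> ennreal 36" using pi_less_4 by (intro ennreal_leI) auto
    finally show ?thesis using False by simp
  qed
  also have "\<dots> = ennreal 36 * ennreal (min \<delta> 1)" using assms by (intro ennreal_mult) auto
  also have "\<dots> \<le> ennreal 36 * emeasure lborel (arc \<zeta> \<delta>)"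
    by (intro mult_left_mono emeasure_arc_ge assms) auto
  finally show ?thesis .
qed

section \<open>Weight and doubling of tents\<close>

context doubling_radial
begin

definition tail :: "real \<Rightarrow> ennreal" where "tail r = (\<integral>\<^sup>+\<rho>\<in>{r<..}. \<kappa> \<rho> \<partial>lborel)"

lemma borel_sets_W: "A \<in> sets borel \<Longrightarrow> A \<subseteq> unit_disc \<Longrightarrow> A \<in> sets W"
  using sets_W by (auto simp: sets_restrict_space_iff intro: subsetD)

lemma tent_sets_W [measurable]: "tent \<zeta> \<delta> \<in> sets W"
  by (intro borel_sets_W tent_borel tent_subset_disc)

lemma emeasure_W:
  assumes "A \<in> sets borel" "A \<subseteq> unit_disc"
  shows "emeasure W A = (\<integral>\<^sup>+\<rho>. \<kappa> \<rho> * circle_integral (indicator A) \<rho> \<partial>lborel)"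
  using assms by (subst polar[symmetric]) (auto simp: borel_sets_W)

lemma emeasure_tent:
  "emeasure W (tent \<zeta> \<delta>) = emeasure lborel (arc \<zeta> \<delta>) * tail (1 - \<delta>)"
proof -
  have "emeasure W (tent \<zeta> \<delta>) = (\<integral>\<^sup>+\<rho>. \<kappa> \<rho> * circle_integral (indicator (tent \<zeta> \<delta>)) \<rho> \<partial>lborel)"
    by (intro emeasure_W tent_borel tent_subset_disc)
  also have "\<dots> = (\<integral>\<^sup>+\<rho>. emeasure lborel (arc \<zeta> \<delta>) * (\<kappa> \<rho> * indicator {1 - \<delta><..} \<rho>) \<partial>lborel)"
  proof (rule nn_integral_cong)
    fix \<rho> :: real
    show "\<kappa> \<rho> * circle_integral (indicator (tent \<zeta> \<delta>)) \<rho>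
      = emeasure lborel (arc \<zeta> \<delta>) * (\<kappa> \<rho> * indicator {1 - \<delta><..} \<rho>)"
    proof (cases "0 < \<rho> \<and> \<rho> < 1")
      case True
      have s: "sgn (rcis \<rho> t) = cis t" for t
        using True by (simp add: rcis_def sgn_mult sgn_of_real)
      have "circle_integral (indicator (tent \<zeta> \<delta>)) \<rho>
         = (\<integral>\<^sup>+t. indicator {1 - \<delta><..} \<rho> * indicator (arc \<zeta> \<delta>) t \<partial>lborel)"
        using True by (intro nn_integral_cong) (auto simp: indicator_def tent_def arc_def s)
      also have "\<dots> = indicator {1 - \<delta><..} \<rho> * emeasure lborel (arc \<zeta> \<delta>)"
        by (subst nn_integral_cmult) auto
      finally show ?thesis by (simp add: mult_ac)
    qed (use kappa_zero in auto)
  qed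
  also have "\<dots> = emeasure lborel (arc \<zeta> \<delta>) * tail (1 - \<delta>)"
    unfolding tail_def by (rule nn_integral_cmult) measurable
  finally show ?thesis .
qed

text \<open>The doubling constant of tents: 36 from the angular factor, \<open>D\<close> from the
  radial one.\<close>

definition K :: real where "K = 36 * D"

lemma K_ge_1: "1 \<le> K" using D_ge_1 by (simp add: K_def)

lemma tent_doubling:
  assumes "cmod \<zeta> = 1" "0 < \<delta>"
  shows "emeasure W (tent \<zeta> (2 * \<delta>)) \<le> ennreal K * emeasure W (tent \<zeta> \<delta>)"
proof -
  have "emeasure W (tent \<zeta> (2 * \<delta>)) \<le> (ennreal 36 * emeasure lborel (arc \<zeta> \<delta>)) * (ennreal D * tail (1 - \<delta>))"
    unfolding emeasure_tent tail_def
    by (intro mult_mono arc_doubling tail_doubling assms) auto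
  also have "\<dots> = ennreal K * emeasure W (tent \<zeta> \<delta>)"
    using D_ge_1 by (simp add: emeasure_tent K_def ennreal_mult mult_ac)
  finally show ?thesis .
qed

lemma tent_doubling_power:
  assumes "cmod \<zeta> = 1" "0 < \<delta>"
  shows "emeasure W (tent \<zeta> (2 ^ n * \<delta>)) \<le> ennreal (K ^ n) * emeasure W (tent \<zeta> \<delta>)"
proof (induction n)
  case (Suc n)
  have "emeasure W (tent \<zeta> (2 ^ Suc n * \<delta>)) \<le> ennreal K * emeasure W (tent \<zeta> (2 ^ n * \<delta>))"
    using tent_doubling[OF assms(1), of "2 ^ n * \<delta>"] assms(2) by (simp add: mult.assoc)
  also have "\<dots> \<le> ennreal K * (ennreal (K ^ n) * emeasure W (tent \<zeta> \<delta>))"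
    by (intro mult_left_mono Suc.IH) simp
  finally show ?case using K_ge_1 by (simp add: ennreal_mult mult.assoc)
qed simp

lemma tent_pos:
  assumes "cmod \<zeta> = 1" "0 < \<delta>"
  shows "0 < emeasure W (tent \<zeta> \<delta>)"
proof -
  have "0 < emeasure lborel (arc \<zeta> \<delta>)"
    using emeasure_arc_ge[OF assms] assms(2) by (auto elim!: order.strict_trans2[rotated])
  moreover have "0 < tail (1 - \<delta>)" unfolding tail_def using assms by (intro tail_pos) auto
  ultimately show ?thesis by (simp add: emeasure_tent ennreal_zero_less_mult_iff)
qed

lemma tent_finite: "emeasure W (tent \<zeta> \<delta>) < \<infinity>"
proof -
  have "emeasure W (tent \<zeta> \<delta>) \<le> emeasure W unit_disc"
    by (intro emeasure_mono tent_subset_disc borel_sets_W) auto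
  then show ?thesis using finite_W by (rule order.strict_trans1)
qed

end

section \<open>The Carleson embedding\<close>

text \<open>The boundary point over which the tents belonging to z are built. The origin has no
  direction and receives an arbitrary unit vector.\<close>

definition vertex :: "complex \<Rightarrow> complex" where
  "vertex z = (if z = 0 then 1 else sgn z)"

lemma cmod_vertex [simp]: "cmod (vertex z) = 1"
  by (simp add: vertex_def norm_sgn)

text \<open>The denominator of the kernel dominates both coordinates of a tent. For the chord put s
  = |z||w| and e = conj(sgn z) sgn w: then |e - 1| <= (1 - s) + |1 - s e| <= 2 |1 - s e|.\<close>

lemma cmod_one_minus_cnj_mult_ge:
  assumes "cmod z < 1" "cmod w < 1"
  shows "1 - cmod z \<le> cmod (1 - cnj z * w)"
    and "cmod (sgn w - vertex z) / 2 \<le> cmod (1 - cnj z * w)"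
proof -
  have "cmod (cnj z * w) \<le> cmod z * 1"
    unfolding norm_mult complex_mod_cnj using assms by (intro mult_left_mono) auto
  then show "1 - cmod z \<le> cmod (1 - cnj z * w)"
    using norm_triangle_ineq2[of 1 "cnj z * w"] by simp
  show "cmod (sgn w - vertex z) / 2 \<le> cmod (1 - cnj z * w)"
  proof (cases "z = 0 \<or> w = 0")
    case True
    have "cmod (sgn w - vertex z) \<le> cmod (sgn w) + 1"
      using norm_triangle_ineq4[of "sgn w" "vertex z"] by simp
    also have "\<dots> \<le> 2" by (simp add: norm_sgn)
    finally show ?thesis using True by auto
  next
    case False
    define s where "s = cmod z * cmod w"
    define e where "e = cnj (sgn z) * sgn w"
    have s: "0 \<le> s" "s < 1" using assms mult_strict_mono[of "cmod z" 1 "cmod w" 1] False by (auto simp: s_def)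
    have e: "cmod e = 1" using False by (simp add: e_def norm_mult norm_sgn)
    have zw: "cnj z * w = of_real s * e"
      using False by (simp add: s_def e_def sgn_eq)
    have "sgn z * cnj (sgn z) = 1" using False by (simp add: complex_norm_square[symmetric] norm_sgn)
    then have "vertex z * (e - 1) = sgn w - vertex z"
      using False by (simp add: vertex_def e_def algebra_simps)
    then have "cmod (sgn w - vertex z) = cmod (e - 1)" by (metis cmod_vertex mult_1 norm_mult)
    also have "e - 1 = of_real (1 - s) * e - (1 - of_real s * e)" by (simp add: algebra_simps)
    also have "cmod \<dots> \<le> (1 - s) + cmod (1 - of_real s * e)"
      using norm_triangle_ineq4[of "of_real (1 - s) * e" "1 - of_real s * e"] s e
      by (simp add: norm_mult del: of_real_diff)
    also have "1 - s \<le> cmod (1 - of_real s * e)"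
      using norm_triangle_ineq2[of 1 "of_real s * e"] s e by (simp add: norm_mult)
    finally show ?thesis by (simp add: zw)
  qed
qed

abbreviation shadow :: "complex \<Rightarrow> nat \<Rightarrow> complex set" where
  "shadow z i \<equiv> {w. cmod (sgn w - vertex z) < 2 ^ i * (1 - cmod z)}"

abbreviation decay :: "nat \<Rightarrow> nat \<Rightarrow> ennreal" where
  "decay N i \<equiv> ennreal (8 ^ N / 2 ^ (N * i))"

text \<open>Let i be the least scale with w in \<open>shadow z i\<close>. For i > 0 the chord is at
  least 2^(i-1) \<delta>, so the denominator is at least 2^(i-2) \<delta>; the numerator is at most
  2\<delta>, whence 8 / 2^i. That single term already bounds the kernel; the sum over all scales is
  a form that can be integrated term by term without selecting i as a function of w.\<close>

lemma kernel_dyadic_bound: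
  fixes N :: nat
  assumes z: "cmod z < 1" and w: "cmod w < 1"
  shows "ennreal (cmod (((1 - of_real ((cmod z)\<^sup>2)) / (1 - cnj z * w)) ^ N))
    \<le> (\<Sum>i. decay N i * indicator (shadow z i) w)"
proof -
  let ?k = "(1 - of_real ((cmod z)\<^sup>2)) / (1 - cnj z * w)"
  define \<delta> where "\<delta> = 1 - cmod z"
  have \<delta>: "0 < \<delta>" using z by (simp add: \<delta>_def)
  define x where "x = cmod (sgn w - vertex z)"
  define d where "d = cmod (1 - cnj z * w)"
  have d: "\<delta> \<le> d" "x / 2 \<le> d"
    using cmod_one_minus_cnj_mult_ge[OF z w] by (simp_all add: \<delta>_def x_def d_def)
  have num: "cmod (1 - of_real ((cmod z)\<^sup>2)) \<le> 2 * \<delta>"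
  proof -
    have "(cmod z)\<^sup>2 \<le> 1" using z by (simp add: power_le_one)
    then have "cmod (1 - of_real ((cmod z)\<^sup>2)) = 1 - (cmod z)\<^sup>2"
      by (metis abs_of_nonneg diff_ge_0_iff_ge norm_of_real of_real_1 of_real_diff)
    also have "\<dots> = (1 + cmod z) * \<delta>" by (simp add: \<delta>_def power2_eq_square algebra_simps)
    also have "\<dots> \<le> 2 * \<delta>" using z \<delta> by (intro mult_right_mono) auto
    finally show ?thesis .
  qed
  obtain j where "x / \<delta> < 2 ^ j" using real_arch_pow[of 2 "x / \<delta>"] by auto
  then have ex: "x < 2 ^ j * \<delta>" using \<delta> by (simp add: field_simps)
  define i where "i = (LEAST i. x < 2 ^ i * \<delta>)"
  have i: "x < 2 ^ i * \<delta>" unfolding i_def by (rule LeastI) (rule ex)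
  have "2 * \<delta> / d \<le> 8 / 2 ^ i"
  proof (cases i)
    case 0
    have "2 * \<delta> / d \<le> 2 * \<delta> / \<delta>" using d \<delta> by (intro divide_left_mono mult_pos_pos) auto
    then show ?thesis using 0 \<delta> by simp
  next
    case (Suc k)
    then have "\<not> x < 2 ^ k * \<delta>" using not_less_Least[of k "\<lambda>i. x < 2 ^ i * \<delta>"] by (simp add: i_def)
    then have "2 ^ k * \<delta> / 2 \<le> d" using d by simp
    then have "2 * \<delta> / d \<le> 2 * \<delta> / (2 ^ k * \<delta> / 2)" using \<delta> d by (intro divide_left_mono mult_pos_pos) auto
    then show ?thesis using Suc \<delta> by simp
  qed
  then have "cmod ?k \<le> 8 / 2 ^ i"
    using divide_right_mono[OF num, of d] by (simp add: norm_divide d_def)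
  then have "cmod (?k ^ N) \<le> (8 / 2 ^ i) ^ N"
    unfolding norm_power by (intro power_mono) auto
  also have "\<dots> = 8 ^ N / 2 ^ (N * i)"
    by (simp add: power_divide power_mult[symmetric] mult.commute)
  finally have "ennreal (cmod (?k ^ N))
    \<le> decay N i * indicator (shadow z i) w"
    using i by (auto simp: x_def \<delta>_def intro!: ennreal_leI)
  also have "\<dots> \<le> (\<Sum>i. decay N i * indicator (shadow z i) w)"
    (is "_ \<le> (\<Sum>i. ?F i)")
  proof -
    have "sum ?F {i} \<le> suminf ?F" by (rule sum_le_suminf) (auto simp: summableI)
    moreover have "sum ?F {i} = ?F i" by (subst sum.insert) (auto simp del: sum.insert)
    ultimately show ?thesis by (simp only:)
  qed
  finally show ?thesis .
qed

text \<open>The zeros are countable, hence so are their moduli. The nonvanishing assumption of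
  \<open>holomorphic_power_submean\<close> thus costs nothing after integration over the
  radius.\<close>

lemma AE_radius_nonzero:
  assumes f: "f holomorphic_on unit_disc" and nz: "\<exists>w\<in>unit_disc. f w \<noteq> 0"
  shows "AE \<rho> in lborel. \<rho> < 1 \<longrightarrow> (\<forall>w. cmod w = \<rho> \<longrightarrow> f w \<noteq> 0)"
proof -
  have "countable {w \<in> unit_disc. f w = 0}"
  proof (cases "f constant_on unit_disc")
    case True
    then have "{w \<in> unit_disc. f w = 0} = {}" using nz by (auto simp: constant_on_def)
    then show ?thesis by (metis countable_empty)
  next
    case False
    have "unit_disc = (\<Union>n. cball 0 (1 - inverse (real (Suc n))))"
    proof (intro equalityI subsetI)
      fix z :: complex assume "z \<in> unit_disc"
      then obtain n where "inverse (real (Suc n)) < 1 - cmod z"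
        using reals_Archimedean[of "1 - cmod z"] by auto
      then show "z \<in> (\<Union>n. cball 0 (1 - inverse (real (Suc n))))" by (auto intro!: exI[of _ n])
    next
      fix z :: complex assume "z \<in> (\<Union>n. cball 0 (1 - inverse (real (Suc n))))"
      then obtain n where "cmod z \<le> 1 - inverse (real (Suc n))" by auto
      also have "\<dots> < 1" by simp
      finally show "z \<in> unit_disc" by simp
    qed
    then have "fsigma unit_disc" by (metis fsigma.intros closed_cball)
    with False show ?thesis by (intro holomorphic_countable_zeros f) auto
  qed
  then have "countable (cmod ` {w \<in> unit_disc. f w = 0})" by (rule countable_image)
  then have "AE \<rho> in lborel. \<rho> \<notin> cmod ` {w \<in> unit_disc. f w = 0}"
    by (intro AE_not_in countable_imp_null_set_lborel)
  then show ?thesis by eventually_elim auto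
qed

section \<open>Sub-mean value estimates with respect to the weight\<close>

context doubling_radial
begin

lemma measurable_W:
  fixes g :: "complex \<Rightarrow> 'a::topological_space"
  shows "g \<in> borel_measurable borel \<Longrightarrow> g \<in> borel_measurable W"
proof (rule measurableI)
  fix A :: "'a set" assume g: "g \<in> borel_measurable borel" and "A \<in> sets borel"
  then have "g -` A \<inter> space borel \<in> sets borel" by (intro measurable_sets)
  then have "g -` A \<inter> unit_disc \<in> sets borel" by (intro sets.Int) auto
  then show "g -` A \<inter> space W \<in> sets W" unfolding space_W by (rule borel_sets_W) simp
qed simp

text \<open>The estimate on circles is multiplied by \<kappa>(\<rho>) and integrated over \<rho> > 1
  - \<delta>/2. The left side becomes u(z) times the tail at 1 - \<delta>/2, which one doubling
  compares with the tail at 1 - \<delta> and hence with the tent of scale \<delta>; on the right the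
  kernel is split dyadically.\<close>

lemma submean_tent_sum:
  fixes f :: "complex \<Rightarrow> complex" and q :: real and N :: nat
  assumes f: "f holomorphic_on unit_disc" and [measurable]: "f \<in> borel_measurable borel"
    and nz: "\<exists>w\<in>unit_disc. f w \<noteq> 0" and q: "0 < q" and z: "z \<in> unit_disc"
  shows "ennreal (cmod (f z) powr q) * emeasure W (tent (vertex z) (1 - cmod z))
    \<le> ennreal (18 * D) * (\<Sum>i. decay N i *
        (\<integral>\<^sup>+w\<in>tent (vertex z) (2 ^ i * (1 - cmod z)). ennreal (cmod (f w) powr q) \<partial>W))"
proof -
  define \<delta> where "\<delta> = 1 - cmod z"
  have \<delta>: "0 < \<delta>" "\<delta> \<le> 1" using z by (auto simp: \<delta>_def)
  define u where "u w = cmod (f w) powr q" for w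
  define k where "k w = ((1 - of_real ((cmod z)\<^sup>2)) / (1 - cnj z * w)) ^ N" for w :: complex
  have [measurable]: "u \<in> borel_measurable borel" "k \<in> borel_measurable borel"
    unfolding u_def k_def by measurable
  have [measurable]: "unit_disc \<in> sets borel" by simp
  have k_hol: "k holomorphic_on ball 0 1"
  proof -
    have "1 - cnj z * w \<noteq> 0" if "w \<in> ball 0 1" for w
      using cmod_one_minus_cnj_mult_ge(1)[of z w] z that \<delta> by (auto simp: \<delta>_def)
    then show ?thesis unfolding k_def by (intro holomorphic_intros) auto
  qed
  have "cnj z * z = of_real ((cmod z)\<^sup>2)" by (metis complex_norm_square mult.commute)
  moreover have "1 - of_real ((cmod z)\<^sup>2) \<noteq> (0::complex)"
    using cmod_one_minus_cnj_mult_ge(1)[of z z] z \<delta> calculation by (auto simp: \<delta>_def)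
  ultimately have kz: "k z = 1" by (simp add: k_def)
  \<comment> \<open>This annulus lies within the radial range of every tent of scale 2^i \<delta>,
    so on it the shadows may be replaced by tents.\<close>
  define A where "A = {w \<in> unit_disc. 1 - \<delta> / 2 < cmod w}"
  have "A = {w \<in> space borel. w \<in> unit_disc \<and> 1 - \<delta> / 2 < cmod w}" by (auto simp: A_def)
  also have "\<dots> \<in> sets borel" by measurable
  finally have [measurable]: "A \<in> sets borel" .
  define G where "G w = ennreal (u w * cmod (k w)) * indicator A w" for w
  have [measurable]: "G \<in> borel_measurable borel" unfolding G_def by measurable
  let ?U = "\<lambda>i w. ennreal (u w) * indicator (tent (vertex z) (2 ^ i * \<delta>)) w"
  have key: "ennreal (u z) * (\<kappa> \<rho> * indicator {1 - \<delta> / 2<..} \<rho>)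
      \<le> ennreal (1 / \<delta>) * (\<kappa> \<rho> * circle_integral G \<rho>)"
    if nz\<rho>: "\<rho> < 1 \<longrightarrow> (\<forall>w. cmod w = \<rho> \<longrightarrow> f w \<noteq> 0)" for \<rho>
  proof (cases "1 - \<delta> / 2 < \<rho> \<and> \<rho> < 1")
    case True
    have zr: "cmod z < \<rho>" "\<delta> / 2 \<le> \<rho> - cmod z" using True \<delta> by (auto simp: \<delta>_def field_simps)
    have \<rho>: "0 < \<rho>" using zr norm_ge_zero[of z] by linarith
    have "ennreal (u z) \<le> ennreal (\<rho> / (2 * pi * (\<rho> - cmod z))) *
      (\<integral>\<^sup>+t\<in>{0<..<2*pi}. ennreal (cmod (f (rcis \<rho> t)) powr q * cmod (k (rcis \<rho> t))) \<partial>lborel)"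
      unfolding u_def using True nz\<rho> by (intro holomorphic_power_submean f k_hol kz zr q) auto
    also have "(\<integral>\<^sup>+t\<in>{0<..<2*pi}. ennreal (cmod (f (rcis \<rho> t)) powr q * cmod (k (rcis \<rho> t))) \<partial>lborel)
      = circle_integral G \<rho>"
      using True \<rho> by (intro nn_integral_cong) (auto simp: G_def A_def u_def)
    \<comment> \<open>This uses \<rho> < 1, \<rho> - |z| >= \<delta>/2 and \<pi> >= 1.\<close>
    also have "ennreal (\<rho> / (2 * pi * (\<rho> - cmod z))) \<le> ennreal (1 / \<delta>)"
    proof (rule ennreal_leI)
      have 1: "\<rho> / (2 * pi * (\<rho> - cmod z)) \<le> 1 / (2 * pi * (\<rho> - cmod z))"
        using True zr by (intro divide_right_mono mult_nonneg_nonneg) auto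
      have "\<delta> \<le> 2 * 1 * (\<rho> - cmod z)" using zr by simp
      also have "2 * 1 * (\<rho> - cmod z) \<le> 2 * pi * (\<rho> - cmod z)"
        using pi_ge_two zr by (intro mult_right_mono mult_left_mono) auto
      finally have "1 / (2 * pi * (\<rho> - cmod z)) \<le> 1 / \<delta>" using \<delta> zr by (intro divide_left_mono mult_pos_pos) auto
      with 1 show "\<rho> / (2 * pi * (\<rho> - cmod z)) \<le> 1 / \<delta>" by linarith
    qed
    finally have "ennreal (u z) \<le> ennreal (1 / \<delta>) * circle_integral G \<rho>"
      by (simp add: mult_right_mono)
    then have "ennreal (u z) * \<kappa> \<rho> \<le> ennreal (1 / \<delta>) * circle_integral G \<rho> * \<kappa> \<rho>"
      by (rule mult_right_mono) simp
    then show ?thesis using True by (simp add: mult_ac)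
  qed (use kappa_zero in \<open>auto simp: not_less\<close>)
  have "ennreal (u z) * tail (1 - \<delta> / 2) = (\<integral>\<^sup>+\<rho>. ennreal (u z) * (\<kappa> \<rho> * indicator {1 - \<delta> / 2<..} \<rho>) \<partial>lborel)"
    unfolding tail_def by (rule nn_integral_cmult[symmetric]) measurable
  also have "\<dots> \<le> (\<integral>\<^sup>+\<rho>. ennreal (1 / \<delta>) * (\<kappa> \<rho> * circle_integral G \<rho>) \<partial>lborel)"
  proof (rule nn_integral_mono_AE)
    show "AE \<rho> in lborel. ennreal (u z) * (\<kappa> \<rho> * indicator {1 - \<delta> / 2<..} \<rho>)
      \<le> ennreal (1 / \<delta>) * (\<kappa> \<rho> * circle_integral G \<rho>)"
      using AE_radius_nonzero[OF f nz] by eventually_elim (rule key)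
  qed
  also have "\<dots> = ennreal (1 / \<delta>) * (\<integral>\<^sup>+w. G w \<partial>W)"
    by (subst polar) (auto intro!: nn_integral_cmult)
  finally have main: "ennreal (u z) * tail (1 - \<delta> / 2) \<le> ennreal (1 / \<delta>) * (\<integral>\<^sup>+w. G w \<partial>W)" .
  \<comment> \<open>The arc contributes 18\<delta>, which cancels the 1/\<delta> from Cauchy's
    formula.\<close>
  have "ennreal (u z) * emeasure W (tent (vertex z) \<delta>)
      \<le> ennreal (u z) * (ennreal (18 * \<delta>) * (ennreal D * tail (1 - \<delta> / 2)))"
    unfolding emeasure_tent tail_def
    using tail_doubling[of "\<delta> / 2"] \<delta>
    by (intro mult_left_mono mult_mono emeasure_arc_le) auto
  also have "\<dots> = ennreal (18 * \<delta>) * ennreal D * (ennreal (u z) * tail (1 - \<delta> / 2))" by (simp add: mult_ac)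
  also have "\<dots> \<le> ennreal (18 * \<delta>) * ennreal D * (ennreal (1 / \<delta>) * (\<integral>\<^sup>+w. G w \<partial>W))"
    by (intro mult_left_mono main) simp
  also have "\<dots> = (ennreal (18 * \<delta>) * ennreal D * ennreal (1 / \<delta>)) * (\<integral>\<^sup>+w. G w \<partial>W)" by (simp add: mult_ac)
  also have "ennreal (18 * \<delta>) * ennreal D * ennreal (1 / \<delta>) = ennreal (18 * D)"
  proof -
    have "ennreal (18 * \<delta> * D) = ennreal (18 * \<delta>) * ennreal D"
      by (rule ennreal_mult) (use \<delta> D_ge_1 in auto)
    moreover have "ennreal (18 * \<delta> * D * (1 / \<delta>)) = ennreal (18 * \<delta> * D) * ennreal (1 / \<delta>)"
      by (rule ennreal_mult) (use \<delta> D_ge_1 in auto)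
    moreover have "18 * \<delta> * D * (1 / \<delta>) = 18 * D" using \<delta> by simp
    ultimately show ?thesis by metis
  qed
  also have "(\<integral>\<^sup>+w. G w \<partial>W) \<le> (\<integral>\<^sup>+w. (\<Sum>i. decay N i *
       ?U i w) \<partial>W)"
  proof (rule nn_integral_mono)
    fix w assume "w \<in> space W"
    then have w: "cmod w < 1" by (simp add: space_W)
    have "G w \<le> indicator A w * (ennreal (u w) * (\<Sum>i. decay N i * indicator (shadow z i) w))"
    proof -
      have "ennreal (cmod (k w)) \<le> (\<Sum>i. decay N i * indicator (shadow z i) w)"
        unfolding k_def by (rule kernel_dyadic_bound) (use z w in auto)
      then have "indicator A w * (ennreal (u w) * ennreal (cmod (k w))) \<le> indicator A w * (ennreal (u w) *
          (\<Sum>i. decay N i * indicator (shadow z i) w))"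
        by (intro mult_left_mono) auto
      moreover have "G w = indicator A w * (ennreal (u w) * ennreal (cmod (k w)))"
        by (simp add: G_def ennreal_mult u_def mult_ac)
      ultimately show ?thesis by (simp only:)
    qed
    also have "\<dots> = (\<Sum>i. indicator A w * (ennreal (u w) * (decay N i * indicator (shadow z i) w)))"
      by simp
    also have "\<dots> \<le> (\<Sum>i. decay N i * ?U i w)"
    proof (intro suminf_le summableI)
      fix i :: nat
      have "1 * \<delta> \<le> 2 ^ i * \<delta>" using \<delta> by (intro mult_right_mono) auto
      then have "\<delta> / 2 \<le> 2 ^ i * \<delta>" using \<delta> by linarith
      then show "indicator A w * (ennreal (u w) * (decay N i * indicator (shadow z i) w))
        \<le> decay N i * ?U i w"
        by (auto simp: indicator_def A_def tent_def \<delta>_def[symmetric] mult_ac)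
    qed
    finally show "G w \<le> (\<Sum>i. decay N i * ?U i w)" .
  qed
  also have "\<dots> = (\<Sum>i. \<integral>\<^sup>+w. decay N i * ?U i w \<partial>W)"
    by (intro nn_integral_suminf measurable_W) measurable
  also have "\<dots> = (\<Sum>i. decay N i * (\<integral>\<^sup>+w\<in>tent (vertex z) (2 ^ i * \<delta>). ennreal (u w) \<partial>W))"
    by (intro suminf_cong nn_integral_cmult measurable_W) measurable
  finally show ?thesis by (simp add: u_def \<delta>_def mult_left_mono)
qed

text \<open>Doubling lets the i-th average cost K^i, the kernel gains 2^(N i), and the series
  converges geometrically. The constant depends on the weight only, not on f, q, z or
  \<tau>.\<close>

lemma maximal_bound:
  obtains C :: real where "0 < C"
    and "\<And>f q z \<tau>. \<lbrakk>f holomorphic_on unit_disc; f \<in> borel_measurable borel; 0 < q; z \<in> unit_disc; 0 \<le> \<tau>;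
      \<And>\<delta>. 1 - cmod z \<le> \<delta> \<Longrightarrow> \<delta> \<le> 4 \<Longrightarrow> (\<integral>\<^sup>+w\<in>tent (vertex z) \<delta>. ennreal (cmod (f w) powr q) \<partial>W)
        \<le> ennreal \<tau> * emeasure W (tent (vertex z) \<delta>)\<rbrakk> \<Longrightarrow> cmod (f z) powr q \<le> C * \<tau>"
proof -
  \<comment> \<open>With this \<open>N\<close> each term is at most half the previous one, so the
    sum contributes the factor 2 in \<open>C\<close>.\<close>
  obtain N where "2 * K < 2 ^ N" using real_arch_pow[of 2 "2 * K"] by auto
  then have N: "K / 2 ^ N \<le> 1 / 2" by (simp add: field_simps)
  define C where "C = 18 * D * 8 ^ N * 2"
  have C: "0 < C" using D_ge_1 by (simp add: C_def)
  show ?thesis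
  proof (rule that[OF C])
    fix f q z and \<tau> :: real
    assume f: "f holomorphic_on unit_disc" "f \<in> borel_measurable borel" and q: "0 < q"
      and z: "z \<in> unit_disc" and \<tau>: "0 \<le> \<tau>"
      and avg: "\<And>\<delta>. 1 - cmod z \<le> \<delta> \<Longrightarrow> \<delta> \<le> 4 \<Longrightarrow> (\<integral>\<^sup>+w\<in>tent (vertex z) \<delta>. ennreal (cmod (f w) powr q) \<partial>W)
        \<le> ennreal \<tau> * emeasure W (tent (vertex z) \<delta>)"
    show "cmod (f z) powr q \<le> C * \<tau>"
    proof (cases "\<exists>w\<in>unit_disc. f w \<noteq> 0")
      case False
      then show ?thesis using z C \<tau> by simp
    next
      case True
      define \<delta> where "\<delta> = 1 - cmod z"
      have \<delta>: "0 < \<delta>" "\<delta> \<le> 1" using z by (auto simp: \<delta>_def)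
      let ?T = "\<lambda>\<delta>. tent (vertex z) \<delta>"
      let ?I = "\<lambda>i. \<integral>\<^sup>+w\<in>?T (2 ^ i * \<delta>). ennreal (cmod (f w) powr q) \<partial>W"
      \<comment> \<open>Scales above 4 give the whole disc, as does the scale 4, where the
        hypothesis is still available.\<close>
      have avg': "?I i \<le> ennreal \<tau> * emeasure W (?T (2 ^ i * \<delta>))" for i :: nat
      proof (cases "2 ^ i * \<delta> \<le> 4")
        case True
        have "1 * \<delta> \<le> 2 ^ i * \<delta>" using \<delta> by (intro mult_right_mono) auto
        then show ?thesis using True by (intro avg) (auto simp: \<delta>_def)
      next
        case False
        then have "?T (2 ^ i * \<delta>) = ?T 4" by (simp add: tent_eq_disc)
        moreover have "1 - cmod z \<le> 4" using norm_ge_zero[of z] by linarith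
        ultimately show ?thesis using avg[of 4] by simp
      qed
      have "ennreal (cmod (f z) powr q) * emeasure W (?T \<delta>) \<le> ennreal (18 * D) *
          (\<Sum>i. decay N i * ?I i)"
        unfolding \<delta>_def by (rule submean_tent_sum[OF f True q z])
      also have "\<dots> \<le> ennreal (18 * D) * (\<Sum>i. ennreal (8 ^ N * \<tau>) * emeasure W (?T \<delta>) * ennreal ((1/2) ^ i))"
      proof (intro mult_left_mono suminf_le summableI)
        fix i
        have "decay N i * ?I i
          \<le> decay N i * (ennreal \<tau> * (ennreal (K ^ i) * emeasure W (?T \<delta>)))"
          by (intro mult_left_mono order_trans[OF avg'] tent_doubling_power) (use \<delta> in auto)
        also have "\<dots> = ennreal (8 ^ N * \<tau> * (K / 2 ^ N) ^ i) * emeasure W (?T \<delta>)"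
        proof -
          have "ennreal \<tau> * ennreal (K ^ i) = ennreal (\<tau> * K ^ i)"
            by (rule ennreal_mult[symmetric]) (use \<tau> K_ge_1 in auto)
          then have "decay N i * (ennreal \<tau> * ennreal (K ^ i))
              = decay N i * ennreal (\<tau> * K ^ i)" by (simp only:)
          also have "\<dots> = ennreal (8 ^ N / 2 ^ (N * i) * (\<tau> * K ^ i))"
            by (rule ennreal_mult[symmetric]) (use \<tau> K_ge_1 in auto)
          also have "8 ^ N / 2 ^ (N * i) * (\<tau> * K ^ i) = 8 ^ N * \<tau> * (K / 2 ^ N) ^ i"
            by (simp add: power_divide power_mult)
          finally show ?thesis by (simp add: mult.assoc[symmetric])
        qed
        also have "\<dots> \<le> ennreal (8 ^ N * \<tau> * (1 / 2) ^ i) * emeasure W (?T \<delta>)"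
          using N K_ge_1 \<tau> by (intro mult_right_mono ennreal_leI mult_left_mono power_mono) auto
        also have "\<dots> = ennreal (8 ^ N * \<tau>) * emeasure W (?T \<delta>) * ennreal ((1/2) ^ i)"
          by (subst ennreal_mult) (use \<tau> in \<open>auto simp: mult_ac\<close>)
        finally show "decay N i * ?I i
          \<le> ennreal (8 ^ N * \<tau>) * emeasure W (?T \<delta>) * ennreal ((1/2) ^ i)" .
      qed simp
      also have "(\<Sum>i. ennreal (8 ^ N * \<tau>) * emeasure W (?T \<delta>) * ennreal ((1/2) ^ i))
          = ennreal (8 ^ N * \<tau>) * emeasure W (?T \<delta>) * (\<Sum>i. ennreal ((1/2) ^ i))"
        by (rule ennreal_suminf_cmult)
      also have "(\<Sum>i. ennreal ((1/2) ^ i)) = ennreal 2"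
        using geometric_sums[of "1/2 :: real"] by (intro suminf_ennreal_eq) auto
      also have "ennreal (18 * D) * (ennreal (8 ^ N * \<tau>) * emeasure W (?T \<delta>) * ennreal 2)
          = (ennreal (18 * D) * ennreal (8 ^ N * \<tau>) * ennreal 2) * emeasure W (?T \<delta>)" by (simp only: mult_ac)
      also have "ennreal (18 * D) * ennreal (8 ^ N * \<tau>) * ennreal 2 = ennreal (18 * D * (8 ^ N * \<tau>) * 2)"
      proof -
        have "ennreal (18 * D * (8 ^ N * \<tau>)) = ennreal (18 * D) * ennreal (8 ^ N * \<tau>)"
          by (rule ennreal_mult) (use D_ge_1 \<tau> in auto)
        moreover have "ennreal (18 * D * (8 ^ N * \<tau>) * 2) = ennreal (18 * D * (8 ^ N * \<tau>)) * ennreal 2"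
          by (rule ennreal_mult) (use D_ge_1 \<tau> in auto)
        ultimately show ?thesis by metis
      qed
      also have "18 * D * (8 ^ N * \<tau>) * 2 = C * \<tau>" by (simp add: C_def)
      finally have le: "ennreal (cmod (f z) powr q) * emeasure W (?T \<delta>) \<le> ennreal (C * \<tau>) * emeasure W (?T \<delta>)" .
      obtain m where m: "emeasure W (?T \<delta>) = ennreal m" "0 \<le> m"
        using tent_finite[of "vertex z" \<delta>] by (cases "emeasure W (?T \<delta>)") auto
      \<comment> \<open>The weight of the tent is finite and positive, so it can be cancelled from
        both sides.\<close>
      have "0 < m" using tent_pos[of "vertex z" \<delta>] \<delta> m by (simp add: ennreal_less_zero_iff)
      have "ennreal (cmod (f z) powr q * m) \<le> ennreal (C * \<tau> * m)"
        using le C \<tau> by (simp only: m(1)) (simp add: ennreal_mult[symmetric] m(2))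
      then have "cmod (f z) powr q * m \<le> C * \<tau> * m"
        using C \<tau> m(2) by (simp add: ennreal_le_iff)
      then show ?thesis using \<open>0 < m\<close> by simp
    qed
  qed
qed

end

section \<open>Vitali covering and the weak-type bound\<close>

lemma tent_cover_subset:
  assumes "cball \<zeta> \<delta> \<subseteq> ball \<zeta>' (5 * \<delta>')" "0 < \<delta>"
  shows "tent \<zeta> (2 * \<delta>) \<subseteq> tent \<zeta>' (16 * \<delta>')"
proof -
  have d: "dist \<zeta> \<zeta>' + \<delta> < 5 * \<delta>'"
    using assms by (auto simp: cball_subset_ball_iff)
  then have "\<delta> < 5 * \<delta>'" using zero_le_dist[of \<zeta> \<zeta>'] by linarith
  \<comment> \<open>The chord is below 2\<delta> + |\<zeta> - \<zeta>'| < 10\<delta>'. The larger 16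
    is a power of 2, so that four doublings undo the enlargement.\<close>
  have "cmod (sgn w - \<zeta>') < 16 * \<delta>'" if "cmod (sgn w - \<zeta>) < 2 * \<delta>" for w
    using norm_triangle_ineq[of "sgn w - \<zeta>" "\<zeta> - \<zeta>'"] that d \<open>\<delta> < 5 * \<delta>'\<close> zero_le_dist[of \<zeta> \<zeta>'] \<open>0 < \<delta>\<close>
    by (simp add: dist_norm)
  then show ?thesis using \<open>\<delta> < 5 * \<delta>'\<close> assms(2) by (auto simp: tent_def)
qed

text \<open>The factor 2 makes the strict inequalities of a tent hold: at \<delta> = 1 - |z| the
  radial one would be an equality, and at z = 0 so would the chordal one.\<close>

lemma tent_vertex:
  assumes "z \<in> unit_disc" "1 - cmod z \<le> \<delta>"
  shows "z \<in> tent (vertex z) (2 * \<delta>)"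
  using assms by (auto simp: tent_def vertex_def)

text \<open>The counting step of a covering argument: subadditivity for the enlarged sets,
  additivity for the disjoint original ones.\<close>

lemma countable_index_sum:
  fixes M N :: "'a measure" and X Y :: "'i \<Rightarrow> 'a set"
  assumes C: "countable C"
    and X: "\<And>i. i \<in> C \<Longrightarrow> X i \<in> sets M" and Y: "\<And>i. i \<in> C \<Longrightarrow> Y i \<in> sets N"
    and disj: "disjoint_family_on Y C"
    and le: "\<And>i. i \<in> C \<Longrightarrow> emeasure M (X i) \<le> c * emeasure N (Y i)"
  shows "emeasure M (\<Union>i\<in>C. X i) \<le> c * emeasure N (space N)"
proof -
  define I where "I = to_nat_on C ` C"
  define X' where "X' n = (if n \<in> I then X (from_nat_into C n) else {})" for n
  define Y' where "Y' n = (if n \<in> I then Y (from_nat_into C n) else {})" for n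
  have I: "from_nat_into C n \<in> C" "to_nat_on C (from_nat_into C n) = n" if "n \<in> I" for n
    using that C by (auto simp: I_def)
  have "(\<Union>i\<in>C. X i) \<subseteq> (\<Union>n. X' n)"
  proof
    fix x assume "x \<in> (\<Union>i\<in>C. X i)"
    then obtain i where "i \<in> C" "x \<in> X i" by auto
    then have "x \<in> X' (to_nat_on C i)" using C by (simp add: X'_def I_def)
    then show "x \<in> (\<Union>n. X' n)" by blast
  qed
  then have "emeasure M (\<Union>i\<in>C. X i) \<le> emeasure M (\<Union>n. X' n)"
    using X I(1) by (intro emeasure_mono sets.countable_UN) (auto simp: X'_def)
  also have "\<dots> \<le> (\<Sum>n. emeasure M (X' n))"
    by (rule emeasure_subadditive_countably) (use X I(1) in \<open>auto simp: X'_def\<close>)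
  also have "\<dots> \<le> (\<Sum>n. c * emeasure N (Y' n))"
    by (intro suminf_le summableI) (use le I(1) in \<open>auto simp: X'_def Y'_def\<close>)
  also have "\<dots> = c * (\<Sum>n. emeasure N (Y' n))" by (rule ennreal_suminf_cmult)
  also have "(\<Sum>n. emeasure N (Y' n)) = emeasure N (\<Union>n. Y' n)"
  proof (rule suminf_emeasure)
    show "range Y' \<subseteq> sets N" using Y I(1) by (auto simp: Y'_def)
    show "disjoint_family Y'"
      unfolding disjoint_family_on_def
    proof (intro ballI impI)
      fix m n :: nat assume "m \<noteq> n"
      then show "Y' m \<inter> Y' n = {}"
        using disj I by (auto simp: Y'_def disjoint_family_on_def) (metis disjoint_iff I)
    qed
  qed
  also have "\<dots> \<le> emeasure N (space N)"
    by (rule emeasure_space)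
  finally show ?thesis by (simp add: mult_left_mono)
qed

context doubling_radial
begin

definition tent_bounded :: "complex measure \<Rightarrow> real \<Rightarrow> bool" where
  "tent_bounded \<mu> B \<longleftrightarrow> sets \<mu> = sets (restrict_space borel unit_disc) \<and> 0 \<le> B \<and>
     (\<forall>\<zeta> \<delta>. cmod \<zeta> = 1 \<longrightarrow> 0 < \<delta> \<longrightarrow> emeasure \<mu> (tent \<zeta> \<delta>) \<le> ennreal B * emeasure W (tent \<zeta> \<delta>))"

text \<open>Let v be u restricted to {u > \<tau>}. If v had average at most \<tau> on every tent
  over the vertex of z, then u would have average at most 2\<tau> there, and
  \<open>maximal_bound\<close> would give u(z) <= \<eta>/2. So each z with u(z) > \<eta> has a tent
  on which v has average at least \<tau>, and Vitali selects disjoint ones whose enlargements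
  cover.\<close>

lemma weak_type:
  obtains C :: real where "0 < C"
    and "\<And>f q \<mu> B \<eta>. \<lbrakk>f holomorphic_on unit_disc; f \<in> borel_measurable borel; 0 < q;
      tent_bounded \<mu> B; 0 < \<eta>\<rbrakk>
      \<Longrightarrow> emeasure \<mu> {z \<in> unit_disc. \<eta> < cmod (f z) powr q} \<le> ennreal (C * B / \<eta>) *
        (\<integral>\<^sup>+w. ennreal (cmod (f w) powr q) * indicator {w. \<eta> < C * cmod (f w) powr q} w \<partial>W)"
proof -
  obtain C0 :: real where C0: "0 < C0"
    and mb: "\<And>f q z \<tau>. \<lbrakk>f holomorphic_on unit_disc; f \<in> borel_measurable borel; 0 < q; z \<in> unit_disc; 0 \<le> \<tau>;
      \<And>\<delta>. 1 - cmod z \<le> \<delta> \<Longrightarrow> \<delta> \<le> 4 \<Longrightarrow> (\<integral>\<^sup>+w\<in>tent (vertex z) \<delta>. ennreal (cmod (f w) powr q) \<partial>W)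
        \<le> ennreal \<tau> * emeasure W (tent (vertex z) \<delta>)\<rbrakk> \<Longrightarrow> cmod (f z) powr q \<le> C0 * \<tau>"
    using maximal_bound by blast
  \<comment> \<open>4 \<open>C0\<close> comes from the choice of \<tau> below, K^4 from four
    doublings of the selected tents.\<close>
  define C where "C = 4 * C0 * K ^ 4"
  have K4: "1 \<le> K ^ 4" using K_ge_1 by (rule one_le_power)
  have "0 < K ^ 4" using K4 by linarith
  then have C: "0 < C" using C0 by (simp add: C_def)
  have C_ge: "4 * C0 \<le> C" using mult_left_mono[OF K4, of "4 * C0"] C0 by (simp add: C_def)
  show ?thesis
  proof (rule that[OF C])
    fix f :: "complex \<Rightarrow> complex" and q B \<eta> :: real and \<mu> :: "complex measure"
    assume f: "f holomorphic_on unit_disc" and [measurable]: "f \<in> borel_measurable borel" and q: "0 < q"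
      and tb: "tent_bounded \<mu> B" and \<eta>: "0 < \<eta>"
    from tb have \<mu>: "sets \<mu> = sets (restrict_space borel unit_disc)" and B: "0 \<le> B"
      and carl: "\<And>\<zeta> \<delta>. cmod \<zeta> = 1 \<Longrightarrow> 0 < \<delta> \<Longrightarrow> emeasure \<mu> (tent \<zeta> \<delta>) \<le> ennreal B * emeasure W (tent \<zeta> \<delta>)"
      unfolding tent_bounded_def by blast+
    define u where "u w = cmod (f w) powr q" for w
    \<comment> \<open>Chosen so that \<open>C0 * (2 * \<tau>)\<close> is \<eta>/2, strictly below
      \<eta>.\<close>
    define \<tau> where "\<tau> = \<eta> / (4 * C0)"
    have \<tau>: "0 < \<tau>" using \<eta> C0 by (simp add: \<tau>_def)
    define v where "v w = ennreal (u w) * indicator {w. \<tau> < u w} w" for w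
    have [measurable]: "u \<in> borel_measurable borel" "v \<in> borel_measurable borel"
      unfolding v_def u_def by measurable
    define \<nu> where "\<nu> = density W v"
    have \<nu>: "emeasure \<nu> A = (\<integral>\<^sup>+w\<in>A. v w \<partial>W)" if "A \<in> sets W" for A
      unfolding \<nu>_def using that by (intro emeasure_density measurable_W) measurable
    \<comment> \<open>The tents are indexed by plane discs centred on the unit circle; the bound 4
      supplies the bounded radii that Vitali's lemma requires.\<close>
    define J where "J = {(\<zeta>, \<delta>). cmod \<zeta> = 1 \<and> 0 < \<delta> \<and> \<delta> \<le> 4 \<and> ennreal \<tau> * emeasure W (tent \<zeta> \<delta>) \<le> emeasure \<nu> (tent \<zeta> \<delta>)}"
    have rad: "\<And>i. i \<in> J \<Longrightarrow> 0 < snd i \<and> snd i \<le> 4" by (auto simp: J_def)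
    have "\<exists>I. countable I \<and> I \<subseteq> J \<and> pairwise (\<lambda>i j. disjnt (cball (fst i) (snd i)) (cball (fst j) (snd j))) I
      \<and> (\<forall>i\<in>J. \<exists>j. j \<in> I \<and> cball (fst i) (snd i) \<subseteq> ball (fst j) (5 * snd j))"
    proof (rule Vitali_covering_lemma_cballs_balls[of J snd 4 fst])
      show "0 < snd i \<and> snd i \<le> 4" if "i \<in> J" for i using that by (rule rad)
    next
      fix I assume a: "countable I" "I \<subseteq> J" "pairwise (\<lambda>i j. disjnt (cball (fst i) (snd i)) (cball (fst j) (snd j))) I"
        "\<And>i. i \<in> J \<Longrightarrow> \<exists>j. j \<in> I \<and> \<not> disjnt (cball (fst i) (snd i)) (cball (fst j) (snd j)) \<and>
          cball (fst i) (snd i) \<subseteq> ball (fst j) (5 * snd j)"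
      then have "\<forall>i\<in>J. \<exists>j. j \<in> I \<and> cball (fst i) (snd i) \<subseteq> ball (fst j) (5 * snd j)" by blast
      with a(1-3) show ?thesis by blast
    qed
    then obtain I where I: "countable I" "I \<subseteq> J"
      and disj: "pairwise (\<lambda>i j. disjnt (cball (fst i) (snd i)) (cball (fst j) (snd j))) I"
      and cov: "\<And>i. i \<in> J \<Longrightarrow> \<exists>j. j \<in> I \<and> cball (fst i) (snd i) \<subseteq> ball (fst j) (5 * snd j)"
      by blast
    have "{z \<in> unit_disc. \<eta> < u z} \<subseteq> (\<Union>j\<in>I. tent (fst j) (16 * snd j))"
    proof
      fix z assume "z \<in> {z \<in> unit_disc. \<eta> < u z}"
      then have z: "z \<in> unit_disc" "\<eta> < u z" by auto
      have "\<exists>\<delta>. 1 - cmod z \<le> \<delta> \<and> \<delta> \<le> 4 \<and> ennreal \<tau> * emeasure W (tent (vertex z) \<delta>) \<le> emeasure \<nu> (tent (vertex z) \<delta>)"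
      proof (rule ccontr)
        assume no: "\<not> ?thesis"
        have "cmod (f z) powr q \<le> C0 * (2 * \<tau>)"
        proof (rule mb[OF f _ q z(1)])
          fix \<delta> assume "1 - cmod z \<le> \<delta>" "\<delta> \<le> 4"
          let ?T = "tent (vertex z) \<delta>"
          have le: "(\<integral>\<^sup>+w\<in>?T. v w \<partial>W) \<le> ennreal \<tau> * emeasure W ?T"
            using no \<open>1 - cmod z \<le> \<delta>\<close> \<open>\<delta> \<le> 4\<close> linear unfolding \<nu>[OF tent_sets_W] by blast
          have "(\<integral>\<^sup>+w\<in>?T. ennreal (cmod (f w) powr q) \<partial>W) \<le> (\<integral>\<^sup>+w. v w * indicator ?T w + ennreal \<tau> * indicator ?T w \<partial>W)"
            by (intro nn_integral_mono) (auto simp: v_def u_def indicator_def not_less intro!: ennreal_leI)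
          also have "\<dots> = (\<integral>\<^sup>+w\<in>?T. v w \<partial>W) + (\<integral>\<^sup>+w. ennreal \<tau> * indicator ?T w \<partial>W)"
            by (intro nn_integral_add measurable_W) measurable
          also have "(\<integral>\<^sup>+w. ennreal \<tau> * indicator ?T w \<partial>W) = ennreal \<tau> * emeasure W ?T"
            by (rule nn_integral_cmult_indicator) (rule tent_sets_W)
          also have "(\<integral>\<^sup>+w\<in>?T. v w \<partial>W) + ennreal \<tau> * emeasure W ?T \<le> ennreal \<tau> * emeasure W ?T + ennreal \<tau> * emeasure W ?T"
            by (intro add_right_mono le)
          also have "\<dots> = ennreal (2 * \<tau>) * emeasure W ?T"
          proof -
            have "ennreal (2 * \<tau>) = ennreal \<tau> + ennreal \<tau>" using \<tau> by (simp add: ennreal_plus[symmetric] del: ennreal_plus)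
            then show ?thesis by (simp only: distrib_right)
          qed
          finally show "(\<integral>\<^sup>+w\<in>?T. ennreal (cmod (f w) powr q) \<partial>W) \<le> ennreal (2 * \<tau>) * emeasure W ?T" .
        qed (use \<tau> in auto)
        then show False using z(2) C0 \<eta> by (simp add: u_def \<tau>_def field_simps)
      qed
      then obtain \<delta> where \<delta>: "1 - cmod z \<le> \<delta>" "\<delta> \<le> 4"
        "ennreal \<tau> * emeasure W (tent (vertex z) \<delta>) \<le> emeasure \<nu> (tent (vertex z) \<delta>)" by blast
      have "0 < \<delta>" using \<delta>(1) z(1) by simp
      then have "(vertex z, \<delta>) \<in> J" using \<delta> by (simp add: J_def)
      from cov[OF this] obtain j where j: "j \<in> I" "cball (vertex z) \<delta> \<subseteq> ball (fst j) (5 * snd j)" by auto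
      have "z \<in> tent (vertex z) (2 * \<delta>)" using z \<delta> by (intro tent_vertex)
      then have "z \<in> tent (fst j) (16 * snd j)" using tent_cover_subset[OF j(2) \<open>0 < \<delta>\<close>] by blast
      then show "z \<in> (\<Union>j\<in>I. tent (fst j) (16 * snd j))" using j(1) by blast
    qed
    then have "emeasure \<mu> {z \<in> unit_disc. \<eta> < u z} \<le> emeasure \<mu> (\<Union>j\<in>I. tent (fst j) (16 * snd j))"
      using I(1) by (intro emeasure_mono sets.countable_UN') (auto simp: tent_in_sets[OF \<mu>])
    also have "\<dots> \<le> ennreal (B * K ^ 4 / \<tau>) * emeasure \<nu> (space \<nu>)"
    proof (rule countable_index_sum[where Y = "\<lambda>j. tent (fst j) (snd j)", OF I(1)])
      show "disjoint_family_on (\<lambda>j. tent (fst j) (snd j)) I"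
        unfolding disjoint_family_on_def
      proof (intro ballI impI)
        fix i j assume ij: "i \<in> I" "j \<in> I" "i \<noteq> j"
        then have "disjnt (cball (fst i) (snd i)) (cball (fst j) (snd j))"
          using disj by (auto simp: pairwise_def)
        \<comment> \<open>A common point w of the tents would put \<open>sgn w\<close> into both
          discs.\<close>
        then show "tent (fst i) (snd i) \<inter> tent (fst j) (snd j) = {}"
          by (auto simp: disjnt_iff tent_def dist_norm norm_minus_commute) (metis less_imp_le)
      qed
      fix j assume "j \<in> I"
      then have j: "cmod (fst j) = 1" "0 < snd j"
        "ennreal \<tau> * emeasure W (tent (fst j) (snd j)) \<le> emeasure \<nu> (tent (fst j) (snd j))"
        using I(2) by (auto simp: J_def)
      have "emeasure \<mu> (tent (fst j) (16 * snd j)) \<le> ennreal B * emeasure W (tent (fst j) (2 ^ 4 * snd j))"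
        using carl[of "fst j" "16 * snd j"] j by simp
      also have "\<dots> \<le> ennreal B * (ennreal (K ^ 4) * emeasure W (tent (fst j) (snd j)))"
        by (intro mult_left_mono tent_doubling_power j) simp
      also have "\<dots> = ennreal (B * K ^ 4 / \<tau>) * (ennreal \<tau> * emeasure W (tent (fst j) (snd j)))"
      proof -
        have "ennreal (B * K ^ 4 / \<tau>) * ennreal \<tau> = ennreal (B * K ^ 4)"
          using B K4 \<tau> by (subst ennreal_mult[symmetric]) auto
        also have "\<dots> = ennreal B * ennreal (K ^ 4)" using B K4 by (intro ennreal_mult) auto
        finally show ?thesis by (simp only: mult.assoc[symmetric])
      qed
      also have "\<dots> \<le> ennreal (B * K ^ 4 / \<tau>) * emeasure \<nu> (tent (fst j) (snd j))"
        by (intro mult_left_mono j) simp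
      finally show "emeasure \<mu> (tent (fst j) (16 * snd j)) \<le> ennreal (B * K ^ 4 / \<tau>) * emeasure \<nu> (tent (fst j) (snd j))" .
    qed (auto simp: \<nu>_def tent_in_sets[OF \<mu>])
    also have "emeasure \<nu> (space \<nu>) = (\<integral>\<^sup>+w. v w \<partial>W)"
    proof -
      have "emeasure \<nu> (space W) = (\<integral>\<^sup>+w\<in>space W. v w \<partial>W)" by (rule \<nu>) simp
      also have "\<dots> = (\<integral>\<^sup>+w. v w \<partial>W)" by (intro nn_integral_cong) simp
      finally show ?thesis by (simp add: \<nu>_def)
    qed
    also have "\<dots> \<le> (\<integral>\<^sup>+w. ennreal (u w) * indicator {w. \<eta> < C * u w} w \<partial>W)"
    proof (rule nn_integral_mono)
      fix w
      have "\<eta> < C * u w" if "\<tau> < u w"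
      proof -
        have "\<eta> < 4 * C0 * u w" using that C0 by (simp add: \<tau>_def field_simps)
        also have "\<dots> \<le> C * u w" using C_ge by (intro mult_right_mono) (auto simp: u_def)
        finally show ?thesis .
      qed
      then show "v w \<le> ennreal (u w) * indicator {w. \<eta> < C * u w} w"
        by (auto simp: v_def indicator_def)
    qed
    also have "B * K ^ 4 / \<tau> = C * B / \<eta>" using C0 \<eta> by (simp add: \<tau>_def C_def)
    finally show "emeasure \<mu> {z \<in> unit_disc. \<eta> < cmod (f z) powr q} \<le> ennreal (C * B / \<eta>) *
        (\<integral>\<^sup>+w. ennreal (cmod (f w) powr q) * indicator {w. \<eta> < C * cmod (f w) powr q} w \<partial>W)"
      by (simp add: u_def mult_left_mono)
  qed
qed

end

lemma ennreal_mult_mult: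
  "0 \<le> a \<Longrightarrow> 0 \<le> b \<Longrightarrow> 0 \<le> c \<Longrightarrow> ennreal a * (ennreal b * ennreal c) = ennreal (a * (b * c))"
  by (simp add: ennreal_mult)

section \<open>From the weak-type bound to the embedding\<close>

context doubling_radial
begin

text \<open>The square of u is written as an integral over levels s with density s, which cancels
  the 1/s of the weak-type bound; after Fubini the levels left at w satisfy s < C0 u(w), giving a
  second factor u(w). Finiteness of \<mu> is what allows Fubini. The square with general q is meant
  for q = p/2.\<close>

theorem carleson_embedding:
  obtains C :: real where "0 < C"
    and "\<And>f q \<mu> B. \<lbrakk>f holomorphic_on unit_disc; f \<in> borel_measurable borel; 0 < q;
      tent_bounded \<mu> B; emeasure \<mu> unit_disc < \<infinity>\<rbrakk>
      \<Longrightarrow> (\<integral>\<^sup>+z. ennreal ((cmod (f z) powr q)\<^sup>2) \<partial>\<mu>) \<le> ennreal (C * B) * (\<integral>\<^sup>+w. ennreal ((cmod (f w) powr q)\<^sup>2) \<partial>W)"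
proof -
  obtain C0 :: real where C0: "0 < C0"
    and wt: "\<And>f q \<mu> B \<eta>. \<lbrakk>f holomorphic_on unit_disc; f \<in> borel_measurable borel; 0 < q;
      tent_bounded \<mu> B; 0 < \<eta>\<rbrakk>
      \<Longrightarrow> emeasure \<mu> {z \<in> unit_disc. \<eta> < cmod (f z) powr q} \<le> ennreal (C0 * B / \<eta>) *
        (\<integral>\<^sup>+w. ennreal (cmod (f w) powr q) * indicator {w. \<eta> < C0 * cmod (f w) powr q} w \<partial>W)"
    using weak_type by blast
  define C where "C = 4 * C0 * C0"
  have C: "0 < C" using C0 by (simp add: C_def)
  show ?thesis
  proof (rule that[OF C])
    fix f :: "complex \<Rightarrow> complex" and q B :: real and \<mu> :: "complex measure"
    assume f: "f holomorphic_on unit_disc" and fm [measurable]: "f \<in> borel_measurable borel" and q: "0 < q"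
      and tb: "tent_bounded \<mu> B" and fin: "emeasure \<mu> unit_disc < \<infinity>"
    from tb have \<mu>: "sets \<mu> = sets (restrict_space borel unit_disc)" and B: "0 \<le> B"
      unfolding tent_bounded_def by blast+
    have sp: "space \<mu> = unit_disc" using sets_eq_imp_space_eq[OF \<mu>] by (simp add: space_restrict_space)
    define u where "u w = cmod (f w) powr q" for w
    have u0: "0 \<le> u w" for w by (simp add: u_def)
    have um: "u \<in> borel_measurable borel" unfolding u_def by measurable
    have um_\<mu> [measurable]: "u \<in> borel_measurable \<mu>"
      using measurable_restrict_space1[OF um, of unit_disc] measurable_cong_sets[OF \<mu> refl] by blast
    have um_W [measurable]: "u \<in> borel_measurable W" by (rule measurable_W[OF um])
    interpret \<mu>: finite_measure \<mu> by standard (use fin sp in auto)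
    interpret W: finite_measure W by standard (use finite_W space_W in auto)
    interpret P: pair_sigma_finite lborel \<mu> ..
    interpret Q: pair_sigma_finite lborel W ..
    let ?U = "\<integral>\<^sup>+w. ennreal ((u w)\<^sup>2) \<partial>W"
    let ?D = "\<lambda>s z. ennreal s * indicator {0<..} s * indicator {z \<in> unit_disc. s < u z} z"
    let ?E = "\<lambda>s z. ennreal s * indicator {0<..} s * indicator {z \<in> space \<mu>. s < u z} z"
    let ?F = "\<lambda>s w. indicator {0<..} s * (ennreal (u w) * indicator {w \<in> space W. s < C0 * u w} w)"
    \<comment> \<open>The levels between u/2 and u suffice: there s >= u/2 on an interval of length
      u/2, whence the 4.\<close>
    have lower: "ennreal ((u z)\<^sup>2)
      \<le> ennreal 4 * (\<integral>\<^sup>+s. ?D s z \<partial>lborel)"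
      if "z \<in> unit_disc" for z
    proof (cases "0 < u z")
      case uz: True
      have "ennreal ((u z)\<^sup>2) = ennreal 4 * (ennreal (u z / 2) * ennreal (u z / 2))"
        using uz by (subst ennreal_mult_mult) (auto simp: power2_eq_square)
      also have "ennreal (u z / 2) * ennreal (u z / 2) = (\<integral>\<^sup>+s. ennreal (u z / 2) * indicator {u z / 2<..<u z} s \<partial>lborel)"
        using uz by (subst nn_integral_cmult_indicator) auto
      also have "\<dots> \<le> (\<integral>\<^sup>+s. ?D s z \<partial>lborel)"
        using uz that by (intro nn_integral_mono) (auto simp: indicator_def intro!: ennreal_leI)
      finally show ?thesis by (simp add: mult_left_mono)
    next
      case False
      then show ?thesis using u0[of z] by simp
    qed
    have "(\<integral>\<^sup>+z. ennreal ((u z)\<^sup>2) \<partial>\<mu>)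
      \<le> (\<integral>\<^sup>+z. ennreal 4 * (\<integral>\<^sup>+s. ?D s z \<partial>lborel) \<partial>\<mu>)"
      by (intro nn_integral_mono lower) (simp add: sp)
    also have "\<dots> = ennreal 4 * (\<integral>\<^sup>+z. \<integral>\<^sup>+s. ?E s z \<partial>lborel \<partial>\<mu>)"
      unfolding sp[symmetric] by (rule nn_integral_cmult) measurable
    also have "(\<integral>\<^sup>+z. \<integral>\<^sup>+s. ?E s z \<partial>lborel \<partial>\<mu>)
      = (\<integral>\<^sup>+s. \<integral>\<^sup>+z. ?E s z \<partial>\<mu> \<partial>lborel)"
      by (rule P.Fubini') measurable
    also have "\<dots> \<le> (\<integral>\<^sup>+s. \<integral>\<^sup>+w. ennreal (C0 * B) * (?F s w) \<partial>W \<partial>lborel)"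
    proof (rule nn_integral_mono)
      fix s :: real
      show "(\<integral>\<^sup>+z. ?E s z \<partial>\<mu>)
        \<le> (\<integral>\<^sup>+w. ennreal (C0 * B) * (?F s w) \<partial>W)"
      proof (cases "0 < s")
        case s: True
        have "(\<integral>\<^sup>+z. ?E s z \<partial>\<mu>)
          = ennreal s * emeasure \<mu> {z \<in> space \<mu>. s < u z}"
          using s by (subst nn_integral_cmult_indicator[symmetric]) (auto intro!: nn_integral_cong)
        also have "\<dots> \<le> ennreal s * (ennreal (C0 * B / s) * (\<integral>\<^sup>+w. ennreal (u w) * indicator {w. s < C0 * u w} w \<partial>W))"
          unfolding sp u_def by (intro mult_left_mono wt f fm q tb s) auto
        also have "\<dots> = ennreal (C0 * B) * (\<integral>\<^sup>+w. ennreal (u w) * indicator {w. s < C0 * u w} w \<partial>W)"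
          using s C0 B by (simp add: mult.assoc[symmetric] ennreal_mult[symmetric])
        also have "(\<integral>\<^sup>+w. ennreal (u w) * indicator {w. s < C0 * u w} w \<partial>W)
          = (\<integral>\<^sup>+w. ?F s w \<partial>W)"
          using s by (intro nn_integral_cong) (auto simp: indicator_def)
        also have "ennreal (C0 * B) * \<dots> = (\<integral>\<^sup>+w. ennreal (C0 * B) * (?F s w) \<partial>W)"
          by (rule nn_integral_cmult[symmetric]) measurable
        finally show ?thesis .
      qed simp
    qed
    also have "\<dots> = (\<integral>\<^sup>+w. \<integral>\<^sup>+s. ennreal (C0 * B) * (?F s w) \<partial>lborel \<partial>W)"
      by (rule Q.Fubini'[symmetric]) measurable
    \<comment> \<open>The integration over s runs only up to \<open>C0 * u w\<close>; this is where
      the truncation in \<open>weak_type\<close> pays off.\<close>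
    also have "\<dots> \<le> (\<integral>\<^sup>+w. ennreal (C0 * B * C0) * ennreal ((u w)\<^sup>2) \<partial>W)"
    proof (rule nn_integral_mono)
      fix w
      show "(\<integral>\<^sup>+s. ennreal (C0 * B) * (?F s w) \<partial>lborel)
        \<le> ennreal (C0 * B * C0) * ennreal ((u w)\<^sup>2)"
      proof -
        have "(\<integral>\<^sup>+s. ennreal (C0 * B) * (?F s w) \<partial>lborel)
          \<le> (\<integral>\<^sup>+s. ennreal (C0 * B * u w) * indicator {0..C0 * u w} s \<partial>lborel)"
          using C0 B u0[of w] by (intro nn_integral_mono) (auto simp: indicator_def ennreal_mult)
        also have "\<dots> = ennreal (C0 * B * u w) * ennreal (C0 * u w)"
          using C0 u0[of w] by (subst nn_integral_cmult_indicator) auto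
        also have "\<dots> = ennreal (C0 * B * C0 * (u w)\<^sup>2)"
          using C0 B u0[of w] by (subst ennreal_mult[symmetric]) (auto simp: power2_eq_square mult_ac)
        also have "\<dots> = ennreal (C0 * B * C0) * ennreal ((u w)\<^sup>2)"
          using C0 B by (intro ennreal_mult) auto
        finally show ?thesis .
      qed
    qed
    also have "\<dots> = ennreal (C0 * B * C0) * ?U"
      by (intro nn_integral_cmult measurable_W) (use um in measurable)
    finally have "(\<integral>\<^sup>+z. ennreal ((u z)\<^sup>2) \<partial>\<mu>)
      \<le> ennreal 4 * (ennreal (C0 * B * C0) * ?U)"
      by (simp add: mult_left_mono)
    also have "\<dots> = ennreal (4 * C0 * C0 * B) * ?U"
    proof -
      have "ennreal (4 * (C0 * B * C0)) = ennreal 4 * ennreal (C0 * B * C0)"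
        using C0 B by (intro ennreal_mult) auto
      moreover have "4 * (C0 * B * C0) = 4 * C0 * C0 * B" by simp
      ultimately have "ennreal (4 * C0 * C0 * B) = ennreal 4 * ennreal (C0 * B * C0)" by (simp only:)
      then show ?thesis by (simp only: mult.assoc)
    qed
    also have "\<dots> \<le> ennreal (C * B) * ?U"
      by (simp add: C_def)
    finally show "(\<integral>\<^sup>+z. ennreal ((cmod (f z) powr q)\<^sup>2) \<partial>\<mu>) \<le> ennreal (C * B) * (\<integral>\<^sup>+w. ennreal ((cmod (f w) powr q)\<^sup>2) \<partial>W)"
      by (simp add: u_def)
  qed
qed

end

section \<open>Vague compactness on the disc\<close>

text \<open>A 1-periodic continuous function that is 0 on [0, 1/6] and 1 on [1/2, 2/3]. The phase
  \<pi>/6 centres these intervals on the plateaus of the clipped cosine.\<close>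

definition fold_wave :: "real \<Rightarrow> real" where
  "fold_wave t = max 0 (min 1 (1 / 2 - cos (2 * pi * t - pi / 6)))"

text \<open>Base 4 with the digits 0 and 2 only. Past the first digit at most 1/6 remains, so the
  number lies on a plateau of \<open>fold_wave\<close>, which therefore reads that digit.\<close>

definition sparse_expansion :: "(nat \<Rightarrow> real) \<Rightarrow> real" where
  "sparse_expansion a = (\<Sum>k. 2 * a k / 4 ^ Suc k)"

lemma fold_wave_bounds: "0 \<le> fold_wave t" "fold_wave t \<le> 1"
  by (auto simp: fold_wave_def)

lemma continuous_fold_wave [continuous_intros]:
  fixes g :: "real \<Rightarrow> real"
  assumes "continuous_on S g"
  shows "continuous_on S (\<lambda>x. fold_wave (g x))"
  unfolding fold_wave_def by (intro continuous_intros assms)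

lemma fold_wave_add_int: "fold_wave (t + of_int n) = fold_wave t"
proof -
  have "cos (2 * pi * (t + of_int n) - pi / 6) = cos ((2 * pi * t - pi / 6) + 2 * pi * of_int n)"
    by (simp add: algebra_simps)
  also have "\<dots> = cos (2 * pi * t - pi / 6)"
    by (simp add: cos_add)
  finally show ?thesis by (simp add: fold_wave_def)
qed

lemma fold_wave_plateau:
  assumes "0 \<le> t" "t \<le> 1 / 6"
  shows "fold_wave t = 0" "fold_wave (1 / 2 + t) = 1"
proof -
  have "cos (pi / 3) \<le> cos \<bar>2 * pi * t - pi / 6\<bar>"
  proof (rule cos_monotone_0_pi_le)
    have "2 * pi * t \<le> 2 * pi * (1 / 6)" using assms by (intro mult_left_mono) auto
    moreover have "0 \<le> 2 * pi * t" using assms by simp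
    ultimately show "\<bar>2 * pi * t - pi / 6\<bar> \<le> pi / 3" using pi_gt_zero by linarith
  qed auto
  then have c: "1 / 2 \<le> cos (2 * pi * t - pi / 6)" by (simp add: cos_60)
  then show "fold_wave t = 0" by (simp add: fold_wave_def)
  have "2 * pi * (1 / 2 + t) - pi / 6 = (2 * pi * t - pi / 6) + pi" by (simp add: algebra_simps)
  then have "cos (2 * pi * (1 / 2 + t) - pi / 6) = - cos (2 * pi * t - pi / 6)" by (simp only: cos_periodic_pi)
  with c show "fold_wave (1 / 2 + t) = 1" by (simp add: fold_wave_def)
qed

lemma summable_sparse:
  assumes "\<And>k. a k \<in> {0, 1::real}"
  shows "summable (\<lambda>k. 2 * a k / 4 ^ Suc k)"
proof (rule summable_comparison_test')
  show "summable (\<lambda>k. (1 / 4 :: real) ^ k)" by (rule summable_geometric) simp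
  fix k :: nat
  show "norm (2 * a k / 4 ^ Suc k) \<le> (1 / 4) ^ k"
    using assms[of k] by (auto simp: power_divide field_simps)
qed

lemma sparse_expansion_tail:
  assumes "\<And>k. a k \<in> {0, 1::real}"
  shows "0 \<le> sparse_expansion a" "sparse_expansion a \<le> 2 / 3"
proof -
  have nn: "0 \<le> a k" "a k \<le> 1" for k using assms[of k] by auto
  show "0 \<le> sparse_expansion a"
    unfolding sparse_expansion_def using nn by (intro suminf_nonneg summable_sparse assms) auto
  have "(\<lambda>k. (1 / 2) * (1 / 4 :: real) ^ k) sums ((1 / 2) * (1 / (1 - 1 / 4)))"
    by (intro sums_mult geometric_sums) simp
  then have s: "(\<lambda>k. 2 * 1 / 4 ^ Suc k) sums (2 / 3 :: real)"
    by (simp add: power_divide)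
  have "sparse_expansion a \<le> (\<Sum>k. 2 * 1 / 4 ^ Suc k)"
    unfolding sparse_expansion_def using nn
    by (intro suminf_le summable_sparse assms sums_summable[OF s]) (auto intro!: divide_right_mono)
  also have "\<dots> = 2 / 3" using s by (rule sums_unique[symmetric])
  finally show "sparse_expansion a \<le> 2 / 3" .
qed

lemma sparse_expansion_split:
  assumes "\<And>k. a k \<in> {0, 1::real}"
  shows "sparse_expansion a = a 0 / 2 + sparse_expansion (\<lambda>k. a (Suc k)) / 4"
proof -
  have "sparse_expansion a = (\<Sum>k. 2 * a (Suc k) / 4 ^ Suc (Suc k)) + 2 * a 0 / 4 ^ Suc 0"
    unfolding sparse_expansion_def using suminf_split_head[OF summable_sparse[of a, OF assms]] by simp
  also have "(\<Sum>k. 2 * a (Suc k) / 4 ^ Suc (Suc k)) = (\<Sum>k. (2 * a (Suc k) / 4 ^ Suc k) / 4)"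
    by (simp add: field_simps)
  also have "\<dots> = sparse_expansion (\<lambda>k. a (Suc k)) / 4"
    unfolding sparse_expansion_def by (rule suminf_divide) (rule summable_sparse[of "\<lambda>k. a (Suc k)", OF assms])
  finally show ?thesis by simp
qed

lemma fold_wave_sparse:
  assumes "\<And>k. a k \<in> {0, 1::real}"
  shows "fold_wave (4 ^ j * sparse_expansion a) = a j"
  using assms
proof (induction j arbitrary: a)
  case 0
  let ?t = "sparse_expansion (\<lambda>k. a (Suc k)) / 4"
  have "0 \<le> ?t" "?t \<le> 1 / 6"
    using sparse_expansion_tail[of "\<lambda>k. a (Suc k)", OF 0] by auto
  then show ?case
    using 0[of 0] fold_wave_plateau[of ?t] by (auto simp: sparse_expansion_split[of a, OF 0])
next
  case (Suc j)
  \<comment> \<open>Multiplication by a power of 4 turns the leading digit into an integer, which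
    periodicity discards; the induction hypothesis applies to the shifted digits.\<close>
  obtain n :: int where n: "4 ^ Suc j * (a 0 / 2) = of_int n"
  proof (cases "a 0 = 0")
    case True
    then show ?thesis using that[of 0] by simp
  next
    case False
    then have "a 0 = 1" using Suc.prems[of 0] by auto
    then show ?thesis using that[of "2 * 4 ^ j"] by simp
  qed
  have "4 ^ Suc j * sparse_expansion a = 4 ^ j * sparse_expansion (\<lambda>k. a (Suc k)) + of_int n"
    using n by (subst sparse_expansion_split[OF Suc.prems]) (simp add: field_simps)
  then show ?case
    using Suc.IH[of "\<lambda>k. a (Suc k)"] Suc.prems by (simp only: fold_wave_add_int)
qed

section \<open>Binary digits and the coordinates of the curve\<close>

definition bin_digit :: "nat \<Rightarrow> real \<Rightarrow> real" where
  "bin_digit k x = of_int \<lfloor>2 ^ Suc k * x\<rfloor> - 2 * of_int \<lfloor>2 ^ k * x\<rfloor>"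

lemma bin_digit_in: "bin_digit k x \<in> {0, 1}"
proof -
  have "\<lfloor>2 * y\<rfloor> = 2 * \<lfloor>y\<rfloor> \<or> \<lfloor>2 * y\<rfloor> = 2 * \<lfloor>y\<rfloor> + 1" for y :: real by linarith
  from this[of "2 ^ k * x"] show ?thesis by (auto simp: bin_digit_def mult.assoc)
qed

lemma bin_digit_measurable [measurable]: "bin_digit k \<in> borel_measurable borel"
  unfolding bin_digit_def[abs_def] by measurable

lemma bin_digit_sums:
  assumes "0 \<le> x" "x < 1"
  shows "(\<lambda>k. bin_digit k x / 2 ^ Suc k) sums x"
proof -
  have part: "(\<Sum>k<n. bin_digit k x / 2 ^ Suc k) = of_int \<lfloor>2 ^ n * x\<rfloor> / 2 ^ n" for n
  proof (induction n)
    case 0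
    have "\<lfloor>x\<rfloor> = 0" using assms by (simp add: floor_eq_iff)
    then show ?case by simp
  next
    case (Suc n)
    then show ?case by (simp add: bin_digit_def field_simps)
  qed
  have "(\<lambda>n. of_int \<lfloor>2 ^ n * x\<rfloor> / 2 ^ n) \<longlonglongrightarrow> x"
  proof (rule tendsto_sandwich)
    show "(\<lambda>n. x - (1 / 2) ^ n) \<longlonglongrightarrow> x"
      using tendsto_diff[OF tendsto_const[of x] LIMSEQ_power_zero[of "1/2 :: real"]] by simp
    show "(\<lambda>n. x) \<longlonglongrightarrow> x" by simp
    show "\<forall>\<^sub>F n in sequentially. of_int \<lfloor>2 ^ n * x\<rfloor> / 2 ^ n \<le> x"
      by (intro always_eventually allI) (simp add: field_simps)
    show "\<forall>\<^sub>F n in sequentially. x - (1 / 2) ^ n \<le> of_int \<lfloor>2 ^ n * x\<rfloor> / 2 ^ n"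
    proof (intro always_eventually allI)
      fix n :: nat
      have "2 ^ n * x - 1 \<le> of_int \<lfloor>2 ^ n * x\<rfloor>" by linarith
      then have "(2 ^ n * x - 1) / 2 ^ n \<le> of_int \<lfloor>2 ^ n * x\<rfloor> / 2 ^ n" by (rule divide_right_mono) simp
      then show "x - (1 / 2) ^ n \<le> of_int \<lfloor>2 ^ n * x\<rfloor> / 2 ^ n" by (simp add: diff_divide_distrib power_divide)
    qed
  qed
  then show ?thesis unfolding sums_def part .
qed

text \<open>Coordinate i of the curve reads the digits at positions of parity i as a binary number.
  It is defined and continuous for all real t, not only for codes.\<close>

definition decode :: "nat \<Rightarrow> real \<Rightarrow> real" where
  "decode i t = (\<Sum>k. fold_wave (4 ^ (2 * k + i) * t) / 2 ^ Suc k)"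

lemma continuous_decode: "continuous_on UNIV (decode i)"
proof -
  have "uniform_limit UNIV (\<lambda>n t. \<Sum>k<n. fold_wave (4 ^ (2 * k + i) * t) / 2 ^ Suc k)
    (\<lambda>t. \<Sum>k. fold_wave (4 ^ (2 * k + i) * t) / 2 ^ Suc k) sequentially"
  proof (rule Weierstrass_m_test)
    show "summable (\<lambda>k. (1 / 2 :: real) ^ k)" by (rule summable_geometric) simp
    fix k :: nat and t :: real
    have "fold_wave (4 ^ (2 * k + i) * t) / 2 ^ Suc k \<le> 1 / 2 ^ k"
      using fold_wave_bounds[of "4 ^ (2 * k + i) * t"] by (simp add: field_simps)
    then show "norm (fold_wave (4 ^ (2 * k + i) * t) / 2 ^ Suc k) \<le> (1 / 2) ^ k"
      using fold_wave_bounds[of "4 ^ (2 * k + i) * t"] by (simp add: power_divide)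
  qed
  then show ?thesis
    unfolding decode_def[abs_def]
    by (rule uniform_limit_theorem[rotated]) (auto intro!: always_eventually continuous_intros)
qed

text \<open>Interleaving the digits of both coordinates gives a right inverse that is Borel but not
  continuous, as binary digits jump. That is enough: it serves only to push measures to the
  line.\<close>

definition encode :: "real \<Rightarrow> real \<Rightarrow> real" where
  "encode x y = sparse_expansion (\<lambda>k. bin_digit (k div 2) (if even k then x else y))"

lemma decode_encode:
  assumes "0 \<le> x" "x < 1" "0 \<le> y" "y < 1"
  shows "decode 0 (encode x y) = x" "decode 1 (encode x y) = y"
proof -
  have *: "fold_wave (4 ^ j * encode x y) = bin_digit (j div 2) (if even j then x else y)" for j
    unfolding encode_def by (rule fold_wave_sparse) (rule bin_digit_in)
  show "decode 0 (encode x y) = x" "decode 1 (encode x y) = y"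
    unfolding decode_def * using bin_digit_sums[of x] bin_digit_sums[of y] assms by (auto simp: sums_iff)
qed

lemma encode_bounds: "0 \<le> encode x y" "encode x y \<le> 2 / 3"
  unfolding encode_def by (rule sparse_expansion_tail; rule bin_digit_in)+

lemma encode_measurable [measurable]:
  assumes [measurable]: "f \<in> borel_measurable M" "g \<in> borel_measurable M"
  shows "(\<lambda>z. encode (f z) (g z)) \<in> borel_measurable M"
  unfolding encode_def sparse_expansion_def by measurable

text \<open>A Schoenberg-type space-filling curve: together with its Borel right inverse it
  reduces vague compactness on the disc to Helly's theorem on the line.\<close>

lemma space_filling_curve:
  obtains \<gamma> :: "real \<Rightarrow> complex" and s :: "complex \<Rightarrow> real"
  where "continuous_on UNIV \<gamma>" "s \<in> borel_measurable borel" "\<And>z. 0 \<le> s z" "\<And>z. s z \<le> 1"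
    "\<And>z. z \<in> unit_disc \<Longrightarrow> \<gamma> (s z) = z"
proof
  show "continuous_on UNIV (\<lambda>t. Complex (4 * decode 0 t - 2) (4 * decode 1 t - 2))"
    unfolding Complex_eq by (intro continuous_intros continuous_decode)
  show "(\<lambda>z. encode ((Re z + 2) / 4) ((Im z + 2) / 4)) \<in> borel_measurable borel"
    by measurable
  show "0 \<le> encode ((Re z + 2) / 4) ((Im z + 2) / 4)" for z by (rule encode_bounds)
  show "encode ((Re z + 2) / 4) ((Im z + 2) / 4) \<le> 1" for z
    using encode_bounds(2)[of "(Re z + 2) / 4" "(Im z + 2) / 4"] by linarith
  fix z :: complex assume "z \<in> unit_disc"
  then have "\<bar>Re z\<bar> < 1" "\<bar>Im z\<bar> < 1"
    using abs_Re_le_cmod[of z] abs_Im_le_cmod[of z] by auto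
  \<comment> \<open>The shift and scaling take (-1, 1) to (1/4, 3/4), inside the range where binary
    digits recover the number.\<close>
  then have "0 \<le> (Re z + 2) / 4" "(Re z + 2) / 4 < 1" "0 \<le> (Im z + 2) / 4" "(Im z + 2) / 4 < 1"
    by (auto simp: abs_less_iff)
  from decode_encode[OF this] show "Complex (4 * decode 0 (encode ((Re z + 2) / 4) ((Im z + 2) / 4)) - 2)
      (4 * decode 1 (encode ((Re z + 2) / 4) ((Im z + 2) / 4)) - 2) = z"
    by (simp add: complex_eq_iff)
qed

section \<open>Extraction of weak limits\<close>

lemma disc_test_function_extend:
  assumes "disc_test_function h"
  obtains H B where "continuous_on UNIV H" "\<And>z. z \<in> unit_disc \<Longrightarrow> H z = h z" "\<And>z. z \<notin> unit_disc \<Longrightarrow> H z = 0"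
    "\<And>z. 0 \<le> H z" "\<And>z. H z \<le> B"
proof -
  from assms obtain K where cont: "continuous_on unit_disc h" and nn: "\<forall>z\<in>unit_disc. 0 \<le> h z"
    and K: "compact K" "K \<subseteq> unit_disc" "\<forall>z\<in>unit_disc - K. h z = 0"
    unfolding disc_test_function_def by blast
  define H where "H z = (if z \<in> unit_disc then h z else 0)" for z
  have "continuous_on unit_disc H"
    using cont by (rule continuous_on_eq) (simp add: H_def)
  moreover have "continuous_on (- K) H"
    using K by (intro continuous_on_eq[OF continuous_on_const[of _ 0]]) (auto simp: H_def)
  \<comment> \<open>The disc and the complement of \<open>K\<close> are open, cover the plane, and
    the extension by zero is continuous on each.\<close>
  ultimately have "continuous_on (unit_disc \<union> - K) H"
    using K by (intro continuous_on_open_Un) (auto intro: compact_imp_closed)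
  moreover have "unit_disc \<union> - K = UNIV" using K by auto
  ultimately have H: "continuous_on UNIV H" by simp
  have "bounded (H ` K)"
    by (intro compact_imp_bounded compact_continuous_image continuous_on_subset[OF H] K) auto
  then obtain B where B: "\<And>z. z \<in> K \<Longrightarrow> \<bar>H z\<bar> \<le> B" by (auto simp: bounded_iff)
  have "H z \<le> max B 0" for z
  proof (cases "z \<in> K")
    case True
    then show ?thesis using B[of z] by auto
  next
    case False
    then have "H z = 0" using K by (auto simp: H_def)
    then show ?thesis by simp
  qed
  moreover have "H z = h z" if "z \<in> unit_disc" for z using that by (simp add: H_def)
  moreover have "H z = 0" if "z \<notin> unit_disc" for z using that by (simp add: H_def)
  moreover have "0 \<le> H z" for z using nn by (simp add: H_def)
  ultimately show ?thesis using that[OF H] by blast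
qed

text \<open>With \<open>H\<close> the extension of a test function by zero, H o \<gamma> is bounded
  and continuous on the line and \<gamma> o s is the identity on the disc. So the integral of h over
  a measure equals its mass times the integral of H o \<gamma> over a probability measure on [0, 1];
  both factors converge along a subsequence.\<close>

theorem vague_compactness:
  fixes \<mu>s :: "nat \<Rightarrow> complex measure" and M :: real
  assumes borel: "\<And>n. disc_borel_measure (\<mu>s n)"
    and mass: "\<And>n. emeasure (\<mu>s n) unit_disc \<le> ennreal M"
  obtains r \<mu> where "strict_mono r" "disc_borel_measure \<mu>" "converges_weakly (\<mu>s \<circ> r) \<mu>"
proof -
  have sets: "sets (\<mu>s n) = sets (restrict_space borel unit_disc)" for n
    using borel by (simp add: disc_borel_measure_def)
  have space: "space (\<mu>s n) = unit_disc" for n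
    using sets_eq_imp_space_eq[OF sets[of n]] by (simp add: space_restrict_space)
  have meas: "g \<in> borel_measurable (\<mu>s n)" if "g \<in> borel_measurable borel" for n and g :: "complex \<Rightarrow> real"
    using measurable_restrict_space1[OF that, of unit_disc] measurable_cong_sets[OF sets[of n] refl] by blast
  define m where "m n = measure (\<mu>s n) unit_disc" for n
  have fin: "emeasure (\<mu>s n) unit_disc = ennreal (m n)" for n
    using mass[of n] unfolding m_def by (intro emeasure_eq_ennreal_measure) (auto simp: top_unique)
  have m: "0 \<le> m n" "m n \<le> max M 0" for n
    using mass[of n] unfolding fin by (auto simp: m_def ennreal_le_iff2)
  have "\<forall>n. m n \<in> {0..max M 0}" using m by simp
  then obtain l r1 where r1: "strict_mono r1" "(m \<circ> r1) \<longlonglongrightarrow> l"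
    using seq_compactE[OF compact_imp_seq_compact[OF compact_Icc], of m 0 "max M 0"] by blast
  have int_le: "(\<integral>\<^sup>+z. ennreal (h z) \<partial>\<mu>s n) \<le> ennreal (B * m n)"
    if "\<And>z. z \<in> unit_disc \<Longrightarrow> h z \<le> B" "0 \<le> B" for h B n
  proof -
    have "(\<integral>\<^sup>+z. ennreal (h z) \<partial>\<mu>s n) \<le> (\<integral>\<^sup>+z. ennreal B \<partial>\<mu>s n)"
      using that by (intro nn_integral_mono) (auto simp: space intro!: ennreal_leI)
    also have "\<dots> = ennreal (B * m n)" using that m[of n] by (simp add: space fin ennreal_mult)
    finally show ?thesis .
  qed
  have l: "0 \<le> l" using r1(2) m by (intro LIMSEQ_le_const[OF r1(2)]) auto
  show ?thesis
  proof (cases "l = 0")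
    case True
    \<comment> \<open>Vanishing masses admit no normalisation; the limit is then the zero
      measure.\<close>
    have "converges_weakly (\<mu>s \<circ> r1) (null_measure (restrict_space borel unit_disc))"
      unfolding converges_weakly_def
    proof (intro allI impI)
      fix h assume "disc_test_function h"
      then obtain H B where H: "\<And>z. z \<in> unit_disc \<Longrightarrow> H z = h z" "\<And>z. 0 \<le> H z" "\<And>z::complex. H z \<le> B"
        by (rule disc_test_function_extend) blast
      have "0 \<le> B" using H(2,3)[of 0] by linarith
      have "(\<lambda>n. ennreal (B * (m \<circ> r1) n)) \<longlonglongrightarrow> ennreal (B * 0)"
        by (rule tendsto_ennrealI[OF tendsto_mult[OF tendsto_const]]) (use r1(2) True in \<open>simp add: o_def\<close>)
      then have lim: "(\<lambda>n. ennreal (B * (m \<circ> r1) n)) \<longlonglongrightarrow> 0" by simp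
      have "(\<lambda>n. \<integral>\<^sup>+z. ennreal (h z) \<partial>(\<mu>s \<circ> r1) n) \<longlonglongrightarrow> 0"
      proof (rule tendsto_sandwich[OF _ _ tendsto_const lim])
        show "\<forall>\<^sub>F n in sequentially. (\<integral>\<^sup>+z. ennreal (h z) \<partial>(\<mu>s \<circ> r1) n) \<le> ennreal (B * (m \<circ> r1) n)"
          using H(1,3) \<open>0 \<le> B\<close> unfolding o_def
          by (intro always_eventually allI int_le) (auto simp flip: H(1))
      qed simp
      then show "(\<lambda>n. \<integral>\<^sup>+z. ennreal (h z) \<partial>(\<mu>s \<circ> r1) n) \<longlonglongrightarrow> (\<integral>\<^sup>+z. ennreal (h z) \<partial>null_measure (restrict_space borel unit_disc))"
        by simp
    qed
    then show ?thesis using r1(1) by (intro that[of r1]) (auto simp: disc_borel_measure_def)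
  next
    case False
    then have "0 < l" using l by simp
    then have "\<forall>\<^sub>F n in sequentially. 0 < (m \<circ> r1) n"
      using r1(2) by (intro order_tendstoD(1))
    then obtain k where k: "\<And>n. k \<le> n \<Longrightarrow> 0 < m (r1 n)" by (auto simp: eventually_sequentially)
    \<comment> \<open>The shift by \<open>k\<close> makes every mass positive, as the division by it
      requires.\<close>
    define r2 where "r2 n = r1 (n + k)" for n
    have r2: "strict_mono r2" using r1(1) by (auto simp: r2_def strict_mono_def)
    have m2: "(\<lambda>n. m (r2 n)) \<longlonglongrightarrow> l" using LIMSEQ_ignore_initial_segment[OF r1(2), of k] by (simp add: r2_def)
    have m2pos: "0 < m (r2 n)" for n using k by (simp add: r2_def)
    obtain \<gamma> :: "real \<Rightarrow> complex" and s :: "complex \<Rightarrow> real"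
      where \<gamma>: "continuous_on UNIV \<gamma>" and s: "s \<in> borel_measurable borel" "\<And>z. 0 \<le> s z" "\<And>z. s z \<le> 1"
        and \<gamma>s: "\<And>z. z \<in> unit_disc \<Longrightarrow> \<gamma> (s z) = z"
      using space_filling_curve by blast
    define N where "N n = scale_measure (ennreal (1 / m (r2 n))) (\<mu>s (r2 n))" for n
    have N_sets: "sets (N n) = sets (\<mu>s (r2 n))" and N_space: "space (N n) = unit_disc" for n
      unfolding N_def by (simp_all add: space_scale_measure space)
    have N_meas: "g \<in> borel_measurable (N n)" if "g \<in> borel_measurable borel" for n and g :: "complex \<Rightarrow> real"
      using meas[OF that] measurable_cong_sets[OF N_sets refl] by blast
    have N_prob: "prob_space (N n)" for n
    proof
      show "emeasure (N n) (space (N n)) = 1"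
        unfolding N_space using m2pos[of n] by (simp add: N_def fin ennreal_mult[symmetric])
    qed
    define P where "P n = distr (N n) borel s" for n
    have P_real: "real_distribution (P n)" for n
      unfolding P_def by (intro prob_space.real_distribution_distr N_prob N_meas s)
    have P_mass: "measure (P n) {-1<..2} = 1" for n
    proof -
      have "s -` {-1<..2} \<inter> space (N n) = space (N n)"
      proof -
        have "-1 < s z" "s z \<le> 2" for z using s(2,3)[of z] by linarith+
        then show ?thesis by auto
      qed
      then have "measure (P n) {-1<..2} = measure (N n) (space (N n))"
        unfolding P_def by (subst measure_distr) (auto intro: N_meas s)
      then show ?thesis using N_prob by (simp add: prob_space.prob_space)
    qed
    have "tight P"
      unfolding tight_def
    proof (intro conjI allI impI)
      show "real_distribution (P n)" for n by (rule P_real)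
      fix \<epsilon> :: real assume "0 < \<epsilon>"
      then show "\<exists>a b. a < b \<and> (\<forall>n. 1 - \<epsilon> < measure (P n) {a<..b})"
        by (intro exI[of _ "-1"] exI[of _ 2]) (simp add: P_mass)
    qed
    from tight_imp_convergent_subsubsequence[OF this strict_mono_id]
    obtain r3 \<nu> where r3: "strict_mono r3" and \<nu>: "real_distribution \<nu>" and wc: "weak_conv_m (P \<circ> r3) \<nu>"
      by auto
    interpret \<nu>: real_distribution \<nu> by (rule \<nu>)
    have \<gamma>_meas [measurable]: "\<gamma> \<in> borel_measurable borel" using \<gamma> by (rule borel_measurable_continuous_onI)
    have \<gamma>_meas' [measurable]: "\<gamma> \<in> borel_measurable \<nu>"
      using measurable_cong_sets[OF \<nu>.events_eq_borel refl] \<gamma>_meas by blast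
    \<comment> \<open>Mass may escape to the boundary, where \<gamma> leaves the open disc. The
      restriction discards it, and test functions do not see it.\<close>
    define \<mu> where "\<mu> = scale_measure (ennreal l) (restrict_space (distr \<nu> borel \<gamma>) unit_disc)"
    have "sets \<mu> = sets (restrict_space borel unit_disc)"
      by (simp add: \<mu>_def cong: sets_restrict_space_cong)
    then have \<mu>: "disc_borel_measure \<mu>" by (simp add: disc_borel_measure_def)
    have "converges_weakly (\<mu>s \<circ> (r2 \<circ> r3)) \<mu>"
      unfolding converges_weakly_def
    proof (intro allI impI)
      fix h assume "disc_test_function h"
      then obtain H B where H: "continuous_on UNIV H" "\<And>z. z \<in> unit_disc \<Longrightarrow> H z = h z" "\<And>z. z \<notin> unit_disc \<Longrightarrow> H z = 0"
        "\<And>z. 0 \<le> H z" "\<And>z::complex. H z \<le> B"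
        by (rule disc_test_function_extend) blast
      have H_meas [measurable]: "H \<in> borel_measurable borel" using H(1) by (rule borel_measurable_continuous_onI)
      define g where "g t = H (\<gamma> t)" for t
      have g: "continuous_on UNIV g" unfolding g_def
        by (rule continuous_on_compose2[OF H(1) \<gamma>]) simp
      have g_bd: "0 \<le> g t" "g t \<le> B" for t using H by (auto simp: g_def)
      let ?I = "\<lambda>n. \<integral>\<^sup>+z. ennreal (h z) \<partial>\<mu>s (r2 n)"
      have g_meas [measurable]: "g \<in> borel_measurable borel" using g by (rule borel_measurable_continuous_onI)
      have "(\<lambda>n. integral\<^sup>L ((P \<circ> r3) n) g) \<longlonglongrightarrow> integral\<^sup>L \<nu> g"
      proof (rule weak_conv_imp_integral_bdd_continuous_conv[OF _ \<nu> wc, of g B])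
        show "real_distribution ((P \<circ> r3) n)" for n using P_real by simp
        show "isCont g t" for t using g by (simp add: continuous_on_eq_continuous_at)
        show "norm (g t) \<le> B" for t using g_bd[of t] by simp
      qed
      then have lim: "(\<lambda>n. ennreal (m (r2 (r3 n)) * integral\<^sup>L (P (r3 n)) g)) \<longlonglongrightarrow> ennreal (l * integral\<^sup>L \<nu> g)"
        using LIMSEQ_subseq_LIMSEQ[OF m2 r3] by (intro tendsto_ennrealI tendsto_mult) (auto simp: o_def)
      have seq: "?I n = ennreal (m (r2 n) * integral\<^sup>L (P n) g)" for n
      proof -
        interpret P: real_distribution "P n" by (rule P_real)
        have "ennreal (integral\<^sup>L (P n) g) = (\<integral>\<^sup>+t. ennreal (g t) \<partial>P n)"
          using g_bd by (intro nn_integral_eq_integral[symmetric] P.integrable_const_bound[of _ B]) auto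
        also have "\<dots> = (\<integral>\<^sup>+z. ennreal (g (s z)) \<partial>N n)"
          unfolding P_def by (intro nn_integral_distr N_meas s) measurable
        also have "\<dots> = (\<integral>\<^sup>+z. ennreal (H z) \<partial>N n)"
          by (intro nn_integral_cong) (simp add: N_space g_def \<gamma>s)
        also have "\<dots> = ennreal (1 / m (r2 n)) * (\<integral>\<^sup>+z. ennreal (H z) \<partial>\<mu>s (r2 n))"
          unfolding N_def by (intro nn_integral_scale_measure measurable_compose[OF meas[OF H_meas]]) simp
        also have "(\<integral>\<^sup>+z. ennreal (H z) \<partial>\<mu>s (r2 n)) = ?I n"
          by (intro nn_integral_cong) (simp add: space H(2))
        finally have e: "ennreal (integral\<^sup>L (P n) g) = ennreal (1 / m (r2 n)) * ?I n" .
        have "ennreal (m (r2 n) * integral\<^sup>L (P n) g) = ennreal (m (r2 n)) * ennreal (integral\<^sup>L (P n) g)"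
          using m2pos[of n] g_bd by (intro ennreal_mult integral_nonneg) auto
        also have "\<dots> = (ennreal (m (r2 n)) * ennreal (1 / m (r2 n))) * ?I n"
          unfolding e by (simp only: mult.assoc)
        also have "ennreal (m (r2 n)) * ennreal (1 / m (r2 n)) = 1"
          using m2pos[of n] by (simp add: ennreal_mult[symmetric])
        finally show ?thesis by simp
      qed
      have "(\<integral>\<^sup>+z. ennreal (h z) \<partial>\<mu>) = ennreal (l * integral\<^sup>L \<nu> g)"
      proof -
        have "(\<integral>\<^sup>+z. ennreal (h z) \<partial>\<mu>) = (\<integral>\<^sup>+z. ennreal (H z) \<partial>\<mu>)"
          by (intro nn_integral_cong) (simp add: \<mu>_def space_scale_measure space_restrict_space H(2))
        also have "\<dots> = ennreal l * (\<integral>\<^sup>+z. ennreal (H z) \<partial>restrict_space (distr \<nu> borel \<gamma>) unit_disc)"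
          unfolding \<mu>_def by (intro nn_integral_scale_measure measurable_restrict_space1) simp
        also have "(\<integral>\<^sup>+z. ennreal (H z) \<partial>restrict_space (distr \<nu> borel \<gamma>) unit_disc)
            = (\<integral>\<^sup>+z. ennreal (H z) * indicator unit_disc z \<partial>distr \<nu> borel \<gamma>)"
          by (intro nn_integral_restrict_space) simp
        also have "\<dots> = (\<integral>\<^sup>+z. ennreal (H z) \<partial>distr \<nu> borel \<gamma>)"
          by (intro nn_integral_cong) (auto simp: indicator_def H(3))
        also have "\<dots> = (\<integral>\<^sup>+t. ennreal (g t) \<partial>\<nu>)"
          unfolding g_def by (intro nn_integral_distr) auto
        also have "\<dots> = ennreal (integral\<^sup>L \<nu> g)"
          using g_bd by (intro nn_integral_eq_integral \<nu>.integrable_const_bound[of _ B]) auto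
        finally show ?thesis using \<open>0 < l\<close> g_bd by (simp add: ennreal_mult)
      qed
      then show "(\<lambda>n. \<integral>\<^sup>+z. ennreal (h z) \<partial>(\<mu>s \<circ> (r2 \<circ> r3)) n) \<longlonglongrightarrow> (\<integral>\<^sup>+z. ennreal (h z) \<partial>\<mu>)"
        using lim by (simp add: seq)
    qed
    then show ?thesis using that[OF strict_mono_o[OF r2 r3] \<mu>] by blast
  qed
qed

section \<open>Carleson squares and the maximal function\<close>

lemma carleson_square_eq:
  assumes "a \<in> unit_disc" "a \<noteq> 0"
  shows "carleson_square a = {w \<in> unit_disc. cmod a < cmod w \<and> \<bar>Arg (a * cnj w)\<bar> < (1 - cmod a) / 2}"
proof (intro set_eqI iffI)
  fix w assume "w \<in> carleson_square a"
  then obtain r \<theta> where w: "w = of_real r * cis \<theta>" "cmod a < r" "r < 1" "\<bar>Arg (a * cis (- \<theta>))\<bar> < (1 - cmod a) / 2"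
    using assms(2) by (auto simp: carleson_square_def)
  have r: "0 < r" using w(2) norm_ge_zero[of a] by linarith
  have "a * cnj w = of_real r * (a * cis (- \<theta>))" using w(1) by (simp add: cis_cnj mult_ac)
  then have "Arg (a * cnj w) = Arg (a * cis (- \<theta>))" by (simp only: Arg_times_of_real[OF r])
  then show "w \<in> {w \<in> unit_disc. cmod a < cmod w \<and> \<bar>Arg (a * cnj w)\<bar> < (1 - cmod a) / 2}"
    using w r by (simp add: norm_mult)
next
  fix w assume w: "w \<in> {w \<in> unit_disc. cmod a < cmod w \<and> \<bar>Arg (a * cnj w)\<bar> < (1 - cmod a) / 2}"
  have r: "0 < cmod w" using w norm_ge_zero[of a] by auto
  have w_eq: "w = of_real (cmod w) * cis (Arg w)"
    using rcis_cmod_Arg[of w] by (simp add: rcis_def)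
  then have "cnj w = of_real (cmod w) * cis (- Arg w)" by (metis cis_cnj complex_cnj_complex_of_real complex_cnj_mult)
  then have "a * cnj w = of_real (cmod w) * (a * cis (- Arg w))" by (simp add: mult_ac)
  then have "Arg (a * cnj w) = Arg (a * cis (- Arg w))" by (simp only: Arg_times_of_real[OF r])
  then have "\<exists>r \<theta>. w = of_real r * cis \<theta> \<and> cmod a < r \<and> r < 1 \<and> \<bar>Arg (a * cis (- \<theta>))\<bar> < (1 - cmod a) / 2"
    using w w_eq by (intro exI[of _ "cmod w"] exI[of _ "Arg w"]) simp
  then show "w \<in> carleson_square a"
    using assms(2) unfolding carleson_square_def by simp
qed

text \<open>\<open>Arg\<close> jumps across the negative axis; the equivalent condition on
  \<open>Re\<close> and \<open>cmod\<close> makes the Borel measurability of Carleson squares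
  immediate.\<close>

lemma abs_Arg_less_iff:
  assumes "u \<noteq> 0" "0 \<le> c" "c \<le> pi"
  shows "\<bar>Arg u\<bar> < c \<longleftrightarrow> cmod u * cos c < Re u"
proof -
  have Re: "Re u = cmod u * cos \<bar>Arg u\<bar>"
    using arg_cong[OF rcis_cmod_Arg[of u], of Re] by simp
  have "\<bar>Arg u\<bar> \<le> pi" using Arg_le_pi[of u] mpi_less_Arg[of u] by auto
  then have "cos c < cos \<bar>Arg u\<bar> \<longleftrightarrow> \<bar>Arg u\<bar> < c"
    using assms(2,3) by (intro cos_mono_less_eq) auto
  moreover have "0 < cmod u" using assms(1) by simp
  ultimately show ?thesis unfolding Re by (simp only: mult_less_cancel_left_pos)
qed

lemma carleson_square_borel:
  assumes "a \<in> unit_disc"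
  shows "carleson_square a \<in> sets borel" "carleson_square a \<subseteq> unit_disc"
proof -
  have disc [measurable]: "unit_disc \<in> sets borel" by simp
  have "carleson_square a \<in> sets borel \<and> carleson_square a \<subseteq> unit_disc"
  proof (cases "a = 0")
    case False
    have c: "0 \<le> (1 - cmod a) / 2" "(1 - cmod a) / 2 \<le> pi"
      using assms pi_gt3 norm_ge_zero[of a] by (auto simp del: norm_ge_zero)
    have iff: "\<bar>Arg (a * cnj w)\<bar> < (1 - cmod a) / 2 \<longleftrightarrow> cmod (a * cnj w) * cos ((1 - cmod a) / 2) < Re (a * cnj w)"
      if "cmod a < cmod w" for w
      by (rule abs_Arg_less_iff[OF _ c]) (use that False in auto)
    have eq: "carleson_square a = {w \<in> space borel. w \<in> unit_disc \<and> cmod a < cmod w \<and>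
        cmod (a * cnj w) * cos ((1 - cmod a) / 2) < Re (a * cnj w)}"
      unfolding carleson_square_eq[OF assms False]
      by (rule Collect_cong) (simp only: space_borel UNIV_I simp_thms iff cong: conj_cong)
    have [measurable]: "cnj \<in> borel_measurable borel"
      by (intro borel_measurable_continuous_onI continuous_intros)
    have "carleson_square a \<in> sets borel" unfolding eq by measurable
    then show ?thesis unfolding carleson_square_eq[OF assms False] by blast
  qed (simp add: carleson_square_def)
  then show "carleson_square a \<in> sets borel" "carleson_square a \<subseteq> unit_disc" by auto
qed

text \<open>The choice a = (1 - 6\<delta>) \<zeta> makes the half angle 3\<delta>, which matches the
  factor 3 between arc and chord. Conversely the square has depth 6\<delta> and chords below
  3\<delta>, well within 16\<delta>. If 6\<delta> >= 1, both \<open>carleson_square 0\<close> and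
  the tent of scale 16\<delta> > 2 are the whole disc.\<close>

lemma tent_subset_carleson_square:
  assumes "cmod \<zeta> = 1" "0 < \<delta>"
  obtains a where "a \<in> unit_disc" "tent \<zeta> \<delta> \<subseteq> carleson_square a" "carleson_square a \<subseteq> tent \<zeta> (16 * \<delta>)"
proof (cases "6 * \<delta> < 1")
  case False
  have disc: "tent \<zeta> (16 * \<delta>) = unit_disc" by (rule tent_eq_disc[OF assms(1)]) (use False in linarith)
  have S: "carleson_square 0 = unit_disc" by (simp add: carleson_square_def)
  show ?thesis
  proof (rule that[of 0])
    show "tent \<zeta> \<delta> \<subseteq> carleson_square 0" unfolding S by (rule tent_subset_disc)
    show "carleson_square 0 \<subseteq> tent \<zeta> (16 * \<delta>)" unfolding S disc by (rule order_refl)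
  qed simp
next
  case True
  define a where "a = of_real (1 - 6 * \<delta>) * \<zeta>"
  have ca: "cmod a = 1 - 6 * \<delta>" using True assms unfolding a_def norm_mult norm_of_real by simp
  have a: "a \<in> unit_disc" "a \<noteq> 0" using ca True assms by auto
  have half: "(1 - cmod a) / 2 = 3 * \<delta>" by (simp add: ca)
  have Arg: "\<bar>Arg (a * cnj w)\<bar> \<le> 3 * cmod (sgn w - \<zeta>)" "cmod (sgn w - \<zeta>) \<le> \<bar>Arg (a * cnj w)\<bar>" if "w \<noteq> 0" for w
  proof -
    have "a * cnj w = of_real ((1 - 6 * \<delta>) * cmod w) * (\<zeta> * cnj (sgn w))"
      using that by (simp add: a_def sgn_eq)
    moreover have "0 < (1 - 6 * \<delta>) * cmod w" using True that by simp
    ultimately have A: "Arg (a * cnj w) = Arg (\<zeta> * cnj (sgn w))" by (simp only: Arg_times_of_real)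
    define e where "e = \<zeta> * cnj (sgn w)"
    have "cmod e = 1" using that assms by (simp add: e_def norm_mult norm_sgn)
    then have e: "cis (Arg e) = e" using rcis_cmod_Arg[of e] by (simp add: rcis_def)
    have "sgn w * cnj (sgn w) = 1" using that by (simp add: complex_norm_square[symmetric] norm_sgn)
    then have "sgn w - \<zeta> = - (sgn w * (e - 1))" by (simp add: e_def algebra_simps)
    then have "cmod (sgn w - \<zeta>) = cmod (e - 1)" using that by (simp add: norm_mult norm_sgn)
    also have "\<dots> = cmod (cis (Arg e) - cis 0)" by (simp add: e)
    finally have d: "cmod (sgn w - \<zeta>) = cmod (cis (Arg e) - cis 0)" .
    have "\<bar>Arg e - 0\<bar> \<le> pi" using Arg_le_pi[of e] mpi_less_Arg[of e] by auto
    from abs_le_cmod_cis_diff[OF this] cmod_cis_diff_le[of "Arg e" 0]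
    show "\<bar>Arg (a * cnj w)\<bar> \<le> 3 * cmod (sgn w - \<zeta>)" "cmod (sgn w - \<zeta>) \<le> \<bar>Arg (a * cnj w)\<bar>"
      unfolding A d e_def[symmetric] by (simp_all only: diff_0_right)
  qed
  show ?thesis
  proof (rule that[OF a(1)])
    show "tent \<zeta> \<delta> \<subseteq> carleson_square a"
    proof
      fix w assume w: "w \<in> tent \<zeta> \<delta>"
      then have "0 < cmod w" using True assms by (auto simp: tent_def)
      then have "w \<noteq> 0" by auto
      from Arg(1)[OF this] show "w \<in> carleson_square a"
        using w assms unfolding carleson_square_eq[OF a] half by (auto simp: tent_def ca)
    qed
    show "carleson_square a \<subseteq> tent \<zeta> (16 * \<delta>)"
    proof
      fix w assume w: "w \<in> carleson_square a"
      then have w': "w \<in> unit_disc" "1 - 6 * \<delta> < cmod w" "\<bar>Arg (a * cnj w)\<bar> < 3 * \<delta>"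
        unfolding carleson_square_eq[OF a] half by (auto simp: ca)
      then have "w \<noteq> 0" using True by auto
      from Arg(2)[OF this] show "w \<in> tent \<zeta> (16 * \<delta>)" using w' assms by (auto simp: tent_def)
    qed
  qed
qed

lemma disc_borel_space: "space \<mu> = unit_disc" if "disc_borel_measure \<mu>"
  using sets_eq_imp_space_eq[OF that[unfolded disc_borel_measure_def]] by (simp add: space_restrict_space)

lemma disc_borel_measurable:
  fixes g :: "complex \<Rightarrow> 'a::topological_space"
  assumes \<mu>: "disc_borel_measure \<mu>" and g: "g \<in> borel_measurable borel"
  shows "g \<in> borel_measurable \<mu>"
proof -
  have "g \<in> borel_measurable (restrict_space borel unit_disc)"
    by (rule measurable_restrict_space1[OF g])
  then show ?thesis
    by (simp only: measurable_cong_sets[OF \<mu>[unfolded disc_borel_measure_def] refl])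
qed

text \<open>An essential bound says nothing about a single point, but the tent inside the square has
  positive weight and must contain a point where the bound holds; the square competes in the
  supremum at that point.\<close>

lemma carleson_square_bound:
  assumes W: "doubling_radial (weight_measure \<omega>) \<kappa> D" and "weight \<omega>"
    and \<mu>: "disc_borel_measure \<mu>" and B: "esssup disc_area (maximal_function \<omega> \<mu>) \<le> ennreal B"
    and a: "a \<in> unit_disc" and \<zeta>: "cmod \<zeta> = 1" "0 < \<delta>" and sub: "tent \<zeta> \<delta> \<subseteq> carleson_square a"
  shows "emeasure \<mu> (carleson_square a) \<le> ennreal B * emeasure (weight_measure \<omega>) (carleson_square a)"
proof -
  interpret doubling_radial "weight_measure \<omega>" \<kappa> D by (rule W)
  let ?S = "carleson_square a" and ?W = "weight_measure \<omega>"
  have S: "?S \<in> sets ?W" by (intro borel_sets_W carleson_square_borel a)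
  have "AE z in disc_area. maximal_function \<omega> \<mu> z \<le> esssup disc_area (maximal_function \<omega> \<mu>)"
    by (rule esssup_AE)
  then have "AE z in disc_area. maximal_function \<omega> \<mu> z \<le> ennreal B"
    by eventually_elim (use B in order)
  then have AE_W: "AE z in ?W. maximal_function \<omega> \<mu> z \<le> ennreal B"
    unfolding weight_measure_def using \<open>weight \<omega>\<close>
    by (subst AE_density) (auto simp: weight_def elim: eventually_mono)
  have "\<exists>z\<in>tent \<zeta> \<delta>. maximal_function \<omega> \<mu> z \<le> ennreal B"
  proof (rule ccontr)
    assume "\<not> ?thesis"
    then have AE_tent: "AE z in ?W. z \<notin> tent \<zeta> \<delta>" using AE_W by (auto elim!: eventually_mono)
    have eq: "{z \<in> space ?W. \<not> z \<notin> tent \<zeta> \<delta>} = tent \<zeta> \<delta>"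
      unfolding space_W using tent_subset_disc by blast
    have "emeasure ?W (tent \<zeta> \<delta>) = 0"
      by (rule iffD1[OF AE_iff_measurable[OF tent_sets_W eq] AE_tent])
    then show False using tent_pos[OF \<zeta>] by simp
  qed
  then obtain z where z: "z \<in> tent \<zeta> \<delta>" "maximal_function \<omega> \<mu> z \<le> ennreal B" by blast
  have "emeasure \<mu> ?S / emeasure ?W ?S \<le> maximal_function \<omega> \<mu> z"
    unfolding maximal_function_def using a z(1) sub by (intro SUP_upper) auto
  also note z(2)
  finally have le: "emeasure \<mu> ?S / emeasure ?W ?S \<le> ennreal B" .
  have "0 < emeasure ?W (tent \<zeta> \<delta>)" by (rule tent_pos[OF \<zeta>])
  also have "\<dots> \<le> emeasure ?W ?S" using sub S by (rule emeasure_mono)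
  finally have pos: "0 < emeasure ?W ?S" .
  have "emeasure ?W ?S \<le> emeasure ?W unit_disc"
    using carleson_square_borel[OF a] by (intro emeasure_mono borel_sets_W) auto
  then have fin: "emeasure ?W ?S < \<infinity>" using finite_W by (rule order.strict_trans1)
  \<comment> \<open>Clearing the quotient requires that the weight of the square be neither 0 nor
    infinite.\<close>
  have "emeasure \<mu> ?S = emeasure \<mu> ?S / emeasure ?W ?S * emeasure ?W ?S"
    using pos fin by (simp add: ennreal_divide_times ennreal_divide_self)
  also have "\<dots> \<le> ennreal B * emeasure ?W ?S" by (intro mult_right_mono le) simp
  finally show ?thesis .
qed

section \<open>Convergence of sequences of Carleson measures\<close>

text \<open>A function holomorphic on the disc has arbitrary values elsewhere. Extending it by zero
  gives the global Borel function that \<open>carleson_embedding\<close> expects, without changing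
  any integral over the disc.\<close>

lemma borel_measurable_disc_extension:
  fixes f :: "complex \<Rightarrow> 'a::real_normed_vector"
  assumes "continuous_on unit_disc f"
  shows "(\<lambda>z. if z \<in> unit_disc then f z else 0) \<in> borel_measurable borel"
  using assms by (intro borel_measurable_continuous_on_if) auto

lemma holomorphic_disc_extension:
  assumes "f holomorphic_on unit_disc"
  shows "(\<lambda>z. if z \<in> unit_disc then f z else 0) holomorphic_on unit_disc"
  using assms by (rule holomorphic_transform) simp

lemma integral_pow_disc_extension:
  assumes "space \<mu> = unit_disc"
  shows "integral_pow p \<mu> (\<lambda>z. if z \<in> unit_disc then f z else 0) = integral_pow p \<mu> f"
  unfolding integral_pow_def by (rule nn_integral_cong) (simp add: assms)

lemma powr_half_square: "0 \<le> x \<Longrightarrow> (x powr (p / 2))\<^sup>2 = x powr p" for x p :: real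
  by (simp add: power2_eq_square flip: powr_add)

text \<open>Here the maximal function hypothesis is converted into one constant for all n. Each tent
  is enclosed in a square, and the square in a tent 16 times larger.\<close>

lemma maximal_function_embedding:
  fixes \<mu>s :: "nat \<Rightarrow> complex measure"
  assumes \<omega>: "\<omega> \<in> D_hat" "\<forall>z\<in>unit_disc. 0 < weight_tail \<omega> z"
    and borel: "\<And>n. disc_borel_measure (\<mu>s n)"
    and sup: "(SUP n. esssup disc_area (maximal_function \<omega> (\<mu>s n))) < \<infinity>"
    and p: "0 < p"
  obtains C M :: real where "0 < C" "\<And>n. emeasure (\<mu>s n) unit_disc \<le> ennreal M"
    "\<And>n f. f holomorphic_on unit_disc \<Longrightarrow> integral_pow p (\<mu>s n) f \<le> ennreal C * integral_pow p (weight_measure \<omega>) f"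
proof -
  obtain \<kappa> D where W: "doubling_radial (weight_measure \<omega>) \<kappa> D"
    using D_hat_doubling_radial[OF \<omega>] by blast
  interpret doubling_radial "weight_measure \<omega>" \<kappa> D by (rule W)
  let ?W = "weight_measure \<omega>"
  have "radial_weight \<omega>" using \<omega>(1) unfolding D_hat_def by blast
  then have "weight \<omega>" unfolding radial_weight_def by blast
  obtain B where B: "(SUP n. esssup disc_area (maximal_function \<omega> (\<mu>s n))) = ennreal B" "0 \<le> B"
    using sup by (cases "SUP n. esssup disc_area (maximal_function \<omega> (\<mu>s n))") auto
  have B_le: "esssup disc_area (maximal_function \<omega> (\<mu>s n)) \<le> ennreal B" for n
    unfolding B(1)[symmetric] by (rule SUP_upper) simp
  \<comment> \<open>Four doublings bring the scale 16\<delta> back to \<delta>.\<close>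
  define B' where "B' = B * K ^ 4"
  have K4: "0 \<le> K ^ 4" using K_ge_1 by simp
  have B': "0 \<le> B'" using B K4 by (simp add: B'_def)
  have carl: "emeasure (\<mu>s n) (tent \<zeta> \<delta>) \<le> ennreal B' * emeasure ?W (tent \<zeta> \<delta>)"
    if \<zeta>: "cmod \<zeta> = 1" "0 < \<delta>" for n \<zeta> \<delta>
  proof -
    obtain a where a: "a \<in> unit_disc" "tent \<zeta> \<delta> \<subseteq> carleson_square a" "carleson_square a \<subseteq> tent \<zeta> (16 * \<delta>)"
      using tent_subset_carleson_square[OF \<zeta>] by blast
    have "carleson_square a \<in> sets (\<mu>s n)"
      using borel[of n] carleson_square_borel[OF a(1)]
      unfolding disc_borel_measure_def by (simp add: sets_restrict_space_iff)
    then have "emeasure (\<mu>s n) (tent \<zeta> \<delta>) \<le> emeasure (\<mu>s n) (carleson_square a)"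
      by (rule emeasure_mono[OF a(2)])
    also have "\<dots> \<le> ennreal B * emeasure ?W (carleson_square a)"
      by (rule carleson_square_bound[OF W \<open>weight \<omega>\<close> borel B_le a(1) \<zeta> a(2)])
    also have "\<dots> \<le> ennreal B * emeasure ?W (tent \<zeta> (2 ^ 4 * \<delta>))"
      using a(3) by (intro mult_left_mono emeasure_mono tent_sets_W) auto
    also have "\<dots> \<le> ennreal B * (ennreal (K ^ 4) * emeasure ?W (tent \<zeta> \<delta>))"
      by (intro mult_left_mono tent_doubling_power \<zeta>) simp
    also have "\<dots> = ennreal B' * emeasure ?W (tent \<zeta> \<delta>)"
      using B K4 by (simp add: B'_def ennreal_mult mult.assoc)
    finally show ?thesis .
  qed
  \<comment> \<open>Any scale above 2 turns the tent condition into a bound on the total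
    mass.\<close>
  have disc: "tent 1 3 = unit_disc" by (rule tent_eq_disc) auto
  obtain m where m: "emeasure ?W unit_disc = ennreal m" "0 \<le> m"
    using finite_W by (cases "emeasure ?W unit_disc") auto
  have mass: "emeasure (\<mu>s n) unit_disc \<le> ennreal (B' * m)" for n
    using carl[of 1 3 n] B' m unfolding disc by (simp add: ennreal_mult)
  obtain C :: real where C: "0 < C"
    and emb: "\<And>f q \<mu> B. \<lbrakk>f holomorphic_on unit_disc; f \<in> borel_measurable borel; 0 < q;
      tent_bounded \<mu> B; emeasure \<mu> unit_disc < \<infinity>\<rbrakk>
      \<Longrightarrow> (\<integral>\<^sup>+z. ennreal ((cmod (f z) powr q)\<^sup>2) \<partial>\<mu>) \<le> ennreal (C * B) * (\<integral>\<^sup>+w. ennreal ((cmod (f w) powr q)\<^sup>2) \<partial>?W)"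
    using carleson_embedding by blast
  show ?thesis
  \<comment> \<open>The added 1 keeps the constant positive even when \<open>B'\<close> is
    0.\<close>
  proof (rule that[of "C * B' + 1" "B' * m"])
    show "0 < C * B' + 1" using C B' by (simp add: add_nonneg_pos)
    show "emeasure (\<mu>s n) unit_disc \<le> ennreal (B' * m)" for n by (rule mass)
    fix n f assume f: "f holomorphic_on unit_disc"
    let ?f = "\<lambda>z. if z \<in> unit_disc then f z else 0"
    have "emeasure (\<mu>s n) unit_disc < \<infinity>" using mass[of n] by (rule order.strict_trans1) simp
    then have "(\<integral>\<^sup>+z. ennreal ((cmod (?f z) powr (p / 2))\<^sup>2) \<partial>\<mu>s n)
        \<le> ennreal (C * B') * (\<integral>\<^sup>+w. ennreal ((cmod (?f w) powr (p / 2))\<^sup>2) \<partial>?W)"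
      using borel[of n] p B' carl unfolding disc_borel_measure_def
      by (intro emb holomorphic_disc_extension[OF f]
          borel_measurable_disc_extension[OF holomorphic_on_imp_continuous_on[OF f]]) (auto simp: tent_bounded_def)
    then have "integral_pow p (\<mu>s n) ?f \<le> ennreal (C * B') * integral_pow p ?W ?f"
      by (simp only: powr_half_square norm_ge_zero integral_pow_def)
    then have "integral_pow p (\<mu>s n) f \<le> ennreal (C * B') * integral_pow p ?W f"
      by (simp only: integral_pow_disc_extension disc_borel_space[OF borel] space_W)
    also have "\<dots> \<le> ennreal (C * B' + 1) * integral_pow p ?W f"
      by (intro mult_right_mono ennreal_leI) auto
    finally show "integral_pow p (\<mu>s n) f \<le> ennreal (C * B' + 1) * integral_pow p ?W f" .
  qed
qed

text \<open>Uniform integrability near the boundary comes for free by applying the embedding to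
  \<open>f z * z ^ k\<close> and letting \<open>k\<close> tend to infinity.\<close>

lemma embedding_imp_tight:
  fixes \<mu>s :: "nat \<Rightarrow> complex measure"
  assumes p: "0 < p" and f: "f \<in> bergman_space p \<omega>" and \<epsilon>: "(0::real) < \<epsilon>"
    and borel: "\<And>n. disc_borel_measure (\<mu>s n)"
    and emb: "\<And>n g. g holomorphic_on unit_disc \<Longrightarrow> integral_pow p (\<mu>s n) g \<le> ennreal C * integral_pow p (weight_measure \<omega>) g"
  obtains R where "0 < R" "R < 1"
    "\<And>n. (\<integral>\<^sup>+z. ennreal (cmod (f z) powr p) * indicator {z. R < cmod z} z \<partial>\<mu>s n) \<le> ennreal \<epsilon>"
proof -
  let ?W = "weight_measure \<omega>"
  have hol: "f holomorphic_on unit_disc" and fin: "integral_pow p ?W f < \<infinity>"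
    using f by (auto simp: bergman_space_def)
  define f' where "f' z = (if z \<in> unit_disc then f z else 0)" for z
  have f'_meas [measurable]: "f' \<in> borel_measurable borel"
    unfolding f'_def by (rule borel_measurable_disc_extension[OF holomorphic_on_imp_continuous_on[OF hol]])
  have W_meas: "g \<in> borel_measurable ?W" if "g \<in> borel_measurable borel" for g :: "complex \<Rightarrow> ennreal"
    unfolding measurable_cong_sets[OF sets_weight_measure refl]
    by (intro measurable_restrict_space1 measurable_completion) (use that in simp)
  have fin': "integral_pow p ?W f' < \<infinity>"
    using fin integral_pow_disc_extension[OF space_weight_measure, of p \<omega> f] by (simp add: f'_def[abs_def])
  have pw: "cmod (g * z ^ k) powr p = cmod g powr p * (cmod z ^ k) powr p" for g z :: complex and k :: nat
    by (simp add: norm_mult norm_power powr_mult)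
  have "(\<lambda>k. \<integral>\<^sup>+z. ennreal (cmod (f' z * z ^ k) powr p) \<partial>?W) \<longlonglongrightarrow> (\<integral>\<^sup>+z. 0 \<partial>?W)"
  proof (rule nn_integral_dominated_convergence[where w = "\<lambda>z. ennreal (cmod (f' z) powr p)"])
    show "(\<lambda>z. ennreal (cmod (f' z * z ^ k) powr p)) \<in> borel_measurable ?W" for k
      by (rule W_meas) measurable
    show "(\<lambda>z. ennreal (cmod (f' z) powr p)) \<in> borel_measurable ?W" by (rule W_meas) measurable
    show "(\<lambda>z. 0::ennreal) \<in> borel_measurable ?W" by simp
    show "(\<integral>\<^sup>+z. ennreal (cmod (f' z) powr p) \<partial>?W) < \<infinity>" using fin' by (simp add: integral_pow_def)
    show "AE z in ?W. ennreal (cmod (f' z * z ^ k) powr p) \<le> ennreal (cmod (f' z) powr p)" for k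
    proof (rule AE_I2)
      fix z assume "z \<in> space ?W"
      then have "cmod z \<le> 1" by (simp add: space_weight_measure)
      then have "cmod (f' z * z ^ k) \<le> cmod (f' z) * 1"
        unfolding norm_mult norm_power by (intro mult_left_mono power_le_one) auto
      then show "ennreal (cmod (f' z * z ^ k) powr p) \<le> ennreal (cmod (f' z) powr p)"
        using p by (intro ennreal_leI powr_mono2) auto
    qed
    show "AE z in ?W. (\<lambda>k. ennreal (cmod (f' z * z ^ k) powr p)) \<longlonglongrightarrow> 0"
    proof (rule AE_I2)
      fix z assume "z \<in> space ?W"
      then have "cmod z < 1" by (simp add: space_weight_measure)
      then have "(\<lambda>k. cmod z ^ k) \<longlonglongrightarrow> 0" by (intro LIMSEQ_power_zero) simp
      then have "(\<lambda>k. cmod (f' z * z ^ k)) \<longlonglongrightarrow> cmod (f' z) * 0"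
        unfolding norm_mult norm_power by (intro tendsto_mult tendsto_const)
      then have "(\<lambda>k. cmod (f' z * z ^ k) powr p) \<longlonglongrightarrow> (cmod (f' z) * 0) powr p"
        using p by (intro tendsto_powr2 tendsto_const) auto
      then show "(\<lambda>k. ennreal (cmod (f' z * z ^ k) powr p)) \<longlonglongrightarrow> 0"
        using tendsto_ennrealI by fastforce
    qed
  qed
  \<comment> \<open>The 2 compensates the lower bound 1/2 for |z|^(k p) outside radius
    \<open>R\<close>; the absolute value is there because the sign of \<open>C\<close> is not
    assumed.\<close>
  then have "(\<lambda>k. ennreal (2 * \<bar>C\<bar>) * (\<integral>\<^sup>+z. ennreal (cmod (f' z * z ^ k) powr p) \<partial>?W)) \<longlonglongrightarrow> ennreal (2 * \<bar>C\<bar>) * 0"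
    by (intro ennreal_tendsto_cmult) simp_all
  then have "\<forall>\<^sub>F k in sequentially. ennreal (2 * \<bar>C\<bar>) * (\<integral>\<^sup>+z. ennreal (cmod (f' z * z ^ k) powr p) \<partial>?W) < ennreal \<epsilon>"
    using \<epsilon> by (intro order_tendstoD(2)[where y = "ennreal (2 * \<bar>C\<bar>) * 0"]) auto
  then obtain k where k: "ennreal (2 * \<bar>C\<bar>) * (\<integral>\<^sup>+z. ennreal (cmod (f' z * z ^ k) powr p) \<partial>?W) < ennreal \<epsilon>"
    by (auto simp: eventually_sequentially)
  \<comment> \<open>With R = (1/2)^(1/e) the power R^(k p) is at least 1/2; the 1 in
    \<open>e\<close> avoids a zero exponent when k = 0 and keeps \<open>R\<close> below 1.\<close>
  define e where "e = real k * p + 1"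
  have e: "1 \<le> e" using p by (simp add: e_def)
  define R where "R = (1 / 2 :: real) powr (1 / e)"
  have R: "0 < R" "R < 1" using e powr_less_mono2[of "1 / e" "1 / 2" 1] by (auto simp: R_def)
  have R_ge: "1 / 2 \<le> (x ^ k) powr p" if "R < x" for x
  proof -
    have "(1 / 2 :: real) = (1 / 2) powr 1" by simp
    also have "\<dots> \<le> (1 / 2) powr (1 / e * (real k * p))"
    proof (rule powr_mono')
      have "real k * p / e \<le> 1" using e by (subst divide_le_eq_1_pos) (auto simp: e_def)
      then show "1 / e * (real k * p) \<le> 1" by simp
    qed auto
    also have "\<dots> = (R ^ k) powr p"
      using R(1) by (simp add: R_def powr_powr flip: powr_realpow)
    also have "\<dots> \<le> (x ^ k) powr p"
      using that R(1) p by (intro powr_mono2 power_mono) auto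
    finally show ?thesis .
  qed
  show ?thesis
  proof (rule that[OF R])
    fix n
    have "(\<integral>\<^sup>+z. ennreal (cmod (f z) powr p) * indicator {z. R < cmod z} z \<partial>\<mu>s n)
        \<le> (\<integral>\<^sup>+z. ennreal 2 * ennreal (cmod (f' z * z ^ k) powr p) \<partial>\<mu>s n)"
    proof (rule nn_integral_mono)
      fix z assume "z \<in> space (\<mu>s n)"
      then have z: "z \<in> unit_disc" by (simp add: disc_borel_space[OF borel])
      have "cmod (f z) powr p \<le> 2 * (cmod (f z) powr p * (cmod z ^ k) powr p)" if "R < cmod z"
        using mult_left_mono[OF R_ge[OF that], of "2 * cmod (f z) powr p"] by (simp add: mult_ac)
      then show "ennreal (cmod (f z) powr p) * indicator {z. R < cmod z} z \<le> ennreal 2 * ennreal (cmod (f' z * z ^ k) powr p)"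
        using z unfolding pw by (auto simp: indicator_def f'_def ennreal_mult[symmetric] intro!: ennreal_leI simp del: ennreal_numeral)
    qed
    also have "\<dots> = ennreal 2 * integral_pow p (\<mu>s n) (\<lambda>z. f' z * z ^ k)"
      unfolding integral_pow_def by (intro nn_integral_cmult disc_borel_measurable[OF borel]) measurable
    also have "\<dots> \<le> ennreal 2 * (ennreal C * integral_pow p ?W (\<lambda>z. f' z * z ^ k))"
      using holomorphic_disc_extension[OF hol]
      by (intro mult_left_mono emb holomorphic_intros) (simp_all add: f'_def[abs_def])
    also have "\<dots> \<le> ennreal 2 * (ennreal \<bar>C\<bar> * integral_pow p ?W (\<lambda>z. f' z * z ^ k))"
      by (intro mult_left_mono mult_right_mono ennreal_leI) auto
    also have "\<dots> = ennreal (2 * \<bar>C\<bar>) * integral_pow p ?W (\<lambda>z. f' z * z ^ k)"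
      by (subst ennreal_mult) (auto simp: mult.assoc simp del: ennreal_numeral)
    also have "\<dots> \<le> ennreal \<epsilon>" using k by (simp add: integral_pow_def less_imp_le)
    finally show "(\<integral>\<^sup>+z. ennreal (cmod (f z) powr p) * indicator {z. R < cmod z} z \<partial>\<mu>s n) \<le> ennreal \<epsilon>" .
  qed
qed

text \<open>Weak convergence applies to |f|^p times a cut-off. The upper limit is controlled by
  tightness, which makes the discarded part small uniformly in n; the lower limit by Fatou for
  \<mu>, so no integrability of |f|^p over \<mu> has to be known in advance.\<close>

lemma integral_pow_tendsto:
  fixes \<mu>s :: "nat \<Rightarrow> complex measure"
  assumes p: "0 < p" and hol: "f holomorphic_on unit_disc"
    and borel: "\<And>n. disc_borel_measure (\<mu>s n)" and borel_\<mu>: "disc_borel_measure \<mu>"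
    and conv: "converges_weakly \<mu>s \<mu>"
    and tight: "\<And>\<epsilon>::real. 0 < \<epsilon> \<Longrightarrow> \<exists>R. 0 < R \<and> R < 1 \<and>
      (\<forall>n. (\<integral>\<^sup>+z. ennreal (cmod (f z) powr p) * indicator {z. R < cmod z} z \<partial>\<mu>s n) \<le> ennreal \<epsilon>)"
  shows "(\<lambda>n. integral_pow p (\<mu>s n) f) \<longlonglongrightarrow> integral_pow p \<mu> f"
proof -
  \<comment> \<open>Equal to 1 up to radius R, equal to 0 from (1 + R)/2 on, linear in between,
    hence compactly supported in the disc.\<close>
  define \<psi> where "\<psi> R z = max 0 (min 1 (((1 + R) / 2 - cmod z) / ((1 - R) / 2)))" for R :: real and z :: complex
  have \<psi>_01: "0 \<le> \<psi> R z" "\<psi> R z \<le> 1" for R z by (auto simp: \<psi>_def)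
  have \<psi>_1: "\<psi> R z = 1" if "R < 1" "cmod z \<le> R" for R z
  proof -
    have "1 \<le> ((1 + R) / 2 - cmod z) / ((1 - R) / 2)" using that by (simp add: field_simps)
    then show ?thesis by (simp add: \<psi>_def)
  qed
  have \<psi>_0: "\<psi> R z = 0" if "R < 1" "(1 + R) / 2 \<le> cmod z" for R z
  proof -
    have "((1 + R) / 2 - cmod z) / ((1 - R) / 2) \<le> 0" using that by (intro divide_nonpos_pos) auto
    then show ?thesis by (simp add: \<psi>_def)
  qed
  define v where "v z = cmod (f z) powr p" for z
  define h where "h R z = \<psi> R z * v z" for R z
  have v: "0 \<le> v z" for z by (simp add: v_def)
  let ?a = "\<lambda>n. integral_pow p (\<mu>s n) f"
  let ?b = "\<lambda>R n. \<integral>\<^sup>+z. ennreal (h R z) \<partial>\<mu>s n"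
  let ?c = "\<lambda>R. \<integral>\<^sup>+z. ennreal (h R z) \<partial>\<mu>"
  have cont_v: "continuous_on unit_disc v"
    unfolding v_def using p
    by (intro continuous_on_powr' continuous_intros holomorphic_on_imp_continuous_on[OF hol]) auto
  have cont_\<psi>: "continuous_on UNIV (\<psi> R)" if "R < 1" for R
    unfolding \<psi>_def using that by (intro continuous_intros) auto
  have test: "disc_test_function (h R)" if "R < 1" for R
    unfolding disc_test_function_def
  proof (intro conjI exI[of _ "cball 0 ((1 + R) / 2)"] ballI)
    show "continuous_on unit_disc (h R)"
      unfolding h_def by (intro continuous_intros cont_v continuous_on_subset[OF cont_\<psi>[OF that]]) auto
    show "0 \<le> h R z" for z using \<psi>_01 v by (simp add: h_def)
    show "cball 0 ((1 + R) / 2) \<subseteq> unit_disc" using that by auto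
    show "h R z = 0" if "z \<in> unit_disc - cball 0 ((1 + R) / 2)" for z
      using \<psi>_0[OF \<open>R < 1\<close>, of z] that by (simp add: h_def)
  qed simp
  have h_le: "(\<integral>\<^sup>+z. ennreal (h R z) \<partial>N) \<le> integral_pow p N f" for R N
    unfolding integral_pow_def h_def v_def[symmetric]
    using \<psi>_01 v by (intro nn_integral_mono ennreal_leI mult_left_le_one_le) auto
  have meas: "(\<lambda>z. ennreal (g z)) \<in> borel_measurable N"
    if "continuous_on unit_disc g" "disc_borel_measure N" for g N
  proof -
    have "(\<lambda>z. ennreal (if z \<in> unit_disc then g z else 0)) \<in> borel_measurable N"
      by (intro disc_borel_measurable[OF that(2)] measurable_compose[OF borel_measurable_disc_extension[OF that(1)]]) simp
    then show ?thesis
      by (subst measurable_cong[of N _ "\<lambda>z. ennreal (if z \<in> unit_disc then g z else 0)"])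
         (simp_all add: disc_borel_space[OF that(2)])
  qed
  have lim: "(\<lambda>n. \<integral>\<^sup>+z. ennreal (h R z) \<partial>\<mu>s n) \<longlonglongrightarrow> ?c R" if "R < 1" for R
    using conv test[OF that] unfolding converges_weakly_def by blast
  have upper: "limsup ?a \<le> integral_pow p \<mu> f"
  proof (rule ennreal_le_epsilon)
    fix \<epsilon> :: real assume "0 < \<epsilon>"
    then obtain R where R: "0 < R" "R < 1"
      "\<And>n. (\<integral>\<^sup>+z. ennreal (cmod (f z) powr p) * indicator {z. R < cmod z} z \<partial>\<mu>s n) \<le> ennreal \<epsilon>"
      using tight by blast
    have le: "integral_pow p (\<mu>s n) f \<le> ?b R n + ennreal \<epsilon>" for n
    proof -
      have ind: "(\<lambda>z. indicator {z. R < cmod z} z :: ennreal) \<in> borel_measurable (\<mu>s n)"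
        by (intro disc_borel_measurable[OF borel]) measurable
      have "integral_pow p (\<mu>s n) f \<le> (\<integral>\<^sup>+z. ennreal (h R z) + ennreal (v z) * indicator {z. R < cmod z} z \<partial>\<mu>s n)"
        unfolding integral_pow_def v_def[symmetric]
      proof (rule nn_integral_mono)
        fix z
        show "ennreal (v z) \<le> ennreal (h R z) + ennreal (v z) * indicator {z. R < cmod z} z"
          using \<psi>_1[OF R(2), of z] by (cases "R < cmod z") (auto simp: h_def not_less)
      qed
      also have "\<dots> = ?b R n + (\<integral>\<^sup>+z. ennreal (v z) * indicator {z. R < cmod z} z \<partial>\<mu>s n)"
        using test[OF R(2)] by (intro nn_integral_add borel_measurable_times_ennreal meas cont_v borel ind)
          (auto simp: disc_test_function_def)
      also have "\<dots> \<le> ?b R n + ennreal \<epsilon>"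
        unfolding v_def by (intro add_left_mono R(3))
      finally show ?thesis .
    qed
    have "(\<lambda>n. ?b R n + ennreal \<epsilon>) \<longlonglongrightarrow> ?c R + ennreal \<epsilon>"
      by (intro tendsto_add lim R tendsto_const)
    then have "limsup (\<lambda>n. ?b R n + ennreal \<epsilon>) = ?c R + ennreal \<epsilon>"
      by (intro lim_imp_Limsup) auto
    moreover have "limsup ?a \<le> limsup (\<lambda>n. ?b R n + ennreal \<epsilon>)"
      by (intro Limsup_mono always_eventually allI le)
    ultimately have "limsup ?a \<le> ?c R + ennreal \<epsilon>" by simp
    also have "\<dots> \<le> integral_pow p \<mu> f + ennreal \<epsilon>" by (intro add_right_mono h_le)
    finally show "limsup ?a \<le> integral_pow p \<mu> f + ennreal \<epsilon>" .
  qed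
  \<comment> \<open>The cut-offs with R tending to 1 converge pointwise to 1, and each cut-off
    integral is the limit of integrals below \<open>?a n\<close>.\<close>
  have lower: "integral_pow p \<mu> f \<le> liminf ?a"
  proof -
    define R where "R j = 1 - inverse (real (Suc j))" for j
    have R: "R j < 1" for j by (simp add: R_def)
    have "integral_pow p \<mu> f = (\<integral>\<^sup>+z. liminf (\<lambda>j. ennreal (h (R j) z)) \<partial>\<mu>)"
      unfolding integral_pow_def v_def[symmetric]
    proof (rule nn_integral_cong)
      fix z assume "z \<in> space \<mu>"
      then have z: "cmod z < 1" by (simp add: disc_borel_space[OF borel_\<mu>])
      have "R \<longlonglongrightarrow> 1 - 0"
        unfolding R_def by (intro tendsto_diff tendsto_const LIMSEQ_inverse_real_of_nat)
      then have "\<forall>\<^sub>F j in sequentially. cmod z < R j" using z by (intro order_tendstoD) auto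
      then have "\<forall>\<^sub>F j in sequentially. ennreal (h (R j) z) = ennreal (v z)"
        by eventually_elim (simp add: h_def \<psi>_1[OF R])
      then have "(\<lambda>j. ennreal (h (R j) z)) \<longlonglongrightarrow> ennreal (v z)" by (rule tendsto_eventually)
      then show "ennreal (v z) = liminf (\<lambda>j. ennreal (h (R j) z))"
        by (intro lim_imp_Liminf[symmetric]) auto
    qed
    also have "\<dots> \<le> liminf (\<lambda>j. \<integral>\<^sup>+z. ennreal (h (R j) z) \<partial>\<mu>)"
      using test[OF R] by (intro nn_integral_liminf meas borel_\<mu>) (auto simp: disc_test_function_def)
    also have "\<dots> \<le> liminf (\<lambda>j::nat. liminf ?a)"
    proof (intro Liminf_mono always_eventually allI)
      fix j
      have "(\<integral>\<^sup>+z. ennreal (h (R j) z) \<partial>\<mu>) = liminf (\<lambda>n. \<integral>\<^sup>+z. ennreal (h (R j) z) \<partial>\<mu>s n)"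
        by (intro lim_imp_Liminf[symmetric] lim R) auto
      also have "\<dots> \<le> liminf ?a"
        by (intro Liminf_mono always_eventually allI h_le)
      finally show "(\<integral>\<^sup>+z. ennreal (h (R j) z) \<partial>\<mu>) \<le> liminf ?a" .
    qed
    also have "\<dots> = liminf ?a" by (intro Liminf_const) simp
    finally show ?thesis .
  qed
  have "liminf ?a \<le> limsup ?a"
    by (rule Liminf_le_Limsup) simp
  with lower upper show ?thesis by (intro Liminf_eq_Limsup) auto
qed

section \<open>From integrals of p-th powers to norms\<close>

lemma Lp_norm_mono:
  assumes p: "0 < p" and C: "0 < C" and le: "integral_pow p \<mu> f \<le> ennreal C * integral_pow p \<nu> f"
    and fin: "integral_pow p \<nu> f < \<infinity>"
  shows "Lp_norm p \<mu> f \<le> ennreal (C powr (1 / p)) * Lp_norm p \<nu> f"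
proof -
  obtain y where y: "integral_pow p \<nu> f = ennreal y" "0 \<le> y"
    using fin by (cases "integral_pow p \<nu> f") auto
  have le': "integral_pow p \<mu> f \<le> ennreal (C * y)" using le C y by (simp add: ennreal_mult)
  then obtain x where x: "integral_pow p \<mu> f = ennreal x" "0 \<le> x"
    by (metis ennreal_cases ennreal_less_top leD)
  have "x \<le> C * y" using le' x C y by (simp add: ennreal_le_iff)
  then have "x powr (1 / p) \<le> (C * y) powr (1 / p)" using x p by (intro powr_mono2) auto
  also have "\<dots> = C powr (1 / p) * y powr (1 / p)" by (rule powr_mult)
  finally have "ennreal (x powr (1 / p)) \<le> ennreal (C powr (1 / p) * y powr (1 / p))" by (rule ennreal_leI)
  then show ?thesis using x y by (simp add: Lp_norm_def ennreal_mult)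
qed

lemma Lp_norm_tendsto:
  assumes p: "0 < p" and lim: "(\<lambda>n. integral_pow p (\<mu>s n) f) \<longlonglongrightarrow> integral_pow p \<mu> f"
    and fin: "\<And>n. integral_pow p (\<mu>s n) f < \<infinity>" "integral_pow p \<mu> f < \<infinity>"
  shows "(\<lambda>n. Lp_norm p (\<mu>s n) f) \<longlonglongrightarrow> Lp_norm p \<mu> f"
proof -
  obtain y where y: "integral_pow p \<mu> f = ennreal y" "0 \<le> y"
    using fin(2) by (cases "integral_pow p \<mu> f") auto
  have "(\<lambda>n. enn2real (integral_pow p (\<mu>s n) f)) \<longlonglongrightarrow> y"
    using lim y by (intro tendsto_enn2real) auto
  then have "(\<lambda>n. enn2real (integral_pow p (\<mu>s n) f) powr (1 / p)) \<longlonglongrightarrow> y powr (1 / p)"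
    using p by (intro tendsto_powr2 tendsto_const) auto
  then have "(\<lambda>n. ennreal (enn2real (integral_pow p (\<mu>s n) f) powr (1 / p))) \<longlonglongrightarrow> ennreal (y powr (1 / p))"
    by (rule tendsto_ennrealI)
  moreover have "integral_pow p (\<mu>s n) f \<noteq> top" for n using fin(1)[of n] by simp
  ultimately show ?thesis using y by (simp add: Lp_norm_def)
qed

lemma Lp_norm_le_embedding_norm:
  assumes "carleson_measure p \<omega> \<mu>" and f: "f \<in> bergman_space p \<omega>" and pos: "0 < bergman_norm p \<omega> f"
  shows "Lp_norm p \<mu> f / bergman_norm p \<omega> f \<le> embedding_norm p \<omega> \<mu>"
  unfolding embedding_norm_def
proof (rule Inf_greatest)
  fix C assume "C \<in> {C. \<forall>f\<in>bergman_space p \<omega>. Lp_norm p \<mu> f \<le> C * bergman_norm p \<omega> f}"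
  then have "Lp_norm p \<mu> f \<le> bergman_norm p \<omega> f * C" using f by (simp add: mult.commute)
  with pos show "Lp_norm p \<mu> f / bergman_norm p \<omega> f \<le> C" by (rule divide_le_posI_ennreal)
qed

theorem theorem11:
  fixes p :: real and \<omega> :: "complex \<Rightarrow> real" and \<mu>s :: "nat \<Rightarrow> complex measure"
  assumes "0 < p"
    and "\<omega> \<in> D_hat"
    and "\<forall>z\<in>unit_disc. 0 < weight_tail \<omega> z"
    and "\<forall>n. carleson_measure p \<omega> (\<mu>s n)"
    and "(SUP n. esssup disc_area (maximal_function \<omega> (\<mu>s n))) < \<infinity>"
  shows "(\<exists>r \<mu>. strict_mono r \<and> disc_borel_measure \<mu> \<and> converges_weakly (\<mu>s \<circ> r) \<mu>) \<and>
    (\<forall>\<mu>. disc_borel_measure \<mu> \<and> converges_weakly \<mu>s \<mu> \<longrightarrow>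
      (\<forall>f \<in> bergman_space p \<omega>. (\<lambda>n. integral_pow p (\<mu>s n) f) \<longlonglongrightarrow> integral_pow p \<mu> f) \<and>
      carleson_measure p \<omega> \<mu> \<and>
      embedding_norm p \<omega> \<mu> \<le> liminf (\<lambda>n. embedding_norm p \<omega> (\<mu>s n)) \<and>
      (\<forall>\<Lambda>>0. (\<forall>n. sampling_measure p \<omega> (\<mu>s n) \<and> sampling_constant_le p \<omega> (\<mu>s n) \<Lambda>) \<longrightarrow>
        sampling_measure p \<omega> \<mu> \<and> sampling_constant_le p \<omega> \<mu> \<Lambda>))"
proof -
  have borel: "\<And>n. disc_borel_measure (\<mu>s n)" using assms(4) unfolding carleson_measure_def by blast
  obtain C M :: real where C: "0 < C" and mass: "\<And>n. emeasure (\<mu>s n) unit_disc \<le> ennreal M"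
    and emb: "\<And>n f. f holomorphic_on unit_disc \<Longrightarrow>
      integral_pow p (\<mu>s n) f \<le> ennreal C * integral_pow p (weight_measure \<omega>) f"
    using maximal_function_embedding[OF assms(2,3) borel assms(5,1)] by blast
  have "\<exists>r \<mu>. strict_mono r \<and> disc_borel_measure \<mu> \<and> converges_weakly (\<mu>s \<circ> r) \<mu>"
    by (rule vague_compactness[of \<mu>s M, OF borel mass]) blast
  moreover have "(\<forall>f \<in> bergman_space p \<omega>. (\<lambda>n. integral_pow p (\<mu>s n) f) \<longlonglongrightarrow> integral_pow p \<mu> f) \<and>
      carleson_measure p \<omega> \<mu> \<and>
      embedding_norm p \<omega> \<mu> \<le> liminf (\<lambda>n. embedding_norm p \<omega> (\<mu>s n)) \<and>
      (\<forall>\<Lambda>>0. (\<forall>n. sampling_measure p \<omega> (\<mu>s n) \<and> sampling_constant_le p \<omega> (\<mu>s n) \<Lambda>) \<longrightarrow>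
        sampling_measure p \<omega> \<mu> \<and> sampling_constant_le p \<omega> \<mu> \<Lambda>)"
    if \<mu>: "disc_borel_measure \<mu>" and conv: "converges_weakly \<mu>s \<mu>" for \<mu>
  proof -
    have hol: "f holomorphic_on unit_disc" and fin: "integral_pow p (weight_measure \<omega>) f < \<infinity>"
      if "f \<in> bergman_space p \<omega>" for f
      using that by (simp_all add: bergman_space_def)
    have lim: "(\<lambda>n. integral_pow p (\<mu>s n) f) \<longlonglongrightarrow> integral_pow p \<mu> f" if f: "f \<in> bergman_space p \<omega>" for f
    proof (rule integral_pow_tendsto[where \<mu>s = \<mu>s, OF assms(1) hol[OF f] borel \<mu> conv])
      fix \<epsilon> :: real assume "0 < \<epsilon>"
      show "\<exists>R. 0 < R \<and> R < 1 \<and>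
        (\<forall>n. (\<integral>\<^sup>+z. ennreal (cmod (f z) powr p) * indicator {z. R < cmod z} z \<partial>\<mu>s n) \<le> ennreal \<epsilon>)"
        by (rule embedding_imp_tight[where \<mu>s = \<mu>s, OF assms(1) f \<open>0 < \<epsilon>\<close> borel emb]) blast+
    qed
    \<comment> \<open>The uniform embedding passes to the limit function by function; it makes \<mu>
      a Carleson measure and all integrals involved finite.\<close>
    have emb_\<mu>: "integral_pow p \<mu> f \<le> ennreal C * integral_pow p (weight_measure \<omega>) f"
      if f: "f \<in> bergman_space p \<omega>" for f
      by (rule LIMSEQ_le_const2[OF lim[OF f]]) (use emb[OF hol[OF f]] in auto)
    have emb_fin: "ennreal C * integral_pow p (weight_measure \<omega>) f < \<infinity>" if "f \<in> bergman_space p \<omega>" for f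
      using fin[OF that] by (simp add: ennreal_mult_less_top)
    have Lp_lim: "(\<lambda>n. Lp_norm p (\<mu>s n) f) \<longlonglongrightarrow> Lp_norm p \<mu> f" if f: "f \<in> bergman_space p \<omega>" for f
      by (rule Lp_norm_tendsto[where \<mu>s = \<mu>s, OF assms(1) lim[OF f]
            order.strict_trans1[OF emb[OF hol[OF f]] emb_fin[OF f]]
            order.strict_trans1[OF emb_\<mu>[OF f] emb_fin[OF f]]])
    have Lp_le: "Lp_norm p \<mu> f \<le> ennreal (C powr (1 / p)) * bergman_norm p \<omega> f"
      if f: "f \<in> bergman_space p \<omega>" for f
      by (rule Lp_norm_mono[OF assms(1) C emb_\<mu>[OF f] fin[OF f]])
    have carl: "carleson_measure p \<omega> \<mu>"
      unfolding carleson_measure_def using \<mu> Lp_le by blast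
    \<comment> \<open>The embedding norm is an infimum of admissible constants, so it suffices that
      the lower limit is itself admissible for each f.\<close>
    have "embedding_norm p \<omega> \<mu> \<le> liminf (\<lambda>n. embedding_norm p \<omega> (\<mu>s n))"
      unfolding embedding_norm_def[of p \<omega> \<mu>]
    proof (rule Inf_lower, rule CollectI, rule ballI)
      fix f assume f: "f \<in> bergman_space p \<omega>"
      let ?x = "bergman_norm p \<omega> f"
      have x: "?x < \<infinity>" using fin[OF f] by (simp add: Lp_norm_def)
      show "Lp_norm p \<mu> f \<le> liminf (\<lambda>n. embedding_norm p \<omega> (\<mu>s n)) * ?x"
      proof (cases "?x = 0")
        case True
        then show ?thesis using Lp_le[OF f] by simp
      next
        case False
        then have pos: "0 < ?x" by (simp add: zero_less_iff_neq_zero)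
        have "(\<lambda>n. inverse ?x * Lp_norm p (\<mu>s n) f) \<longlonglongrightarrow> inverse ?x * Lp_norm p \<mu> f"
        proof (rule ennreal_tendsto_cmult[OF _ Lp_lim[OF f]])
          show "inverse ?x < top" using False by (simp add: less_top[symmetric])
        qed
        then have "Lp_norm p \<mu> f / ?x = liminf (\<lambda>n. Lp_norm p (\<mu>s n) f / ?x)"
          by (intro lim_imp_Liminf[symmetric]) (simp_all add: divide_ennreal_def mult.commute)
        also have "\<dots> \<le> liminf (\<lambda>n. embedding_norm p \<omega> (\<mu>s n))"
          using assms(4) f pos by (intro Liminf_mono always_eventually allI Lp_norm_le_embedding_norm) auto
        finally have "Lp_norm p \<mu> f / ?x * ?x \<le> liminf (\<lambda>n. embedding_norm p \<omega> (\<mu>s n)) * ?x"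
          by (rule mult_right_mono) simp
        moreover have "Lp_norm p \<mu> f / ?x * ?x = Lp_norm p \<mu> f"
          using False x by (simp add: ennreal_divide_times ennreal_divide_self)
        ultimately show ?thesis by simp
      qed
    qed
    moreover have "sampling_measure p \<omega> \<mu> \<and> sampling_constant_le p \<omega> \<mu> \<Lambda>"
      if "0 < \<Lambda>" and samp: "\<forall>n. sampling_measure p \<omega> (\<mu>s n) \<and> sampling_constant_le p \<omega> (\<mu>s n) \<Lambda>" for \<Lambda>
    proof -
      have "sampling_constant_le p \<omega> \<mu> \<Lambda>"
        unfolding sampling_constant_le_def
      proof (intro ballI conjI)
        fix f assume f: "f \<in> bergman_space p \<omega>"
        have *: "ennreal (1 / \<Lambda>) * integral_pow p (weight_measure \<omega>) f \<le> integral_pow p (\<mu>s n) f"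
          "integral_pow p (\<mu>s n) f \<le> ennreal \<Lambda> * integral_pow p (weight_measure \<omega>) f" for n
          using samp f unfolding sampling_constant_le_def by blast+
        show "ennreal (1 / \<Lambda>) * integral_pow p (weight_measure \<omega>) f \<le> integral_pow p \<mu> f"
          by (rule LIMSEQ_le_const[OF lim[OF f]]) (use * in auto)
        show "integral_pow p \<mu> f \<le> ennreal \<Lambda> * integral_pow p (weight_measure \<omega>) f"
          by (rule LIMSEQ_le_const2[OF lim[OF f]]) (use * in auto)
      qed
      then show ?thesis using \<mu> \<open>0 < \<Lambda>\<close> unfolding sampling_measure_def by blast
    qed
    ultimately show ?thesis using lim carl by blast
  qed
  ultimately show ?thesis by blast
qed

end
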